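(* Let $(\Sigma,\sigma)$ be an irreducible subshift of finite type. Let $F\colon\Sigma\to(0,\infty)$ be a potential with $\alpha$-bounded Hölder variations for some $\alpha>0$. Let $\mathcal L$ be the corresponding transfer operator and $\rho$ its spectral radius. Let $G$ be a finitely generated group and $\theta\colon\Sigma\to G$ a locally constant map. Assume that the corresponding extension $(\Sigma_\theta,\sigma_\theta)$ has the visibility property. Let $Y$ be a set endowed with an action of $G$ and $\lambda\colon G\to\mathcal U(\mathcal H)$ the induced unitary representation, where $\mathcal H=\ell^2(Y)$. Let $\rho_\lambda$ be the spectral radius of the twisted transfer operator $\mathcal L_\lambda\colon H^\infty_\alpha(\Sigma,\mathcal H)\to H^\infty_\alpha(\Sigma,\mathcal H)$ defined by $$\mathcal L_\lambda\Phi(x)=\sum_{\sigma y=x}F(y)\lambda(\theta(y))^{-1}\Phi(y).$$ The following statements are equivalent: (i) the action of $G$ on $Y$ is amenable; (ii) $\rho$ belongs to the spectrum of $\mathcal L_\lambda$; (iii) $\rho_\lambda=\rho$.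
   Context: Subshifts: let $\mathcal A$ be a finite alphabet, $\sigma$ the shift on $\mathcal A^{\mathbb N}$, and $d(x,y)=e^{-n}$ where $n$ is the length of the longest common prefix of $x,y$. A subshift $\Sigma\subset\mathcal A^{\mathbb N}$ is a closed $\sigma$-invariant subset; a finite word is admissible if it is a prefix of an element of $\Sigma$. $\Sigma$ is of finite type if there is $N$ such that $x\in\mathcal A^{\mathbb N}$ belongs to $\Sigma$ iff every subword of length $N$ of $x$ is admissible. It is irreducible (topologically transitive) if for all admissible words $w,w'$ there is an admissible word $w_0$ such that $ww_0w'$ is admissible. Function spaces: for a Banach space $E$ and $\Phi\colon\Sigma\to E$, let $\|\Phi\|_\infty=\sup_x\|\Phi(x)\|$, $\Delta_\alpha(\Phi)=\sup_{x\ne y}\|\Phi(x)-\Phi(y)\|/d(x,y)^\alpha$, $\|\Phi\|_{\infty,\alpha}=\|\Phi\|_\infty+\Delta_\alpha(\Phi)$, and $H^\infty_\alpha(\Sigma,E)=\{\Phi:\|\Phi\|_{\infty,\alpha}<\infty\}$, a Banach space. "$F$ has $\alpha$-bounded Hölder variations" means $\ln F\in H^\infty_\alpha(\Sigma,\mathbb R)$ (equivalently $F\in H^\infty_\alpha(\Sigma,\mathbb R)$). $\mathcal L\Phi(x)=\sum_{\sigma y=x}F(y)\Phi(y)$ is viewed as a bounded operator of $H^\infty_\alpha(\Sigma,\mathbb C)$. The induced representation is $[\lambda(g)\phi](y)=\phi(g^{-1}y)$. Extension: $\Sigma_\theta=\Sigma\times G$, $\sigma_\theta(x,g)=(\sigma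 x,g\theta(x))$; $\theta_n(x)=\theta(x)\theta(\sigma x)\cdots\theta(\sigma^{n-1}x)$, $\theta_0=1$. It has the visibility property if there is a finite subset $U\subset G$ such that for every $g\in G$ there are $x\in\Sigma$, $n\in\mathbb N$, $u_1,u_2\in U$ with $g=u_1\theta_n(x)u_2$. The action of $G$ on $Y$ is amenable if $\lambda$ has almost invariant vectors: for all finite $S\subset G$ and $\epsilon>0$ there is $\phi\in\mathcal H$ with $\sup_{s\in S}\|\lambda(s)\phi-\phi\|<\epsilon\|\phi\|$. *)

theory Defs
  imports
    "HOL-Analysis.Analysis"
    "HOL-Algebra.Generated_Groups"
    "HOL-Algebra.Group_Action"
    "HOL-Library.Function_Algebras"
    "HOL-Library.Omega_Words_Fun"
begin

section \<open>Subshifts\<close>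

text \<open>For \<open>x \<noteq> y\<close>, the least index at which the two words differ is the length of
  their longest common prefix.\<close>

definition word_dist :: "'a word \<Rightarrow> 'a word \<Rightarrow> real" where
  "word_dist x y = (if x = y then 0 else exp (- real (LEAST n. x n \<noteq> y n)))"

lemma Metric_space_word_dist: "Metric_space UNIV (word_dist :: 'a word \<Rightarrow> 'a word \<Rightarrow> real)"
proof
  fix x y z :: "'a word"
  show "0 \<le> word_dist x y" by (simp add: word_dist_def)
  have "(\<lambda>n. x n \<noteq> y n) = (\<lambda>n. y n \<noteq> x n)" by (intro ext) metis
  then show "word_dist x y = word_dist y x" by (auto simp: word_dist_def)
  show "word_dist x y = 0 \<longleftrightarrow> x = y" by (simp add: word_dist_def)
  show "word_dist x z \<le> word_dist x y + word_dist y z"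
  proof (cases "x = y \<or> y = z \<or> x = z")
    case True
    then show ?thesis by (auto simp: word_dist_def)
  next
    case False
    define k where "k = (LEAST n. x n \<noteq> z n)"
    have "\<exists>n. x n \<noteq> z n" using False by (auto simp: fun_eq_iff)
    then have "x k \<noteq> z k" unfolding k_def by (rule LeastI_ex)
    then have "x k \<noteq> y k \<or> y k \<noteq> z k" by metis
    then have "(LEAST n. x n \<noteq> y n) \<le> k \<or> (LEAST n. y n \<noteq> z n) \<le> k"
      by (auto intro: Least_le)
    then have "word_dist x z \<le> word_dist x y \<or> word_dist x z \<le> word_dist y z"
      using False by (auto simp: word_dist_def k_def)
    moreover have "0 \<le> word_dist x y" "0 \<le> word_dist y z"
      by (simp_all add: word_dist_def)
    ultimately show ?thesis by linarith
  qed
qed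

abbreviation word_topology :: "'a word topology" where
  "word_topology \<equiv> Metric_space.mtopology UNIV word_dist"

abbreviation shift :: "'a word \<Rightarrow> 'a word" where
  "shift \<equiv> suffix 1"

definition subshift :: "'a::finite word set \<Rightarrow> bool" where
  "subshift \<Sigma> \<longleftrightarrow> closedin word_topology \<Sigma> \<and> shift ` \<Sigma> \<subseteq> \<Sigma>"

definition admissible_word :: "'a word set \<Rightarrow> 'a list \<Rightarrow> bool" where
  "admissible_word \<Sigma> w \<longleftrightarrow> (\<exists>x\<in>\<Sigma>. prefix (length w) x = w)"

definition finite_type :: "'a word set \<Rightarrow> bool" where
  "finite_type \<Sigma> \<longleftrightarrow>
     (\<exists>N. \<forall>x. x \<in> \<Sigma> \<longleftrightarrow> (\<forall>i. admissible_word \<Sigma> (subsequence x i (i + N))))"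

definition irreducible_shift :: "'a word set \<Rightarrow> bool" where
  "irreducible_shift \<Sigma> \<longleftrightarrow>
     (\<forall>w w'. admissible_word \<Sigma> w \<longrightarrow> admissible_word \<Sigma> w' \<longrightarrow>
        (\<exists>w0. admissible_word \<Sigma> w0 \<and> admissible_word \<Sigma> (w @ w0 @ w')))"

definition locally_constant_on :: "'a word set \<Rightarrow> ('a word \<Rightarrow> 'b) \<Rightarrow> bool" where
  "locally_constant_on \<Sigma> f \<longleftrightarrow>
     (\<forall>x\<in>\<Sigma>. \<exists>U. openin word_topology U \<and> x \<in> U \<and> (\<forall>y\<in>U \<inter> \<Sigma>. f y = f x))"


section \<open>Operators on complex normed spaces\<close>

class complex_vector = ab_group_add +
  fixes scaleC :: "complex \<Rightarrow> 'a \<Rightarrow> 'a" (infixr "*\<^sub>C" 75)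
  assumes scaleC_add_right: "c *\<^sub>C (u + v) = c *\<^sub>C u + c *\<^sub>C v"
    and scaleC_add_left: "(b + c) *\<^sub>C v = b *\<^sub>C v + c *\<^sub>C v"
    and scaleC_scaleC: "b *\<^sub>C c *\<^sub>C v = (b * c) *\<^sub>C v"
    and scaleC_one: "1 *\<^sub>C v = v"

instantiation complex :: complex_vector
begin
definition scaleC_complex :: "complex \<Rightarrow> complex \<Rightarrow> complex" where
  "scaleC_complex = (*)"
instance by standard (simp_all add: scaleC_complex_def algebra_simps)
end

instantiation "fun" :: (type, complex_vector) complex_vector
begin
definition scaleC_fun :: "complex \<Rightarrow> ('a \<Rightarrow> 'b) \<Rightarrow> 'a \<Rightarrow> 'b" where
  "scaleC_fun c f = (\<lambda>x. c *\<^sub>C f x)"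
instance
  by standard
    (simp_all add: scaleC_fun_def fun_eq_iff scaleC_add_right scaleC_add_left
      scaleC_scaleC scaleC_one)
end

text \<open>A normed space is given by a linear subspace \<open>V\<close> of the ambient type together with a
  norm \<open>nrm\<close> on it; operators are only considered on \<open>V\<close>.\<close>

definition bounded_operator ::
  "'v::complex_vector set \<Rightarrow> ('v \<Rightarrow> real) \<Rightarrow> ('v \<Rightarrow> 'v) \<Rightarrow> bool" where
  "bounded_operator V nrm T \<longleftrightarrow>
     (\<forall>v\<in>V. T v \<in> V) \<and>
     (\<forall>u\<in>V. \<forall>v\<in>V. T (u + v) = T u + T v) \<and>
     (\<forall>c. \<forall>v\<in>V. T (c *\<^sub>C v) = c *\<^sub>C T v) \<and>
     (\<exists>K. \<forall>v\<in>V. nrm (T v) \<le> K * nrm v)"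

definition op_spectrum ::
  "'v::complex_vector set \<Rightarrow> ('v \<Rightarrow> real) \<Rightarrow> ('v \<Rightarrow> 'v) \<Rightarrow> complex set" where
  "op_spectrum V nrm T =
     {z. \<not> (\<exists>R. bounded_operator V nrm R \<and>
           (\<forall>v\<in>V. R (z *\<^sub>C v - T v) = v \<and> z *\<^sub>C R v - T (R v) = v))}"

text \<open>Inserting \<open>0\<close> only matters for the zero space, whose operator has empty spectrum;
  its spectral radius is \<open>0\<close>.\<close>

definition op_spectral_radius ::
  "'v::complex_vector set \<Rightarrow> ('v \<Rightarrow> real) \<Rightarrow> ('v \<Rightarrow> 'v) \<Rightarrow> real" where
  "op_spectral_radius V nrm T = Sup (insert 0 (cmod ` op_spectrum V nrm T))"


section \<open>Bounded Hoelder functions on a subshift\<close>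

text \<open>The norms take values in \<open>[0,\<infinity>]\<close>, so that suprema are unconditionally meaningful and
  finiteness is a property.\<close>

definition sup_norm :: "'a word set \<Rightarrow> ('e \<Rightarrow> real) \<Rightarrow> ('a word \<Rightarrow> 'e) \<Rightarrow> ennreal" where
  "sup_norm \<Sigma> nrm \<Phi> = (SUP x\<in>\<Sigma>. ennreal (nrm (\<Phi> x)))"

definition hoelder_seminorm ::
  "real \<Rightarrow> 'a word set \<Rightarrow> ('e::minus \<Rightarrow> real) \<Rightarrow> ('a word \<Rightarrow> 'e) \<Rightarrow> ennreal" where
  "hoelder_seminorm \<alpha> \<Sigma> nrm \<Phi> =
     (SUP (x, y)\<in>{(x, y). x \<in> \<Sigma> \<and> y \<in> \<Sigma> \<and> x \<noteq> y}.
        ennreal (nrm (\<Phi> x - \<Phi> y) / word_dist x y powr \<alpha>))"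

definition hoelder_norm ::
  "real \<Rightarrow> 'a word set \<Rightarrow> ('e::minus \<Rightarrow> real) \<Rightarrow> ('a word \<Rightarrow> 'e) \<Rightarrow> ennreal" where
  "hoelder_norm \<alpha> \<Sigma> nrm \<Phi> = sup_norm \<Sigma> nrm \<Phi> + hoelder_seminorm \<alpha> \<Sigma> nrm \<Phi>"

text \<open>A function on \<open>\<Sigma>\<close> is represented by its extension by \<open>0\<close> to all words, which makes
  the space of functions from \<open>\<Sigma>\<close> to \<open>E\<close> a linear subspace of a function type.\<close>

definition hoelder_space ::
  "real \<Rightarrow> 'a word set \<Rightarrow> 'e::ab_group_add set \<Rightarrow> ('e \<Rightarrow> real) \<Rightarrow> ('a word \<Rightarrow> 'e) set" where
  "hoelder_space \<alpha> \<Sigma> E nrm =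
     {\<Phi>. (\<forall>x\<in>\<Sigma>. \<Phi> x \<in> E) \<and> (\<forall>x. x \<notin> \<Sigma> \<longrightarrow> \<Phi> x = 0) \<and> hoelder_norm \<alpha> \<Sigma> nrm \<Phi> < \<infinity>}"

definition hoelder_norm_real ::
  "real \<Rightarrow> 'a word set \<Rightarrow> ('e::minus \<Rightarrow> real) \<Rightarrow> ('a word \<Rightarrow> 'e) \<Rightarrow> real" where
  "hoelder_norm_real \<alpha> \<Sigma> nrm \<Phi> = enn2real (hoelder_norm \<alpha> \<Sigma> nrm \<Phi>)"

definition bounded_hoelder_variations :: "real \<Rightarrow> 'a word set \<Rightarrow> ('a word \<Rightarrow> real) \<Rightarrow> bool" where
  "bounded_hoelder_variations \<alpha> \<Sigma> F \<longleftrightarrow> hoelder_norm \<alpha> \<Sigma> norm (\<lambda>x. ln (F x)) < \<infinity>"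


section \<open>The representation on square-summable functions\<close>

text \<open>As above, functions on \<open>Y\<close> are extended by \<open>0\<close>.\<close>

definition ell2 :: "'y set \<Rightarrow> ('y \<Rightarrow> complex) set" where
  "ell2 Y = {\<phi>. (\<forall>y. y \<notin> Y \<longrightarrow> \<phi> y = 0) \<and> (\<lambda>y. (cmod (\<phi> y))\<^sup>2) summable_on Y}"

definition ell2_norm :: "'y set \<Rightarrow> ('y \<Rightarrow> complex) \<Rightarrow> real" where
  "ell2_norm Y \<phi> = sqrt (\<Sum>\<^sub>\<infinity>y\<in>Y. (cmod (\<phi> y))\<^sup>2)"

definition induced_rep ::
  "('g, 'm) monoid_scheme \<Rightarrow> 'y set \<Rightarrow> ('g \<Rightarrow> 'y \<Rightarrow> 'y) \<Rightarrow> 'g \<Rightarrow> ('y \<Rightarrow> complex) \<Rightarrow> 'y \<Rightarrow> complex"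
  where
  "induced_rep G Y act g \<phi> = (\<lambda>y. if y \<in> Y then \<phi> (act (inv\<^bsub>G\<^esub> g) y) else 0)"

text \<open>The inverse of the operator of \<open>g\<close> is the operator of the inverse of \<open>g\<close>.\<close>

lemma induced_rep_inverse:
  assumes "group_action G Y act" "g \<in> carrier G" "\<phi> \<in> ell2 Y"
  shows "induced_rep G Y act (inv\<^bsub>G\<^esub> g) (induced_rep G Y act g \<phi>) = \<phi>"
    and "induced_rep G Y act g (induced_rep G Y act (inv\<^bsub>G\<^esub> g) \<phi>) = \<phi>"
proof -
  interpret group_action G Y act by fact
  interpret group G using group_hom group_hom.axioms(1) by blast
  have *: "act a y \<in> Y" if "a \<in> carrier G" "y \<in> Y" for a y
    using that element_image by blast
  have **: "act (inv\<^bsub>G\<^esub> g) (act g y) = y" "act g (act (inv\<^bsub>G\<^esub> g) y) = y" if "y \<in> Y" for y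
    using that assms(2) orbit_sym_aux[of g y "act g y"]
      orbit_sym_aux[of "inv\<^bsub>G\<^esub> g" y "act (inv\<^bsub>G\<^esub> g) y"]
    by auto
  show "induced_rep G Y act (inv\<^bsub>G\<^esub> g) (induced_rep G Y act g \<phi>) = \<phi>"
    "induced_rep G Y act g (induced_rep G Y act (inv\<^bsub>G\<^esub> g) \<phi>) = \<phi>"
    by (rule ext; use assms(2,3) in \<open>simp add: induced_rep_def ell2_def * **\<close>)+
qed

definition amenable_action ::
  "('g, 'm) monoid_scheme \<Rightarrow> 'y set \<Rightarrow> ('g \<Rightarrow> 'y \<Rightarrow> 'y) \<Rightarrow> bool" where
  "amenable_action G Y act \<longleftrightarrow>
     (\<forall>S \<epsilon>. finite S \<longrightarrow> S \<subseteq> carrier G \<longrightarrow> \<epsilon> > 0 \<longrightarrow>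
        (\<exists>\<phi>\<in>ell2 Y. \<forall>s\<in>S.
           ell2_norm Y (induced_rep G Y act s \<phi> - \<phi>) < \<epsilon> * ell2_norm Y \<phi>))"


section \<open>Group extensions\<close>

definition finitely_generated_group :: "('g, 'm) monoid_scheme \<Rightarrow> bool" where
  "finitely_generated_group G \<longleftrightarrow>
     group G \<and> (\<exists>S. finite S \<and> S \<subseteq> carrier G \<and> generate G S = carrier G)"

primrec cocycle ::
  "('g, 'm) monoid_scheme \<Rightarrow> ('a word \<Rightarrow> 'g) \<Rightarrow> nat \<Rightarrow> 'a word \<Rightarrow> 'g" where
  "cocycle G \<theta> 0 x = \<one>\<^bsub>G\<^esub>"
| "cocycle G \<theta> (Suc n) x = \<theta> x \<otimes>\<^bsub>G\<^esub> cocycle G \<theta> n (shift x)"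

definition visibility_property ::
  "'a word set \<Rightarrow> ('g, 'm) monoid_scheme \<Rightarrow> ('a word \<Rightarrow> 'g) \<Rightarrow> bool" where
  "visibility_property \<Sigma> G \<theta> \<longleftrightarrow>
     (\<exists>U. finite U \<and> U \<subseteq> carrier G \<and>
        (\<forall>g\<in>carrier G. \<exists>x\<in>\<Sigma>. \<exists>n. \<exists>u1\<in>U. \<exists>u2\<in>U.
           g = u1 \<otimes>\<^bsub>G\<^esub> cocycle G \<theta> n x \<otimes>\<^bsub>G\<^esub> u2))"


section \<open>Transfer operators\<close>

definition transfer_operator ::
  "'a word set \<Rightarrow> ('a word \<Rightarrow> real) \<Rightarrow> ('a word \<Rightarrow> complex) \<Rightarrow> 'a word \<Rightarrow> complex" where
  "transfer_operator \<Sigma> F \<Phi> x =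
     (if x \<in> \<Sigma> then \<Sum>y | y \<in> \<Sigma> \<and> shift y = x. complex_of_real (F y) * \<Phi> y else 0)"

definition twisted_transfer_operator ::
  "'a word set \<Rightarrow> ('a word \<Rightarrow> real) \<Rightarrow> ('g, 'm) monoid_scheme \<Rightarrow> 'y set \<Rightarrow> ('g \<Rightarrow> 'y \<Rightarrow> 'y) \<Rightarrow>
   ('a word \<Rightarrow> 'g) \<Rightarrow> ('a word \<Rightarrow> 'y \<Rightarrow> complex) \<Rightarrow> 'a word \<Rightarrow> 'y \<Rightarrow> complex" where
  "twisted_transfer_operator \<Sigma> F G Y act \<theta> \<Phi> x =
     (if x \<in> \<Sigma>
      then \<Sum>y | y \<in> \<Sigma> \<and> shift y = x.
             complex_of_real (F y) *\<^sub>C induced_rep G Y act (inv\<^bsub>G\<^esub> \<theta> y) (\<Phi> y)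
      else 0)"

end

theory Submission
  imports Defs
begin

text \<open>
  Why the theorem is true. Let \<open>a n\<close> be the supremum of the \<open>n\<close>-th iterate of the transfer
  operator applied to the constant function 1. It is submultiplicative and, by irreducibility,
  supermultiplicative up to a constant, so that \<open>r ^ n \<le> a n \<le> C * r ^ n\<close> for some \<open>r\<close>
  (\<open>growth_rate_bounds\<close>, \<open>le_radius\<close>). The operators \<open>\<lambda>(g)\<close> are isometries and the cocycle is
  locally constant, so every twisted operator satisfies a Lasota-Yorke inequality whose
  constants do not depend on the action (\<open>lasota_yorke\<close>). With the Neumann series, its spectrum
  lies in the disc of radius \<open>r\<close> (\<open>spectrum_le_radius\<close>).

  If the action is amenable, an almost invariant vector, multiplied by an almost eigenfunction
  of the untwisted operator, is an almost eigenvector, so \<open>r\<close> is in the spectrum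
  (\<open>amenable_imp_radius_in_spectrum\<close>). The untwisted operator is the twisted operator of the
  trivial action on a point, which is amenable. Hence \<open>\<rho> = r\<close>, and (i) implies (ii), which
  implies (iii).

  It remains to prove that the spectral radius of the twisted operator is smaller than \<open>r\<close> if
  the action is not amenable. Then some finite average of translations has norm less than 1 on
  \<open>\<ell>\<^sup>2(Y)\<close>, and its powers have arbitrarily small norm (\<open>nonamenable_small_average\<close>). By
  visibility and irreducibility, the finitely many group elements of such a power are read, up
  to factors from a finite set \<open>V\<close> that is fixed in advance, along paths that begin in a common
  window and end at any prescribed point (\<open>visibility_paths\<close>). Everything is positive, so the
  contribution of these paths to an iterate is at most a constant times \<open>(card V)\<^sup>2\<close> times the
  small norm, although it carries a definite proportion of the total weight. The paths have
  different lengths, so this gain is applied to the truncated Green function \<open>\<Sum>n\<le>J. z ^ (-n)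
  L\<^sup>n\<close>, which bounds itself with a factor smaller than 1 even for some \<open>z < r\<close>
  (\<open>nonamenable_contraction\<close>). This gives exponential decay relative to \<open>r ^ n\<close> on functions
  that are constant on \<open>\<Sigma>\<close>. A Hoelder function is close to one with finitely many values, and
  the Lasota-Yorke inequality transfers the decay to the Hoelder norm
  (\<open>nonamenable_spectral_gap\<close>).
\<close>


section \<open>Words that agree on an initial segment\<close>

definition agree :: "nat \<Rightarrow> 'a word \<Rightarrow> 'a word \<Rightarrow> bool" where
  "agree k x y \<longleftrightarrow> (\<forall>i<k. x i = y i)"

definition glue :: "nat \<Rightarrow> 'a word \<Rightarrow> 'a word \<Rightarrow> 'a word" where
  "glue n y x = (\<lambda>i. if i < n then y i else x (i - n))"

definition hdist :: "real \<Rightarrow> 'a word \<Rightarrow> 'a word \<Rightarrow> real" where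
  "hdist \<alpha> x y = word_dist x y powr \<alpha>"

lemma agree_refl [simp]: "agree k x x" by (simp add: agree_def)
lemma agree_sym: "agree k x y \<Longrightarrow> agree k y x" by (simp add: agree_def)
lemma agree_trans: "agree k x y \<Longrightarrow> agree k y z \<Longrightarrow> agree k x z" by (simp add: agree_def)
lemma agree_mono: "agree k x y \<Longrightarrow> l \<le> k \<Longrightarrow> agree l x y" by (simp add: agree_def)

lemma agree_add_iff: "agree (n + m) x y \<longleftrightarrow> agree n x y \<and> agree m (suffix n x) (suffix n y)"
  unfolding agree_def suffix_nth
  by (auto, metis le_add_diff_inverse nat_add_left_cancel_less not_less)

lemma agree_shift: "agree (Suc n) x y \<Longrightarrow> agree n (shift x) (shift y)"
  using agree_add_iff[of 1 n x y] by simp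

lemma agree_iff_map: "agree k x y \<longleftrightarrow> map x [0..<k] = map y [0..<k]"
  by (auto simp: agree_def)

lemma suffix_glue [simp]: "suffix n (glue n y x) = x"
  by (simp add: glue_def suffix_def)

lemma agree_glue [simp]: "agree n (glue n y x) y"
  by (simp add: agree_def glue_def)

lemma glue_suffix: "agree n y z \<Longrightarrow> glue n z (suffix n y) = y"
  by (auto simp: glue_def agree_def suffix_def)

lemma agree_glue_suffix: "agree k x (suffix n y) \<Longrightarrow> agree (n + k) (glue n y x) y"
  by (simp add: agree_add_iff)

text \<open>Only the classes of a finite equivalence relation matter, because the alphabet is
  finite.\<close>

lemma finite_representatives:
  fixes \<Sigma> :: "'a::finite word set"
  obtains R where "finite R" "R \<subseteq> \<Sigma>" "\<And>x. x \<in> \<Sigma> \<Longrightarrow> \<exists>c\<in>R. agree k x c"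
proof -
  let ?p = "\<lambda>x::'a word. map x [0..<k]"
  have fin: "finite (?p ` \<Sigma>)"
    by (rule finite_subset[OF _ finite_lists_length_eq[of "UNIV :: 'a set" k]]) auto
  obtain R where R: "R \<subseteq> \<Sigma>" "finite R" "?p ` \<Sigma> = ?p ` R"
    using finite_subset_image[OF fin order_refl] by metis
  show thesis
  proof (rule that[OF R(2,1)])
    fix x assume "x \<in> \<Sigma>"
    then have "?p x \<in> ?p ` R" using R(3) by blast
    then show "\<exists>c\<in>R. agree k x c" unfolding agree_iff_map by blast
  qed
qed

lemma word_dist_eq_exp:
  assumes "x \<noteq> y"
  obtains l where "word_dist x y = exp (- real l)" "agree l x y" "x l \<noteq> y l"
proof -
  have ex: "\<exists>n. x n \<noteq> y n" using assms by auto
  show thesis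
  proof (rule that[of "LEAST n. x n \<noteq> y n"])
    show "word_dist x y = exp (- real (LEAST n. x n \<noteq> y n))"
      using assms by (simp add: word_dist_def)
    show "agree (LEAST n. x n \<noteq> y n) x y"
      unfolding agree_def using not_less_Least by blast
    show "x (LEAST n. x n \<noteq> y n) \<noteq> y (LEAST n. x n \<noteq> y n)"
      using LeastI_ex[OF ex] .
  qed
qed

lemma word_dist_eqI:
  assumes "agree l x y" "x l \<noteq> y l"
  shows "word_dist x y = exp (- real l)"
proof -
  have "(LEAST n. x n \<noteq> y n) = l"
    using assms by (intro Least_equality) (auto simp: agree_def intro: leI)
  then show ?thesis using assms by (auto simp: word_dist_def)
qed

lemma hdist_eqI:
  assumes "agree l x y" "x l \<noteq> y l"
  shows "hdist \<alpha> x y = exp (- \<alpha> * real l)"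
  unfolding hdist_def word_dist_eqI[OF assms] by (simp add: powr_def)

lemma hdist_nonneg [simp]: "0 \<le> hdist \<alpha> x y" by (simp add: hdist_def)
lemma hdist_self [simp]: "hdist \<alpha> x x = 0" by (simp add: hdist_def word_dist_def)

lemma hdist_sym: "hdist \<alpha> x y = hdist \<alpha> y x"
  unfolding hdist_def by (simp add: Metric_space.commute[OF Metric_space_word_dist])

lemma hdist_pos: "x \<noteq> y \<Longrightarrow> 0 < hdist \<alpha> x y"
  by (auto simp: hdist_def word_dist_def)

lemma exists_first_difference:
  assumes "x \<noteq> y"
  obtains l where "agree l x y" "x l \<noteq> y l"
  using word_dist_eq_exp[OF assms] by metis

lemma hdist_le_if_agree:
  assumes "\<alpha> > 0" "agree k x y"
  shows "hdist \<alpha> x y \<le> exp (- \<alpha> * real k)"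
proof (cases "x = y")
  case False
  then obtain l where l: "agree l x y" "x l \<noteq> y l" by (rule exists_first_difference)
  have "k \<le> l" using assms(2) l(2) by (auto simp: agree_def intro: leI)
  then show ?thesis using hdist_eqI[OF l] assms(1) by simp
qed simp

lemma hdist_le_1: "\<alpha> > 0 \<Longrightarrow> hdist \<alpha> x y \<le> 1"
  using hdist_le_if_agree[of \<alpha> 0 x y] by (simp add: agree_def)

lemma hdist_ge_if_not_agree:
  assumes "\<alpha> > 0" "\<not> agree k x y"
  shows "exp (- \<alpha> * real k) \<le> hdist \<alpha> x y"
proof -
  have "x \<noteq> y" using assms by auto
  then obtain l where l: "agree l x y" "x l \<noteq> y l" by (rule exists_first_difference)
  have "l \<le> k" using assms(2) l(1) agree_mono by (metis nat_le_linear)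
  then show ?thesis using hdist_eqI[OF l] assms(1) by simp
qed

lemma hdist_suffix:
  assumes "agree n x y"
  shows "hdist \<alpha> x y = exp (- \<alpha> * real n) * hdist \<alpha> (suffix n x) (suffix n y)"
proof (cases "suffix n x = suffix n y")
  case True
  then have "x = y" using glue_suffix[OF assms] glue_suffix[OF agree_refl, of n y] by metis
  then show ?thesis by simp
next
  case False
  then obtain l where l: "agree l (suffix n x) (suffix n y)" "suffix n x l \<noteq> suffix n y l"
    by (rule exists_first_difference)
  have "agree (n + l) x y" "x (n + l) \<noteq> y (n + l)"
    using l assms by (simp_all add: agree_add_iff)
  show ?thesis
    unfolding hdist_eqI[OF \<open>agree (n + l) x y\<close> \<open>x (n + l) \<noteq> y (n + l)\<close>] hdist_eqI[OF l]
    by (simp add: exp_add[symmetric] distrib_left)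
qed


section \<open>Subshifts of finite type\<close>

lemma subshift_suffix:
  assumes "shift ` \<Sigma> \<subseteq> \<Sigma>" "x \<in> \<Sigma>"
  shows "suffix n x \<in> \<Sigma>"
proof (induction n)
  case (Suc n)
  then have "shift (suffix n x) \<in> \<Sigma>" using assms(1) by blast
  then show ?case by (simp only: suffix_suffix Suc_eq_plus1)
qed (simp add: assms)

lemma admissible_subsequence:
  assumes "shift ` \<Sigma> \<subseteq> \<Sigma>" "x \<in> \<Sigma>"
  shows "admissible_word \<Sigma> (subsequence x i (i + N))"
proof -
  have "prefix (length (subsequence x i (i + N))) (suffix i x) = subsequence x i (i + N)"
    by (auto simp: subsequence_def intro!: nth_equalityI)
  then show ?thesis
    unfolding admissible_word_def using subshift_suffix[OF assms] by blast
qed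

text \<open>A window of the glued word lies in \<open>x\<close>, or it starts in \<open>z\<close> and sees at most the
  first \<open>N\<close> letters of \<open>x\<close>, where it cannot tell \<open>x\<close> from the tail of \<open>z\<close>.\<close>

lemma glue_in_finite_type:
  assumes inv: "shift ` \<Sigma> \<subseteq> \<Sigma>"
    and N: "\<And>x. x \<in> \<Sigma> \<longleftrightarrow> (\<forall>i. admissible_word \<Sigma> (subsequence x i (i + N)))"
    and z: "z \<in> \<Sigma>" and x: "x \<in> \<Sigma>" and ag: "agree N (suffix n z) x"
  shows "glue n z x \<in> \<Sigma>"
  unfolding N[of "glue n z x"]
proof
  fix i
  have gz: "agree (n + N) (glue n z x) z"
    using agree_glue_suffix[OF agree_sym[OF ag]] .
  show "admissible_word \<Sigma> (subsequence (glue n z x) i (i + N))"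
  proof (cases "i < n")
    case True
    then have "subsequence (glue n z x) i (i + N) = subsequence z i (i + N)"
      using gz by (auto simp: subsequence_def agree_def)
    then show ?thesis using admissible_subsequence[OF inv z] by metis
  next
    case False
    then have "subsequence (glue n z x) i (i + N) = subsequence x (i - n) (i - n + N)"
      by (auto simp: subsequence_def glue_def intro!: nth_equalityI)
    then show ?thesis using admissible_subsequence[OF inv x] by metis
  qed
qed

lemma irreducible_connect:
  assumes irr: "irreducible_shift \<Sigma>"
    and gl: "\<And>n z x. z \<in> \<Sigma> \<Longrightarrow> x \<in> \<Sigma> \<Longrightarrow> agree M (suffix n z) x \<Longrightarrow> glue n z x \<in> \<Sigma>"
    and inv: "shift ` \<Sigma> \<subseteq> \<Sigma>"
    and z: "z \<in> \<Sigma>" and x: "x \<in> \<Sigma>"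
  shows "\<exists>k\<ge>M. \<exists>y\<in>\<Sigma>. agree M y z \<and> suffix k y = x"
proof -
  have adm: "admissible_word \<Sigma> (prefix M u)" if "u \<in> \<Sigma>" for u
    using admissible_subsequence[OF inv that, of 0 M] by simp
  obtain w where "admissible_word \<Sigma> (prefix M z @ w @ prefix M x)"
    using irr adm[OF z] adm[OF x] unfolding irreducible_shift_def by metis
  then obtain y where y: "y \<in> \<Sigma>"
    and yw: "prefix (length (prefix M z @ w @ prefix M x)) y = prefix M z @ w @ prefix M x"
    unfolding admissible_word_def by blast
  define k where "k = M + length w"
  have len: "length (prefix M z @ w @ prefix M x) = k + M" by (simp add: k_def)
  have nth: "y i = (prefix M z @ w @ prefix M x) ! i" if "i < k + M" for i
  proof -
    have "prefix (k + M) y ! i = y i" using that by (simp add: subsequence_def)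
    then show ?thesis using yw unfolding len by simp
  qed
  have "agree M y z"
    unfolding agree_def using nth by (auto simp: k_def nth_append)
  moreover have "agree M (suffix k y) x"
    unfolding agree_def using nth by (auto simp: k_def nth_append)
  moreover have "glue k y x \<in> \<Sigma>" using gl[OF y x] calculation by blast
  moreover have "agree M (glue k y x) z"
    using agree_trans[OF agree_mono[OF agree_glue[of k y x], of M] calculation(1)]
    by (simp add: k_def)
  moreover have "k \<ge> M" by (simp add: k_def)
  ultimately show ?thesis using suffix_glue[of k y x] by blast
qed

text \<open>Whether \<open>z\<close> can be connected to \<open>x\<close> in \<open>k\<close> steps depends only on the windows of
  \<open>z\<close> and \<open>x\<close>, of which there are finitely many.\<close>

lemma irreducible_connect_uniform:
  fixes \<Sigma> :: "'a::finite word set"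
  assumes irr: "irreducible_shift \<Sigma>"
    and gl: "\<And>n z x. z \<in> \<Sigma> \<Longrightarrow> x \<in> \<Sigma> \<Longrightarrow> agree M (suffix n z) x \<Longrightarrow> glue n z x \<in> \<Sigma>"
    and inv: "shift ` \<Sigma> \<subseteq> \<Sigma>"
  shows "\<exists>K. \<forall>z\<in>\<Sigma>. \<forall>x\<in>\<Sigma>. \<exists>k\<le>K. \<exists>y\<in>\<Sigma>. agree M y z \<and> suffix k y = x"
proof -
  obtain R where R: "finite R" "R \<subseteq> \<Sigma>" "\<And>x. x \<in> \<Sigma> \<Longrightarrow> \<exists>c\<in>R. agree M x c"
    using finite_representatives by blast
  have "\<forall>p\<in>R \<times> R. \<exists>k. k \<ge> M \<and> (\<exists>y\<in>\<Sigma>. agree M y (fst p) \<and> suffix k y = snd p)"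
    using irreducible_connect[OF irr gl inv] R(2) by (auto simp: subset_iff)
  then obtain k where k: "\<And>c d. c \<in> R \<Longrightarrow> d \<in> R \<Longrightarrow>
      k (c, d) \<ge> M \<and> (\<exists>y\<in>\<Sigma>. agree M y c \<and> suffix (k (c, d)) y = d)"
    by (auto simp: bchoice_iff)
  show ?thesis
  proof (rule exI[of _ "Max (k ` (R \<times> R))"], intro ballI)
    fix z x assume z: "z \<in> \<Sigma>" and x: "x \<in> \<Sigma>"
    obtain c d where c: "c \<in> R" "agree M z c" and d: "d \<in> R" "agree M x d"
      using R(3) z x by metis
    obtain y where y: "y \<in> \<Sigma>" "agree M y c" "suffix (k (c, d)) y = d"
      and kM: "k (c, d) \<ge> M" using k[OF c(1) d(1)] by blast
    let ?k = "k (c, d)"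
    have "glue ?k y x \<in> \<Sigma>" using gl[OF y(1) x, of ?k] agree_sym[OF d(2)] unfolding y(3) .
    moreover have "agree M (glue ?k y x) z"
      by (rule agree_trans[OF agree_mono[OF agree_glue[of ?k y x] kM]
            agree_trans[OF y(2) agree_sym[OF c(2)]]])
    moreover have "?k \<le> Max (k ` (R \<times> R))" using R(1) c d by (intro Max_ge) auto
    ultimately show "\<exists>k'\<le>Max (k ` (R \<times> R)). \<exists>y\<in>\<Sigma>. agree M y z \<and> suffix k' y = x"
      using suffix_glue[of ?k y x] by metis
  qed
qed

lemma exists_exp_less:
  assumes "r > 0"
  obtains k where "exp (- real k) < r"
proof -
  obtain k where "real k > - ln r" using reals_Archimedean2 by blast
  then have "exp (- real k) < exp (ln r)" by simp
  then show thesis using assms that by simp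
qed

lemma word_dist_le_exp:
  assumes "agree k x y" shows "word_dist x y \<le> exp (- real k)"
  using hdist_le_if_agree[of 1 k x y] assms by (simp add: hdist_def word_dist_def split: if_splits)

lemma closed_in_word_topology:
  assumes "closedin word_topology \<Sigma>" "\<And>k. \<exists>y\<in>\<Sigma>. agree k y x"
  shows "x \<in> \<Sigma>"
proof (rule ccontr)
  interpret Metric_space UNIV "word_dist :: 'a word \<Rightarrow> 'a word \<Rightarrow> real"
    by (rule Metric_space_word_dist)
  assume "x \<notin> \<Sigma>"
  then obtain r where r: "r > 0" "disjnt \<Sigma> (mball x r)"
    using assms(1) unfolding closedin_metric by auto
  obtain k where k: "exp (- real k) < r" using r(1) by (rule exists_exp_less)
  obtain y where y: "y \<in> \<Sigma>" "agree k y x" using assms(2) by blast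
  have "word_dist x y < r"
    using word_dist_le_exp[OF agree_sym[OF y(2)]] k by linarith
  then show False using r(2) y(1) by (auto simp: disjnt_iff)
qed

text \<open>This is compactness of \<open>\<Sigma>\<close>, in the form of Koenig's lemma: if no window determines
  the function, then there is a point of \<open>\<Sigma>\<close> no neighbourhood of which has a window determining
  the function.\<close>

lemma locally_constant_window:
  fixes \<Sigma> :: "'a::finite word set"
  assumes cl: "closedin word_topology \<Sigma>" and lc: "locally_constant_on \<Sigma> f"
  shows "\<exists>M. \<forall>x\<in>\<Sigma>. \<forall>y\<in>\<Sigma>. agree M x y \<longrightarrow> f x = f y"
proof (rule ccontr)
  interpret Metric_space UNIV "word_dist :: 'a word \<Rightarrow> 'a word \<Rightarrow> real"
    by (rule Metric_space_word_dist)
  assume no: "\<not> ?thesis"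
  define det where "det n x m \<longleftrightarrow>
    (\<forall>u\<in>\<Sigma>. \<forall>v\<in>\<Sigma>. agree n u x \<longrightarrow> agree n v x \<longrightarrow> agree m u v \<longrightarrow> f u = f v)" for n x m
  define bad where "bad n x \<longleftrightarrow> (\<forall>m. \<not> det n x m)" for n x
  have step: "\<exists>y. agree n y x \<and> bad (Suc n) y" if "bad n x" for n and x :: "'a word"
  proof (rule ccontr)
    assume c: "\<not> ?thesis"
    have "\<forall>a. \<exists>m. det (Suc n) (x(n := a)) m"
    proof
      fix a
      have "agree n (x(n := a)) x" by (simp add: agree_def)
      then show "\<exists>m. det (Suc n) (x(n := a)) m" using c bad_def by blast
    qed
    then obtain m where m: "\<And>a. det (Suc n) (x(n := a)) (m a)" by metis
    define m0 where "m0 = Suc n + Max (range m)"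
    have "det n x m0"
      unfolding det_def
    proof (intro ballI impI)
      fix u v assume uv: "u \<in> \<Sigma>" "v \<in> \<Sigma>" "agree n u x" "agree n v x" "agree m0 u v"
      have "agree (Suc n) u (x(n := u n))" using uv(3) by (auto simp: agree_def less_Suc_eq)
      moreover have "v n = u n" using uv(5) by (simp add: agree_def m0_def)
      then have "agree (Suc n) v (x(n := u n))"
        using uv(4) by (auto simp: agree_def less_Suc_eq)
      moreover have "m (u n) \<le> Max (range m)" by (rule Max_ge) simp_all
      then have "m (u n) \<le> m0" unfolding m0_def by linarith
      then have agm: "agree (m (u n)) u v" using uv(5) agree_mono by blast
      ultimately show "f u = f v" using m[of "u n"] uv(1,2) agm unfolding det_def by blast
    qed
    then show False using that bad_def by blast
  qed
  have "bad 0 undefined" using no unfolding bad_def det_def agree_def by auto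
  then have "\<exists>g. \<forall>n. bad n (g n) \<and> agree n (g (Suc n)) (g n)"
    using dependent_nat_choice[of "\<lambda>n x. bad n x" "\<lambda>n x y. agree n y x"] step by metis
  then obtain g where g: "\<And>n. bad n (g n)" "\<And>n. agree n (g (Suc n)) (g n)" by blast
  have g_le: "agree n (g (n + k)) (g n)" for n k
  proof (induction k)
    case (Suc k)
    then show ?case using agree_mono[OF g(2)[of "n + k"], of n] agree_trans by fastforce
  qed simp
  define x where "x = (\<lambda>i. g (Suc i) i)"
  have gx: "agree n (g n) x" for n
    unfolding agree_def x_def
  proof (intro allI impI)
    fix i assume "i < n"
    then show "g n i = g (Suc i) i"
      using g_le[of "Suc i" "n - Suc i"] by (simp add: agree_def)
  qed
  have "x \<in> \<Sigma>"
  proof (rule closed_in_word_topology[OF cl])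
    fix k
    obtain u where "u \<in> \<Sigma>" "agree k u (g k)"
      using g(1)[of k] unfolding bad_def det_def by blast
    then show "\<exists>y\<in>\<Sigma>. agree k y x" using gx agree_trans by blast
  qed
  then obtain U where U: "openin word_topology U" "x \<in> U" "\<forall>y\<in>U \<inter> \<Sigma>. f y = f x"
    using lc unfolding locally_constant_on_def by blast
  then obtain r where r: "r > 0" "mball x r \<subseteq> U" unfolding openin_mtopology by blast
  obtain k where k: "exp (- real k) < r" using r(1) by (rule exists_exp_less)
  have "u \<in> U" if "agree k u x" for u
  proof -
    have "word_dist x u < r"
      using word_dist_le_exp[OF agree_sym[OF that]] k by linarith
    then show ?thesis using r(2) by auto
  qed
  then have "det k (g k) 0"
    unfolding det_def using U(3) gx agree_trans by (metis IntI)
  then show False using g(1) bad_def by blast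
qed


section \<open>Growth of almost multiplicative sequences\<close>

lemma submultiplicative_power_le:
  fixes a :: "nat \<Rightarrow> real"
  assumes "\<And>n. a n > 0" "\<And>n m. a (n + m) \<le> a n * a m" "n \<ge> 1"
  shows "a (m * n) \<le> a m ^ n"
  using \<open>n \<ge> 1\<close>
proof (induction n rule: dec_induct)
  case (step n)
  have "a (m * Suc n) \<le> a m * a (m * n)" using assms(2)[of m "m * n"] by simp
  also have "\<dots> \<le> a m * a m ^ n" using step assms(1)[of m] by (intro mult_left_mono) auto
  finally show ?case by simp
qed simp

lemma supermultiplicative_power_le:
  fixes a :: "nat \<Rightarrow> real"
  assumes "\<And>n. a n > 0" "\<And>n m. a n * a m \<le> C * a (n + m)" "C > 0" "m \<ge> 1"
  shows "(a n / C) ^ m \<le> a (n * m) / C"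
  using \<open>m \<ge> 1\<close>
proof (induction m rule: dec_induct)
  case (step m)
  have "(a n / C) ^ Suc m \<le> a n / C * (a (n * m) / C)"
    using step.IH assms(1)[of n] assms(3) by (simp only: power_Suc) (intro mult_left_mono, auto)
  also have "\<dots> \<le> a (n * Suc m) / C"
    using assms(2)[of n "n * m"] assms(3) by (simp add: field_simps)
  finally show ?case .
qed simp

definition growth_rate :: "(nat \<Rightarrow> real) \<Rightarrow> real" where
  "growth_rate a = (INF n\<in>{1..}. root n (a n))"

text \<open>Submultiplicativity makes the infimum a lower bound for the growth of \<open>a\<close>.
  Supermultiplicativity up to the constant \<open>C\<close> gives \<open>(a n / C) powr (1 / n) \<le> a m powr (1 / m)\<close>
  for all \<open>n\<close> and \<open>m\<close>, by comparing both with \<open>a (n * m)\<close>, so the bound is sharp up to \<open>C\<close>.\<close>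

lemma growth_rate_bounds:
  fixes a :: "nat \<Rightarrow> real"
  assumes pos: "\<And>n. a n > 0" and a0: "a 0 = 1"
    and sub: "\<And>n m. a (n + m) \<le> a n * a m"
    and super: "\<And>n m. a n * a m \<le> C * a (n + m)" and C: "C \<ge> 1"
  shows "growth_rate a > 0" "growth_rate a ^ n \<le> a n" "a n \<le> C * growth_rate a ^ n"
proof -
  have key: "root n (a n / C) \<le> root m (a m)" if "n \<ge> 1" "m \<ge> 1" for n m
  proof -
    have nn: "a n / C \<ge> 0" "a m \<ge> 0" using pos[of n] pos[of m] C by simp_all
    have "root n (a n / C) ^ (n * m) = (a n / C) ^ m"
      using that nn by (simp add: power_mult)
    also have "\<dots> \<le> a (n * m) / C"
      using supermultiplicative_power_le[of a C m n] pos super C that by simp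
    also have "\<dots> \<le> a (m * n)" using C pos[of "m * n"] by (simp add: field_simps)
    also have "\<dots> \<le> a m ^ n" using submultiplicative_power_le[of a n m] pos sub that by simp
    also have "\<dots> = root m (a m) ^ (n * m)"
      using that nn by (simp add: mult.commute[of n m] power_mult)
    finally have "root n (a n / C) ^ (n * m) \<le> root m (a m) ^ (n * m)" .
    then show ?thesis
      using that nn by (subst (asm) power_mono_iff) simp_all
  qed
  have bdd: "bdd_below ((\<lambda>n. root n (a n)) ` {1..})"
    using pos by (intro bdd_belowI2[of _ 0]) (simp add: less_imp_le)
  have upper: "growth_rate a \<le> root n (a n)" if "n \<ge> 1" for n
    unfolding growth_rate_def using that by (intro cINF_lower[OF bdd]) simp
  have lower: "root n (a n / C) \<le> growth_rate a" if "n \<ge> 1" for n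
    unfolding growth_rate_def using key that by (intro cINF_greatest) auto
  have "0 < root 1 (a 1 / C)" using pos[of 1] C by simp
  then show r0: "growth_rate a > 0" using lower[of 1] by linarith
  show "growth_rate a ^ n \<le> a n"
  proof (cases "n = 0")
    case False
    then have "growth_rate a ^ n \<le> root n (a n) ^ n"
      using upper[of n] r0 by (intro power_mono) auto
    then show ?thesis using False pos[of n] by simp
  qed (simp add: a0)
  show "a n \<le> C * growth_rate a ^ n"
  proof (cases "n = 0")
    case False
    have "a n / C = root n (a n / C) ^ n" using False pos[of n] C by simp
    also have "\<dots> \<le> growth_rate a ^ n"
      using lower[of n] pos[of n] C False by (intro power_mono) auto
    finally show ?thesis using C by (simp add: field_simps)
  qed (simp add: a0 C)
qed


lemma sum_overlapping_le:
  fixes g :: "nat \<Rightarrow> real"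
  assumes "\<And>n. g n \<ge> 0"
  shows "(\<Sum>n<J. \<Sum>k\<le>L. g (n + k)) \<le> real (L + 1) * (\<Sum>n<J + L. g n)"
proof -
  have "(\<Sum>n<J. g (n + k)) \<le> (\<Sum>n<J + L. g n)" if "k \<le> L" for k
  proof -
    have "(\<Sum>n<J. g (n + k)) = (\<Sum>n\<in>(\<lambda>n. n + k) ` {..<J}. g n)"
      by (subst sum.reindex) (auto simp: inj_on_def)
    also have "\<dots> \<le> (\<Sum>n<J + L. g n)" using assms that by (intro sum_mono2) auto
    finally show ?thesis .
  qed
  then have "(\<Sum>k\<le>L. \<Sum>n<J. g (n + k)) \<le> (\<Sum>k\<le>L. \<Sum>n<J + L. g n)" by (intro sum_mono) auto
  then show ?thesis by (subst sum.swap) simp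
qed


section \<open>The weights of the transfer operator\<close>

text \<open>A subshift of finite type with a potential, seen through the properties that the
  argument uses: words can be glued along windows of length \<open>M\<close>, and any window can be connected
  to any point by a word of bounded length.\<close>

locale weighted_shift =
  fixes \<Sigma> :: "'a::finite word set" and F :: "'a word \<Rightarrow> real" and \<alpha> b :: real and M K :: nat
  assumes nonempty: "\<Sigma> \<noteq> {}" and shift_in: "shift ` \<Sigma> \<subseteq> \<Sigma>"
    and glue_in: "z \<in> \<Sigma> \<Longrightarrow> x \<in> \<Sigma> \<Longrightarrow> agree M (suffix n z) x \<Longrightarrow> glue n z x \<in> \<Sigma>"
    and connect: "z \<in> \<Sigma> \<Longrightarrow> x \<in> \<Sigma> \<Longrightarrow> \<exists>k\<le>K. \<exists>y\<in>\<Sigma>. agree M y z \<and> suffix k y = x"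
    and alpha_pos: "\<alpha> > 0" and b_nonneg: "b \<ge> 0"
    and F_pos: "x \<in> \<Sigma> \<Longrightarrow> F x > 0"
    and ln_F_bound: "x \<in> \<Sigma> \<Longrightarrow> \<bar>ln (F x)\<bar> \<le> b"
    and ln_F_hoelder: "x \<in> \<Sigma> \<Longrightarrow> y \<in> \<Sigma> \<Longrightarrow> \<bar>ln (F x) - ln (F y)\<bar> \<le> b * hdist \<alpha> x y"
begin

definition preimages :: "nat \<Rightarrow> 'a word \<Rightarrow> 'a word set" where
  "preimages n x = {y \<in> \<Sigma>. suffix n y = x}"

definition weight :: "nat \<Rightarrow> 'a word \<Rightarrow> real" where
  "weight n y = (\<Prod>i<n. F (suffix i y))"

definition weight_sum :: "nat \<Rightarrow> 'a word \<Rightarrow> real" where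
  "weight_sum n x = (\<Sum>y\<in>preimages n x. weight n y)"

definition sup_weight :: "nat \<Rightarrow> real" where
  "sup_weight n = (SUP x\<in>\<Sigma>. weight_sum n x)"

text \<open>The logarithmic distortion of the weights is a geometric series in \<open>exp (- \<alpha>)\<close>.\<close>

definition distortion :: real where
  "distortion = b * exp (- \<alpha>) / (1 - exp (- \<alpha>))"

abbreviation D :: "'a word \<Rightarrow> 'a word \<Rightarrow> real" where "D \<equiv> hdist \<alpha>"

lemma suffix_in: "x \<in> \<Sigma> \<Longrightarrow> suffix n x \<in> \<Sigma>"
  using subshift_suffix[OF shift_in] .

lemma preimagesD: "y \<in> preimages n x \<Longrightarrow> y \<in> \<Sigma>" "y \<in> preimages n x \<Longrightarrow> suffix n y = x"
  by (auto simp: preimages_def)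

lemma finite_preimages [simp]: "finite (preimages n x)"
proof (rule finite_imageD)
  show "finite ((\<lambda>y. map y [0..<n]) ` preimages n x)"
    by (rule finite_subset[OF _ finite_lists_length_eq[of "UNIV :: 'a set" n]]) auto
  show "inj_on (\<lambda>y. map y [0..<n]) (preimages n x)"
  proof (rule inj_onI)
    fix y z assume yz: "y \<in> preimages n x" "z \<in> preimages n x" "map y [0..<n] = map z [0..<n]"
    then have "agree n y z" by (simp add: agree_iff_map)
    then show "y = z"
      using glue_suffix[of n y z] glue_suffix[of n z z] yz(1,2) preimagesD(2) by fastforce
  qed
qed

lemma preimages_0: "x \<in> \<Sigma> \<Longrightarrow> preimages 0 x = {x}"
  by (auto simp: preimages_def)

lemma preimages_1: "preimages 1 x = {y. y \<in> \<Sigma> \<and> shift y = x}"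
  by (simp add: preimages_def)

lemma sum_preimages_add:
  "(\<Sum>y\<in>preimages (n + m) x. f y) = (\<Sum>u\<in>preimages m x. \<Sum>y\<in>preimages n u. f y)"
proof -
  have "preimages (n + m) x = (\<Union>u\<in>preimages m x. preimages n u)"
    using suffix_in by (auto simp: preimages_def)
  moreover have "(\<Sum>y\<in>(\<Union>u\<in>preimages m x. preimages n u). f y)
      = (\<Sum>u\<in>preimages m x. \<Sum>y\<in>preimages n u. f y)"
    by (rule sum.UNION_disjoint) (simp_all, auto simp: preimages_def)
  ultimately show ?thesis by simp
qed

lemma bij_betw_glue:
  assumes "x \<in> \<Sigma>" "x' \<in> \<Sigma>" "agree M x x'"
  shows "bij_betw (\<lambda>y. glue n y x') (preimages n x) (preimages n x')"
proof (rule bij_betwI[where g = "\<lambda>y. glue n y x"])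
  show "(\<lambda>y. glue n y x') \<in> preimages n x \<rightarrow> preimages n x'"
    using assms by (auto simp: preimages_def intro: glue_in)
  show "(\<lambda>y. glue n y x) \<in> preimages n x' \<rightarrow> preimages n x"
    using assms by (auto simp: preimages_def intro: glue_in agree_sym)
  show "glue n (glue n y x') x = y" if "y \<in> preimages n x" for y
    using that glue_suffix[of n y "glue n y x'"] agree_sym[OF agree_glue[of n y x']]
    by (simp add: preimages_def)
  show "glue n (glue n y x) x' = y" if "y \<in> preimages n x'" for y
    using that glue_suffix[of n y "glue n y x"] agree_sym[OF agree_glue[of n y x]]
    by (simp add: preimages_def)
qed

lemma sum_preimages_glue:
  assumes "x \<in> \<Sigma>" "x' \<in> \<Sigma>" "agree M x x'"
  shows "(\<Sum>y\<in>preimages n x'. f y) = (\<Sum>y\<in>preimages n x. f (glue n y x'))"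
  by (rule sum.reindex_bij_betw[OF bij_betw_glue[OF assms], symmetric])

lemma glue_preimage:
  assumes "y \<in> preimages n x" "x' \<in> \<Sigma>" "agree M x x'"
  shows "glue n y x' \<in> \<Sigma>" "agree n y (glue n y x')" "agree (n + M) y (glue n y x')"
  using assms glue_in[of y x' n] agree_sym[OF agree_glue[of n y x']]
  by (auto simp: preimages_def agree_add_iff)

lemma weight_0 [simp]: "weight 0 y = 1" by (simp add: weight_def)

lemma weight_Suc: "weight (Suc n) y = F y * weight n (shift y)"
  unfolding weight_def by (subst prod.lessThan_Suc_shift) simp

lemma weight_1 [simp]: "weight (Suc 0) y = F y"
  by (simp add: weight_Suc)

lemma weight_add: "weight (n + m) y = weight n y * weight m (suffix n y)"
proof (induction n arbitrary: y)
  case (Suc n)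
  have "weight (Suc n + m) y = F y * weight (n + m) (shift y)" by (simp add: weight_Suc)
  also have "\<dots> = weight (Suc n) y * weight m (suffix (Suc n) y)"
    unfolding Suc by (simp add: weight_Suc)
  finally show ?case .
qed simp

lemma weight_pos: "y \<in> \<Sigma> \<Longrightarrow> weight n y > 0"
  unfolding weight_def by (intro prod_pos) (simp add: F_pos suffix_in)

lemma F_lower: "x \<in> \<Sigma> \<Longrightarrow> exp (- b) \<le> F x"
  using ln_F_bound[of x] F_pos[of x] ln_ge_iff[of "F x" "- b"] by linarith

lemma weight_lower: "y \<in> \<Sigma> \<Longrightarrow> exp (- b) ^ n \<le> weight n y"
proof (induction n arbitrary: y)
  case (Suc n)
  have "exp (- b) * exp (- b) ^ n \<le> F y * weight n (shift y)"
    using Suc suffix_in[of y 1] F_lower[of y] by (intro mult_mono) (auto intro: less_imp_le F_pos)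
  then show ?case by (simp add: weight_Suc)
qed simp

lemma distortion_nonneg: "distortion \<ge> 0"
  unfolding distortion_def using b_nonneg alpha_pos by simp

lemma weight_distortion_aux:
  assumes "y \<in> \<Sigma>" "y' \<in> \<Sigma>" "agree n y y'"
  shows "weight n y \<le> exp (distortion * (1 - exp (- \<alpha> * real n)) * D (suffix n y) (suffix n y')) * weight n y'"
  using assms
proof (induction n arbitrary: y y')
  case (Suc n)
  let ?d = "D (suffix (Suc n) y) (suffix (Suc n) y')"
  have sh: "shift y \<in> \<Sigma>" "shift y' \<in> \<Sigma>" using Suc.prems suffix_in by auto
  have "ln (F y) \<le> ln (F y') + b * D y y'" using ln_F_hoelder[OF Suc.prems(1,2)] by linarith
  then have "F y \<le> exp (b * D y y') * F y'"
    using F_pos Suc.prems(1,2) by (metis exp_add exp_le_cancel_iff exp_ln mult.commute)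
  moreover have "D y y' = exp (- \<alpha> * real (Suc n)) * ?d"
    using hdist_suffix[OF Suc.prems(3)] .
  ultimately have Fy: "F y \<le> exp (b * (exp (- \<alpha> * real (Suc n)) * ?d)) * F y'" by simp
  have ih: "weight n (shift y) \<le> exp (distortion * (1 - exp (- \<alpha> * real n)) * ?d) * weight n (shift y')"
    using Suc.IH[OF sh agree_shift[OF Suc.prems(3)]] by (simp only: suffix_suffix plus_1_eq_Suc)
  have e: "exp (- \<alpha> * real (Suc n)) = exp (- \<alpha>) * exp (- \<alpha> * real n)"
    by (simp add: exp_add[symmetric] algebra_simps)
  have "b * exp (- \<alpha>) = distortion * (1 - exp (- \<alpha>))"
    unfolding distortion_def using alpha_pos by simp
  then have be: "b * exp (- \<alpha> * real (Suc n)) = distortion * (1 - exp (- \<alpha>)) * exp (- \<alpha> * real n)"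
    unfolding e by simp
  have expo: "b * (exp (- \<alpha> * real (Suc n)) * ?d) + distortion * (1 - exp (- \<alpha> * real n)) * ?d
     = distortion * (1 - exp (- \<alpha> * real (Suc n))) * ?d"
    unfolding mult.assoc[symmetric] be unfolding e by (simp add: algebra_simps)
  have "weight (Suc n) y \<le> (exp (b * (exp (- \<alpha> * real (Suc n)) * ?d)) * F y') *
      (exp (distortion * (1 - exp (- \<alpha> * real n)) * ?d) * weight n (shift y'))"
    unfolding weight_Suc using Fy ih F_pos[OF Suc.prems(1)] F_pos[OF Suc.prems(2)]
      weight_pos[OF sh(1), of n]
    by (intro mult_mono) (auto intro: less_imp_le)
  also have "\<dots> = exp (b * (exp (- \<alpha> * real (Suc n)) * ?d) + distortion * (1 - exp (- \<alpha> * real n)) * ?d)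
      * weight (Suc n) y'"
    by (simp add: exp_add weight_Suc)
  finally show ?case unfolding expo .
qed simp

lemma weight_distortion:
  assumes "y \<in> \<Sigma>" "y' \<in> \<Sigma>" "agree n y y'"
  shows "weight n y \<le> exp (distortion * D (suffix n y) (suffix n y')) * weight n y'"
proof -
  have "distortion * (1 - exp (- \<alpha> * real n)) * D (suffix n y) (suffix n y')
     \<le> distortion * D (suffix n y) (suffix n y')"
    using distortion_nonneg by (intro mult_right_mono) (simp_all add: mult_left_le)
  then have "exp (distortion * (1 - exp (- \<alpha> * real n)) * D (suffix n y) (suffix n y')) * weight n y'
     \<le> exp (distortion * D (suffix n y) (suffix n y')) * weight n y'"
    using weight_pos[OF assms(2), of n] by (intro mult_right_mono) auto
  then show ?thesis using weight_distortion_aux[OF assms] by linarith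
qed

definition harnack :: real where "harnack = exp distortion"

lemma harnack_ge_1: "harnack \<ge> 1"
  unfolding harnack_def using distortion_nonneg by simp

lemma exp_distortion_le: "exp (distortion * D x y) \<le> harnack"
  unfolding harnack_def using distortion_nonneg hdist_le_1[OF alpha_pos, of x y]
  by (simp add: mult_left_le)

lemma weight_harnack:
  assumes "y \<in> \<Sigma>" "y' \<in> \<Sigma>" "agree n y y'"
  shows "weight n y \<le> harnack * weight n y'"
  using weight_distortion[OF assms] weight_pos[OF assms(2), of n]
    mult_right_mono[OF exp_distortion_le[of "suffix n y" "suffix n y'"], of "weight n y'"]
  by linarith

definition weight_lip :: real where "weight_lip = distortion * harnack ^ 2"

lemma weight_lip_nonneg: "weight_lip \<ge> 0"
  unfolding weight_lip_def using distortion_nonneg by simp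

lemma weight_lipschitz_aux:
  assumes "y \<in> \<Sigma>" "y' \<in> \<Sigma>" "agree n y y'"
  shows "weight n y - weight n y' \<le> distortion * harnack * D (suffix n y) (suffix n y') * weight n y'"
proof -
  let ?u = "distortion * D (suffix n y) (suffix n y')"
  have u: "?u \<ge> 0" using distortion_nonneg by simp
  have "1 - ?u \<le> exp (- ?u)" using exp_ge_add_one_self[of "- ?u"] by simp
  then have "(1 - ?u) * exp ?u \<le> exp (- ?u) * exp ?u" by (intro mult_right_mono) auto
  then have "exp ?u - 1 \<le> ?u * exp ?u" by (simp add: exp_minus field_simps)
  also have "\<dots> \<le> ?u * harnack" using exp_distortion_le u by (intro mult_left_mono) auto
  finally have "(exp ?u - 1) * weight n y' \<le> ?u * harnack * weight n y'"
    using weight_pos[OF assms(2), of n] by (intro mult_right_mono) auto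
  then show ?thesis using weight_distortion[OF assms] by (simp add: algebra_simps)
qed

lemma weight_lipschitz:
  assumes "y \<in> \<Sigma>" "y' \<in> \<Sigma>" "agree n y y'"
  shows "\<bar>weight n y - weight n y'\<bar> \<le> weight_lip * D (suffix n y) (suffix n y') * weight n y'"
proof -
  let ?d = "D (suffix n y) (suffix n y')"
  have nn: "distortion * harnack * ?d \<ge> 0"
    using distortion_nonneg harnack_ge_1 by simp
  have "weight n y' - weight n y \<le> distortion * harnack * ?d * weight n y"
    using weight_lipschitz_aux[OF assms(2,1) agree_sym[OF assms(3)]] by (simp add: hdist_sym)
  also have "\<dots> \<le> distortion * harnack * ?d * (harnack * weight n y')"
    using weight_harnack[OF assms] nn by (rule mult_left_mono)
  finally have 1: "weight n y' - weight n y \<le> weight_lip * ?d * weight n y'"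
    by (simp add: weight_lip_def power2_eq_square algebra_simps)
  have "distortion * harnack * ?d * (1 * weight n y') \<le> distortion * harnack * ?d * (harnack * weight n y')"
    using harnack_ge_1 weight_pos[OF assms(2), of n] nn by (intro mult_left_mono mult_right_mono) auto
  then have 2: "weight n y - weight n y' \<le> weight_lip * ?d * weight n y'"
    using weight_lipschitz_aux[OF assms] by (simp add: weight_lip_def power2_eq_square algebra_simps)
  show ?thesis using 1 2 by linarith
qed

lemma weight_sum_nonneg: "weight_sum n x \<ge> 0"
  unfolding weight_sum_def by (intro sum_nonneg less_imp_le weight_pos) (auto dest: preimagesD)

lemma weight_sum_0: "x \<in> \<Sigma> \<Longrightarrow> weight_sum 0 x = 1"
  by (simp add: weight_sum_def preimages_0)

lemma weight_sum_harnack: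
  assumes "x \<in> \<Sigma>" "x' \<in> \<Sigma>" "agree M x x'"
  shows "weight_sum n x \<le> harnack * weight_sum n x'"
  unfolding weight_sum_def sum_preimages_glue[OF assms] sum_distrib_left
  by (intro sum_mono weight_harnack) (use assms glue_preimage preimagesD in blast)+

lemma weight_sum_lipschitz:
  assumes "x \<in> \<Sigma>" "x' \<in> \<Sigma>" "agree M x x'"
  shows "\<bar>weight_sum n x - weight_sum n x'\<bar> \<le> weight_lip * D x x' * weight_sum n x'"
proof -
  have "weight_sum n x - weight_sum n x' = (\<Sum>y\<in>preimages n x. weight n y - weight n (glue n y x'))"
    unfolding weight_sum_def sum_preimages_glue[OF assms] sum_subtractf ..
  also have "\<bar>\<dots>\<bar> \<le> (\<Sum>y\<in>preimages n x. weight_lip * D x x' * weight n (glue n y x'))"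
  proof (rule order_trans[OF sum_abs], rule sum_mono)
    fix y assume y: "y \<in> preimages n x"
    then show "\<bar>weight n y - weight n (glue n y x')\<bar> \<le> weight_lip * D x x' * weight n (glue n y x')"
      using weight_lipschitz[OF preimagesD(1)[OF y] glue_preimage(1,2)[OF y assms(2,3)]]
      by (simp add: preimagesD(2)[OF y])
  qed
  also have "\<dots> = weight_lip * D x x' * weight_sum n x'"
    unfolding weight_sum_def sum_preimages_glue[OF assms] sum_distrib_left ..
  finally show ?thesis .
qed

lemma bdd_above_weight_sum: "bdd_above (weight_sum n ` \<Sigma>)"
proof -
  obtain R where R: "finite R" "R \<subseteq> \<Sigma>" "\<And>x. x \<in> \<Sigma> \<Longrightarrow> \<exists>c\<in>R. agree M x c"
    using finite_representatives by blast
  show ?thesis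
  proof (rule bdd_aboveI2)
    fix x assume x: "x \<in> \<Sigma>"
    then obtain c where c: "c \<in> R" "agree M x c" using R(3) by blast
    have "weight_sum n x \<le> harnack * weight_sum n c" using weight_sum_harnack x c R(2) by blast
    also have "\<dots> \<le> harnack * (\<Sum>c\<in>R. weight_sum n c)"
      using member_le_sum[of c R "weight_sum n"] c(1) R(1) weight_sum_nonneg harnack_ge_1
      by (intro mult_left_mono) auto
    finally show "weight_sum n x \<le> harnack * (\<Sum>c\<in>R. weight_sum n c)" .
  qed
qed

lemma weight_sum_le: "x \<in> \<Sigma> \<Longrightarrow> weight_sum n x \<le> sup_weight n"
  unfolding sup_weight_def by (rule cSUP_upper[OF _ bdd_above_weight_sum])

lemma sup_weight_le: "(\<And>x. x \<in> \<Sigma> \<Longrightarrow> weight_sum n x \<le> B) \<Longrightarrow> sup_weight n \<le> B"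
  unfolding sup_weight_def using nonempty by (intro cSUP_least)

lemma sup_weight_pos: "sup_weight n > 0"
proof -
  obtain y where y: "y \<in> \<Sigma>" using nonempty by blast
  have "0 < weight n y" using weight_pos[OF y] .
  also have "\<dots> \<le> weight_sum n (suffix n y)"
    unfolding weight_sum_def using y
    by (intro member_le_sum finite_preimages) (auto simp: preimages_def intro: less_imp_le weight_pos)
  also have "\<dots> \<le> sup_weight n" using weight_sum_le suffix_in[OF y] by blast
  finally show ?thesis .
qed

lemma sup_weight_0: "sup_weight 0 = 1"
  unfolding sup_weight_def using nonempty by (simp add: weight_sum_0)

lemma weight_sum_add:
  "weight_sum (n + m) x = (\<Sum>u\<in>preimages m x. weight m u * weight_sum n u)"
proof -
  have "weight_sum (n + m) x = (\<Sum>u\<in>preimages m x. \<Sum>y\<in>preimages n u. weight n y * weight m (suffix n y))"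
    unfolding weight_sum_def sum_preimages_add weight_add ..
  also have "\<dots> = (\<Sum>u\<in>preimages m x. weight m u * weight_sum n u)"
    unfolding weight_sum_def sum_distrib_left
    by (intro sum.cong refl) (simp add: preimagesD(2) mult.commute)
  finally show ?thesis .
qed

lemma sup_weight_submultiplicative: "sup_weight (n + m) \<le> sup_weight n * sup_weight m"
proof (rule sup_weight_le)
  fix x assume x: "x \<in> \<Sigma>"
  have "weight_sum (n + m) x \<le> (\<Sum>u\<in>preimages m x. weight m u * sup_weight n)"
    unfolding weight_sum_add
    by (intro sum_mono mult_left_mono weight_sum_le less_imp_le weight_pos) (auto dest: preimagesD)
  also have "\<dots> = sup_weight n * weight_sum m x"
    by (simp add: weight_sum_def sum_distrib_left mult.commute)
  also have "\<dots> \<le> sup_weight n * sup_weight m"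
    using weight_sum_le[OF x] sup_weight_pos[of n] by (intro mult_left_mono) auto
  finally show "weight_sum (n + m) x \<le> sup_weight n * sup_weight m" .
qed

text \<open>Irreducibility: a path of at most \<open>K\<close> letters leads back from \<open>x\<close> to the window of
  \<open>y\<close>, and it has a weight bounded below.\<close>

definition connect_weight :: real where "connect_weight = exp (- b) ^ K / harnack"

lemma connect_weight_pos: "connect_weight > 0"
  unfolding connect_weight_def using harnack_ge_1 by simp

lemma weight_sum_connect:
  assumes "x \<in> \<Sigma>" "y \<in> \<Sigma>"
  shows "connect_weight * weight_sum n y \<le> (\<Sum>k\<le>K. weight_sum (n + k) x)"
proof -
  obtain k z where k: "k \<le> K" and z: "z \<in> \<Sigma>" "agree M z y" "suffix k z = x"
    using connect[OF assms(2,1)] by blast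
  have "exp (- b) ^ K \<le> exp (- b) ^ k" using k b_nonneg by (intro power_decreasing) auto
  then have w: "exp (- b) ^ K \<le> weight k z" using weight_lower[OF z(1), of k] by linarith
  have "weight_sum n y \<le> harnack * weight_sum n z"
    using weight_sum_harnack assms z agree_sym by blast
  then have "weight_sum n y / harnack \<le> weight_sum n z"
    using harnack_ge_1 by (simp add: field_simps)
  then have "exp (- b) ^ K * (weight_sum n y / harnack) \<le> weight k z * weight_sum n z"
    using w weight_sum_nonneg[of n y] harnack_ge_1 weight_pos[OF z(1), of k]
    by (intro mult_mono) (auto intro: less_imp_le)
  also have "\<dots> \<le> weight_sum (n + k) x"
    unfolding weight_sum_add
    by (intro member_le_sum[of z "preimages k x" "\<lambda>u. weight k u * weight_sum n u"] finite_preimages)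
      (use z in \<open>auto simp: preimages_def intro!: mult_nonneg_nonneg less_imp_le[OF weight_pos] weight_sum_nonneg\<close>)
  also have "\<dots> \<le> (\<Sum>k\<le>K. weight_sum (n + k) x)"
    using k by (intro member_le_sum[of k "{..K}" "\<lambda>k. weight_sum (n + k) x"]) (auto simp: weight_sum_nonneg)
  finally show ?thesis by (simp add: connect_weight_def)
qed

text \<open>Each preimage counted by \<open>weight_sum n x\<close> is connected to a prescribed point by a
  word whose length varies but is at most \<open>K\<close>. Submultiplicativity removes the extra letters.\<close>

lemma sup_weight_supermultiplicative:
  "\<exists>C\<ge>1. \<forall>n m. sup_weight n * sup_weight m \<le> C * sup_weight (n + m)"
proof -
  define A where "A = (\<Sum>k\<le>K. sup_weight k)"
  have A: "A \<ge> 1"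
    using member_le_sum[of 0 "{..K}" sup_weight] sup_weight_pos sup_weight_0
    by (simp add: A_def less_imp_le)
  have main: "connect_weight * weight_sum m y * weight_sum n x \<le> A * sup_weight (n + m)"
    if x: "x \<in> \<Sigma>" and y: "y \<in> \<Sigma>" for n m x y
  proof -
    have "connect_weight * weight_sum m y * weight_sum n x
      = (\<Sum>u\<in>preimages n x. weight n u * (connect_weight * weight_sum m y))"
      by (simp only: weight_sum_def[of n] sum_distrib_right mult.commute)
    also have "\<dots> \<le> (\<Sum>u\<in>preimages n x. weight n u * (\<Sum>k\<le>K. weight_sum (m + k) u))"
      by (intro sum_mono mult_left_mono weight_sum_connect y less_imp_le[OF weight_pos])
        (auto dest: preimagesD)
    also have "\<dots> = (\<Sum>k\<le>K. weight_sum (m + k + n) x)"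
      unfolding weight_sum_add sum_distrib_left by (rule sum.swap)
    also have "\<dots> \<le> (\<Sum>k\<le>K. sup_weight k * sup_weight (n + m))"
    proof (rule sum_mono)
      fix k
      have "weight_sum (m + k + n) x \<le> sup_weight (k + (n + m))"
        using weight_sum_le[OF x, of "m + k + n"] by (simp add: ac_simps)
      then show "weight_sum (m + k + n) x \<le> sup_weight k * sup_weight (n + m)"
        using sup_weight_submultiplicative[of k "n + m"] by linarith
    qed
    finally show ?thesis by (simp add: A_def sum_distrib_right)
  qed
  have "sup_weight n * sup_weight m \<le> (A / connect_weight) * sup_weight (n + m)" for n m
  proof -
    have 1: "sup_weight n \<le> A * sup_weight (n + m) / (connect_weight * weight_sum m y)"
      if "y \<in> \<Sigma>" "weight_sum m y > 0" for y
      using main[OF _ that(1), of _ m n] that(2) connect_weight_pos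
      by (intro sup_weight_le) (simp add: field_simps)
    have "weight_sum m y \<le> A * sup_weight (n + m) / (connect_weight * sup_weight n)"
      if y: "y \<in> \<Sigma>" for y
    proof (cases "weight_sum m y > 0")
      case True
      then show ?thesis
        using 1[OF y True] connect_weight_pos sup_weight_pos[of n] by (simp add: field_simps)
    next
      case False
      moreover have "0 \<le> A * sup_weight (n + m) / (connect_weight * sup_weight n)"
        using A connect_weight_pos sup_weight_pos by (auto intro!: divide_nonneg_pos less_imp_le)
      ultimately show ?thesis by linarith
    qed
    then have "sup_weight m \<le> A * sup_weight (n + m) / (connect_weight * sup_weight n)"
      by (rule sup_weight_le)
    then show ?thesis using connect_weight_pos sup_weight_pos[of n] by (simp add: field_simps)
  qed
  then show ?thesis
  proof (intro exI[of _ "max 1 (A / connect_weight)"] conjI allI)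
    fix n m
    assume *: "\<And>n m. sup_weight n * sup_weight m \<le> A / connect_weight * sup_weight (n + m)"
    have "A / connect_weight * sup_weight (n + m) \<le> max 1 (A / connect_weight) * sup_weight (n + m)"
      using sup_weight_pos[of "n + m"] by (intro mult_right_mono) auto
    then show "sup_weight n * sup_weight m \<le> max 1 (A / connect_weight) * sup_weight (n + m)"
      using *[of n m] by linarith
  qed simp
qed

definition radius :: real where "radius = growth_rate sup_weight"

definition sup_const :: real where
  "sup_const = (SOME C. C \<ge> 1 \<and> (\<forall>n m. sup_weight n * sup_weight m \<le> C * sup_weight (n + m)))"

lemma sup_const: "sup_const \<ge> 1" "sup_weight n * sup_weight m \<le> sup_const * sup_weight (n + m)"
  using someI_ex[OF sup_weight_supermultiplicative[unfolded Bex_def]]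
  unfolding sup_const_def by auto

lemma radius_pos: "radius > 0"
  and radius_le: "radius ^ n \<le> sup_weight n"
  and le_radius: "sup_weight n \<le> sup_const * radius ^ n"
  using growth_rate_bounds[where a = sup_weight and C = sup_const] sup_weight_pos sup_weight_0
    sup_weight_submultiplicative sup_const
  unfolding radius_def by blast+

text \<open>Divided by \<open>J\<close>, this is almost an eigenfunction for the eigenvalue \<open>radius\<close>: the
  transfer operator shifts the index of the sum by one, which changes only the two boundary
  terms. It plays the role of the eigenfunction of the Perron-Frobenius theorem.\<close>

definition cesaro :: "nat \<Rightarrow> 'a word \<Rightarrow> real" where
  "cesaro J x = (\<Sum>n<J. weight_sum n x / radius ^ n)"

lemma cesaro_nonneg: "cesaro J x \<ge> 0"
  unfolding cesaro_def using radius_pos by (intro sum_nonneg divide_nonneg_nonneg weight_sum_nonneg) auto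

lemma cesaro_le: "x \<in> \<Sigma> \<Longrightarrow> cesaro J x \<le> sup_const * real J"
proof -
  assume x: "x \<in> \<Sigma>"
  have "weight_sum n x / radius ^ n \<le> sup_const" for n
    using weight_sum_le[OF x, of n] le_radius[of n] radius_pos by (simp add: field_simps)
  then have "cesaro J x \<le> (\<Sum>n<J. sup_const)" unfolding cesaro_def by (intro sum_mono)
  then show ?thesis by (simp add: mult.commute)
qed

lemma cesaro_lipschitz:
  assumes "x \<in> \<Sigma>" "x' \<in> \<Sigma>" "agree M x x'"
  shows "\<bar>cesaro J x - cesaro J x'\<bar> \<le> weight_lip * D x x' * cesaro J x'"
proof -
  have "cesaro J x - cesaro J x' = (\<Sum>n<J. (weight_sum n x - weight_sum n x') / radius ^ n)"
    by (simp add: cesaro_def sum_subtractf diff_divide_distrib)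
  also have "\<bar>\<dots>\<bar> \<le> (\<Sum>n<J. weight_lip * D x x' * (weight_sum n x' / radius ^ n))"
  proof (rule order_trans[OF sum_abs], rule sum_mono)
    fix n
    show "\<bar>(weight_sum n x - weight_sum n x') / radius ^ n\<bar> \<le> weight_lip * D x x' * (weight_sum n x' / radius ^ n)"
      using divide_right_mono[OF weight_sum_lipschitz[OF assms, of n], of "radius ^ n"] radius_pos
      by (simp add: abs_divide)
  qed
  finally show ?thesis by (simp add: cesaro_def sum_distrib_left)
qed

lemma transfer_cesaro:
  assumes "x \<in> \<Sigma>"
  shows "(\<Sum>y\<in>preimages 1 x. F y * cesaro J y)
    = radius * (cesaro J x - 1 + weight_sum J x / radius ^ J)"
proof (induction J)
  case (Suc J)
  have "(\<Sum>y\<in>preimages 1 x. F y * (weight_sum J y / radius ^ J)) = weight_sum (Suc J) x / radius ^ J"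
    using weight_sum_add[of J 1 x] by (simp add: sum_divide_distrib)
  moreover have "(\<Sum>y\<in>preimages 1 x. F y * cesaro (Suc J) y)
    = (\<Sum>y\<in>preimages 1 x. F y * cesaro J y) + (\<Sum>y\<in>preimages 1 x. F y * (weight_sum J y / radius ^ J))"
    by (simp add: cesaro_def distrib_left sum.distrib)
  moreover have "cesaro (Suc J) x = cesaro J x + weight_sum J x / radius ^ J"
    by (simp add: cesaro_def)
  moreover have "weight_sum (Suc J) x / radius ^ J = radius * (weight_sum (Suc J) x / radius ^ Suc J)"
    using radius_pos by simp
  ultimately show ?case using Suc by (simp only: distrib_left right_diff_distrib)
qed (simp add: cesaro_def weight_sum_0 assms)

text \<open>For a single \<open>n\<close>, nothing relates the summand at \<open>x\<close> to its supremum over \<open>\<Sigma>\<close>. But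
  among \<open>K + 1\<close> consecutive summands at \<open>x\<close>, one is comparable with the supremum of the first,
  because \<open>x\<close> is connected to a point where this supremum is almost attained.\<close>

lemma cesaro_ge: "\<exists>c>0. \<forall>J. \<forall>x\<in>\<Sigma>. c * real J \<le> cesaro (J + K) x"
proof -
  define s where "s = min 1 (1 / radius)"
  have s: "0 < s" "s \<le> 1" "s \<le> 1 / radius" using radius_pos by (auto simp: s_def)
  have sk: "s ^ K \<le> (1 / radius) ^ k" if "k \<le> K" for k
    using power_decreasing[OF that, of s] power_mono[of s "1 / radius" k] s by simp
  define c where "c = s ^ K * (connect_weight / 2)"
  have one: "c \<le> (\<Sum>k\<le>K. weight_sum (n + k) x / radius ^ (n + k))" if x: "x \<in> \<Sigma>" for n x
  proof -
    have "\<exists>y\<in>\<Sigma>. sup_weight n / 2 < weight_sum n y"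
    proof (rule ccontr)
      assume "\<not> ?thesis"
      then have "sup_weight n \<le> sup_weight n / 2" by (intro sup_weight_le) (auto simp: not_less)
      then show False using sup_weight_pos[of n] by linarith
    qed
    then obtain y where y: "y \<in> \<Sigma>" "sup_weight n / 2 < weight_sum n y" by blast
    then have "radius ^ n / 2 \<le> weight_sum n y" using radius_le[of n] by linarith
    then have "connect_weight * (radius ^ n / 2) \<le> (\<Sum>k\<le>K. weight_sum (n + k) x)"
      using weight_sum_connect[OF x y(1), of n] connect_weight_pos
        mult_left_mono[of "radius ^ n / 2" "weight_sum n y" connect_weight] by linarith
    then have "s ^ K / radius ^ n * (connect_weight * (radius ^ n / 2))
      \<le> s ^ K / radius ^ n * (\<Sum>k\<le>K. weight_sum (n + k) x)"
      using s radius_pos by (intro mult_left_mono) auto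
    also have "\<dots> = (\<Sum>k\<le>K. s ^ K * (weight_sum (n + k) x / radius ^ n))"
      by (simp add: sum_distrib_left)
    also have "\<dots> \<le> (\<Sum>k\<le>K. (1 / radius) ^ k * (weight_sum (n + k) x / radius ^ n))"
      using sk radius_pos by (intro sum_mono mult_right_mono) (auto simp: weight_sum_nonneg)
    also have "\<dots> = (\<Sum>k\<le>K. weight_sum (n + k) x / radius ^ (n + k))"
      by (simp add: power_add power_divide field_simps)
    finally show ?thesis using radius_pos by (simp add: c_def)
  qed
  have "c / real (K + 1) * real J \<le> cesaro (J + K) x" if x: "x \<in> \<Sigma>" for J x
  proof -
    have "real J * c \<le> (\<Sum>n<J. \<Sum>k\<le>K. weight_sum (n + k) x / radius ^ (n + k))"
      using sum_mono[of "{..<J}" "\<lambda>_. c", OF one[OF x]] by simp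
    also have "\<dots> \<le> real (K + 1) * cesaro (J + K) x"
      unfolding cesaro_def using radius_pos
      by (intro sum_overlapping_le[of "\<lambda>n. weight_sum n x / radius ^ n"]) (simp add: weight_sum_nonneg)
    finally show ?thesis by (simp add: field_simps)
  qed
  moreover have "c / real (K + 1) > 0" using s connect_weight_pos by (simp add: c_def)
  ultimately show ?thesis by blast
qed

end


section \<open>Bounds for norms of square-summable functions\<close>

text \<open>The statement that a norm is at most \<open>B\<close> only involves finite sums. In this form
  it is stable under pointwise limits and needs no summability side conditions.\<close>

definition l2_bounded :: "'y set \<Rightarrow> ('y \<Rightarrow> real) \<Rightarrow> real \<Rightarrow> bool" where
  "l2_bounded Y f B \<longleftrightarrow> (\<forall>A. finite A \<longrightarrow> A \<subseteq> Y \<longrightarrow> L2_set f A \<le> B)"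

lemma l2_bounded_nonneg: "l2_bounded Y f B \<Longrightarrow> 0 \<le> B"
  unfolding l2_bounded_def by (metis L2_set_empty empty_subsetI finite.emptyI)

lemma l2_bounded_weaken: "l2_bounded Y f B \<Longrightarrow> B \<le> C \<Longrightarrow> l2_bounded Y f C"
  unfolding l2_bounded_def by force

lemma L2_set_abs: "L2_set (\<lambda>y. \<bar>f y\<bar>) A = L2_set f A"
  by (simp add: L2_set_def)

lemma l2_bounded_mono:
  assumes "l2_bounded Y g B" "\<And>y. y \<in> Y \<Longrightarrow> \<bar>f y\<bar> \<le> g y"
  shows "l2_bounded Y f B"
  unfolding l2_bounded_def
proof (intro allI impI)
  fix A assume A: "finite A" "A \<subseteq> Y"
  have "L2_set f A = L2_set (\<lambda>y. \<bar>f y\<bar>) A" by (simp add: L2_set_abs)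
  also have "\<dots> \<le> L2_set g A" using A assms(2) by (intro L2_set_mono) auto
  finally show "L2_set f A \<le> B" using assms(1) A unfolding l2_bounded_def by force
qed

lemma l2_bounded_cong:
  "l2_bounded Y f B \<Longrightarrow> (\<And>y. y \<in> Y \<Longrightarrow> f y = g y) \<Longrightarrow> l2_bounded Y g B"
  unfolding l2_bounded_def using L2_set_cong[OF refl, of _ f g] by (metis subsetD)

lemma l2_bounded_zero [simp]: "0 \<le> B \<Longrightarrow> l2_bounded Y (\<lambda>_. 0) B"
  by (simp add: l2_bounded_def L2_set_0')

lemma l2_bounded_add:
  assumes "l2_bounded Y f B" "l2_bounded Y g C"
  shows "l2_bounded Y (\<lambda>y. f y + g y) (B + C)"
  using assms L2_set_triangle_ineq[of f g] unfolding l2_bounded_def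
  by (meson add_mono order_trans)

lemma l2_bounded_cmult:
  assumes "l2_bounded Y f B"
  shows "l2_bounded Y (\<lambda>y. c * f y) (\<bar>c\<bar> * B)"
  unfolding l2_bounded_def
proof (intro allI impI)
  fix A assume A: "finite A" "A \<subseteq> Y"
  have "L2_set (\<lambda>y. c * f y) A = L2_set (\<lambda>y. \<bar>c\<bar> * f y) A"
    by (simp add: L2_set_def power_mult_distrib)
  also have "\<dots> = \<bar>c\<bar> * L2_set f A" by (simp add: L2_set_right_distrib)
  also have "\<dots> \<le> \<bar>c\<bar> * B" using assms A by (intro mult_left_mono) (auto simp: l2_bounded_def)
  finally show "L2_set (\<lambda>y. c * f y) A \<le> \<bar>c\<bar> * B" .
qed

lemma l2_bounded_cmult_nonneg:
  "l2_bounded Y f B \<Longrightarrow> 0 \<le> c \<Longrightarrow> l2_bounded Y (\<lambda>y. c * f y) (c * B)"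
  using l2_bounded_cmult[of Y f B c] by simp

lemma l2_bounded_sum:
  assumes "\<And>i. i \<in> I \<Longrightarrow> l2_bounded Y (f i) (B i)"
  shows "l2_bounded Y (\<lambda>y. \<Sum>i\<in>I. f i y) (\<Sum>i\<in>I. B i)"
  using assms
proof (induction I rule: infinite_finite_induct)
  case (insert i I)
  then show ?case by (simp add: l2_bounded_add)
qed simp_all

lemma l2_bounded_compose:
  assumes "l2_bounded Y f B" "inj_on h Y" "h ` Y \<subseteq> Y"
  shows "l2_bounded Y (\<lambda>y. f (h y)) B"
  unfolding l2_bounded_def
proof (intro allI impI)
  fix A assume A: "finite A" "A \<subseteq> Y"
  have "L2_set (\<lambda>y. f (h y)) A = L2_set f (h ` A)"
    unfolding L2_set_def using inj_on_subset[OF assms(2) A(2)] by (simp add: sum.reindex)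
  also have "\<dots> \<le> B" using assms(1,3) A unfolding l2_bounded_def by blast
  finally show "L2_set (\<lambda>y. f (h y)) A \<le> B" .
qed

lemma l2_bounded_limit:
  assumes "\<And>n. l2_bounded Y (f n) B" "\<And>y. y \<in> Y \<Longrightarrow> (\<lambda>n. f n y) \<longlonglongrightarrow> g y"
  shows "l2_bounded Y g B"
  unfolding l2_bounded_def
proof (intro allI impI)
  fix A assume A: "finite A" "A \<subseteq> Y"
  have "(\<lambda>n. L2_set (f n) A) \<longlonglongrightarrow> L2_set g A"
    unfolding L2_set_def using A assms(2)
    by (intro tendsto_real_sqrt tendsto_sum tendsto_power) blast
  then show "L2_set g A \<le> B"
    by (rule LIMSEQ_le_const2) (use assms(1) A in \<open>auto simp: l2_bounded_def\<close>)
qed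

lemma l2_bounded_limit_bound:
  assumes "\<And>n. l2_bounded Y f (B n)" "B \<longlonglongrightarrow> C"
  shows "l2_bounded Y f C"
  unfolding l2_bounded_def
proof (intro allI impI)
  fix A assume "finite A" "A \<subseteq> Y"
  then show "L2_set f A \<le> C"
    by (intro LIMSEQ_le_const[OF assms(2)]) (use assms(1) in \<open>auto simp: l2_bounded_def\<close>)
qed

lemma l2_bounded_pointwise: "l2_bounded Y f B \<Longrightarrow> y \<in> Y \<Longrightarrow> \<bar>f y\<bar> \<le> B"
  unfolding l2_bounded_def by (drule spec[of _ "{y}"]) (simp add: L2_set_def)

lemma ell2_norm_nonneg [simp]: "0 \<le> ell2_norm Y \<phi>"
  by (simp add: ell2_norm_def infsum_nonneg)

lemma ell2_bounded:
  assumes "\<phi> \<in> ell2 Y"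
  shows "l2_bounded Y (\<lambda>y. cmod (\<phi> y)) (ell2_norm Y \<phi>)"
  unfolding l2_bounded_def L2_set_def ell2_norm_def
  using assms by (auto simp: ell2_def intro!: finite_sum_le_infsum)

lemma ell2I:
  assumes "\<And>y. y \<notin> Y \<Longrightarrow> \<phi> y = 0" "l2_bounded Y (\<lambda>y. cmod (\<phi> y)) B"
  shows "\<phi> \<in> ell2 Y" "ell2_norm Y \<phi> \<le> B"
proof -
  have B: "B \<ge> 0" using assms(2) by (rule l2_bounded_nonneg)
  have fin: "(\<Sum>y\<in>A. (cmod (\<phi> y))\<^sup>2) \<le> B\<^sup>2" if "finite A" "A \<subseteq> Y" for A
    using assms(2) that B unfolding l2_bounded_def L2_set_def by (metis sqrt_le_D)
  have "(\<lambda>y. (cmod (\<phi> y))\<^sup>2) summable_on Y"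
    by (rule nonneg_bdd_above_summable_on) (auto intro!: bdd_aboveI2[where M = "B\<^sup>2"] fin)
  then show "\<phi> \<in> ell2 Y" using assms(1) by (simp add: ell2_def)
  have "(\<Sum>\<^sub>\<infinity>y\<in>Y. (cmod (\<phi> y))\<^sup>2) \<le> B\<^sup>2"
    using \<open>(\<lambda>y. (cmod (\<phi> y))\<^sup>2) summable_on Y\<close> fin by (intro infsum_le_finite_sums) auto
  then show "ell2_norm Y \<phi> \<le> B" unfolding ell2_norm_def using B real_le_lsqrt by blast
qed


section \<open>Hoelder functions with square-summable values\<close>

lemma hoelder_norm_finite:
  assumes "hoelder_norm \<alpha> \<Sigma> nrm \<Phi> < \<infinity>"
  obtains s t where "0 \<le> s" "0 \<le> t" "enn2real (hoelder_norm \<alpha> \<Sigma> nrm \<Phi>) = s + t"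
    "\<And>x. x \<in> \<Sigma> \<Longrightarrow> nrm (\<Phi> x) \<le> s"
    "\<And>x y. x \<in> \<Sigma> \<Longrightarrow> y \<in> \<Sigma> \<Longrightarrow> x \<noteq> y \<Longrightarrow> nrm (\<Phi> x - \<Phi> y) \<le> t * hdist \<alpha> x y"
proof -
  let ?s = "sup_norm \<Sigma> nrm \<Phi>" and ?t = "hoelder_seminorm \<alpha> \<Sigma> nrm \<Phi>"
  have fin: "?s < \<infinity>" "?t < \<infinity>" using assms by (auto simp: hoelder_norm_def)
  show thesis
  proof (rule that[of "enn2real ?s" "enn2real ?t"])
    show "enn2real (hoelder_norm \<alpha> \<Sigma> nrm \<Phi>) = enn2real ?s + enn2real ?t"
      unfolding hoelder_norm_def using fin by (simp add: enn2real_plus)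
    fix x assume x: "x \<in> \<Sigma>"
    have "ennreal (nrm (\<Phi> x)) \<le> ennreal (enn2real ?s)"
      using fin(1) SUP_upper[OF x, of "\<lambda>x. ennreal (nrm (\<Phi> x))"] by (simp add: sup_norm_def)
    then show "nrm (\<Phi> x) \<le> enn2real ?s" by (simp add: ennreal_le_iff)
    fix y assume y: "y \<in> \<Sigma>" "x \<noteq> y"
    have "ennreal (nrm (\<Phi> x - \<Phi> y) / word_dist x y powr \<alpha>) \<le> ?t"
      unfolding hoelder_seminorm_def using x y
      by (intro SUP_upper2[of "(x, y)"]) auto
    also have "\<dots> = ennreal (enn2real ?t)" using fin(2) by simp
    finally have "nrm (\<Phi> x - \<Phi> y) / hdist \<alpha> x y \<le> enn2real ?t"
      by (simp add: ennreal_le_iff hdist_def)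
    then show "nrm (\<Phi> x - \<Phi> y) \<le> enn2real ?t * hdist \<alpha> x y"
      using hdist_pos[OF y(2), of \<alpha>] by (simp add: pos_divide_le_eq)
  qed simp_all
qed

lemma hoelder_norm_le:
  assumes "0 \<le> s" "0 \<le> t" "\<And>x. x \<in> \<Sigma> \<Longrightarrow> nrm (\<Phi> x) \<le> s"
    "\<And>x y. x \<in> \<Sigma> \<Longrightarrow> y \<in> \<Sigma> \<Longrightarrow> x \<noteq> y \<Longrightarrow> nrm (\<Phi> x - \<Phi> y) \<le> t * hdist \<alpha> x y"
  shows "hoelder_norm \<alpha> \<Sigma> nrm \<Phi> \<le> ennreal (s + t)"
proof -
  have "sup_norm \<Sigma> nrm \<Phi> \<le> ennreal s"
    unfolding sup_norm_def by (intro SUP_least ennreal_leI assms(3))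
  moreover have "hoelder_seminorm \<alpha> \<Sigma> nrm \<Phi> \<le> ennreal t"
    unfolding hoelder_seminorm_def
  proof (rule SUP_least, clarify, rule ennreal_leI)
    fix x y assume xy: "x \<in> \<Sigma>" "y \<in> \<Sigma>" "x \<noteq> y"
    show "nrm (\<Phi> x - \<Phi> y) / word_dist x y powr \<alpha> \<le> t"
      using assms(4)[OF xy] hdist_pos[OF xy(3), of \<alpha>] by (simp add: pos_divide_le_eq hdist_def)
  qed
  ultimately show ?thesis
    unfolding hoelder_norm_def using assms(1,2) by (simp add: add_mono)
qed

text \<open>The bounds for the supremum and for the Hoelder seminorm are kept apart, because
  the Lasota-Yorke inequality treats them differently.\<close>

definition hoelder_bounded ::
  "real \<Rightarrow> 'a word set \<Rightarrow> 'y set \<Rightarrow> ('a word \<Rightarrow> 'y \<Rightarrow> complex) \<Rightarrow> real \<Rightarrow> real \<Rightarrow> bool" where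
  "hoelder_bounded \<alpha> \<Sigma> Y \<Phi> s t \<longleftrightarrow> 0 \<le> s \<and> 0 \<le> t \<and>
     (\<forall>x \<eta>. x \<notin> \<Sigma> \<or> \<eta> \<notin> Y \<longrightarrow> \<Phi> x \<eta> = 0) \<and>
     (\<forall>x\<in>\<Sigma>. l2_bounded Y (\<lambda>\<eta>. cmod (\<Phi> x \<eta>)) s) \<and>
     (\<forall>x\<in>\<Sigma>. \<forall>x'\<in>\<Sigma>. l2_bounded Y (\<lambda>\<eta>. cmod (\<Phi> x \<eta> - \<Phi> x' \<eta>)) (t * hdist \<alpha> x x'))"

lemma hoelder_boundedI:
  assumes "0 \<le> s" "0 \<le> t" "\<And>x \<eta>. x \<notin> \<Sigma> \<or> \<eta> \<notin> Y \<Longrightarrow> \<Phi> x \<eta> = 0"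
    and "\<And>x. x \<in> \<Sigma> \<Longrightarrow> l2_bounded Y (\<lambda>\<eta>. cmod (\<Phi> x \<eta>)) s"
    and "\<And>x x'. x \<in> \<Sigma> \<Longrightarrow> x' \<in> \<Sigma> \<Longrightarrow> l2_bounded Y (\<lambda>\<eta>. cmod (\<Phi> x \<eta> - \<Phi> x' \<eta>)) (t * hdist \<alpha> x x')"
  shows "hoelder_bounded \<alpha> \<Sigma> Y \<Phi> s t"
  unfolding hoelder_bounded_def using assms by blast

lemma hoelder_boundedD:
  assumes "hoelder_bounded \<alpha> \<Sigma> Y \<Phi> s t"
  shows "0 \<le> s" "0 \<le> t" "x \<notin> \<Sigma> \<or> \<eta> \<notin> Y \<Longrightarrow> \<Phi> x \<eta> = 0"
    and "x \<in> \<Sigma> \<Longrightarrow> l2_bounded Y (\<lambda>\<eta>. cmod (\<Phi> x \<eta>)) s"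
    and "x \<in> \<Sigma> \<Longrightarrow> x' \<in> \<Sigma> \<Longrightarrow> l2_bounded Y (\<lambda>\<eta>. cmod (\<Phi> x \<eta> - \<Phi> x' \<eta>)) (t * hdist \<alpha> x x')"
  using assms unfolding hoelder_bounded_def by auto

lemma hoelder_bounded_weaken:
  assumes "hoelder_bounded \<alpha> \<Sigma> Y \<Phi> s t" "s \<le> s'" "t \<le> t'"
  shows "hoelder_bounded \<alpha> \<Sigma> Y \<Phi> s' t'"
proof (rule hoelder_boundedI)
  note 1 = hoelder_boundedD[OF assms(1)]
  show "0 \<le> s'" "0 \<le> t'" using 1(1,2) assms(2,3) by auto
  show "\<Phi> x \<eta> = 0" if "x \<notin> \<Sigma> \<or> \<eta> \<notin> Y" for x \<eta> using 1(3) that .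
  show "l2_bounded Y (\<lambda>\<eta>. cmod (\<Phi> x \<eta>)) s'" if "x \<in> \<Sigma>" for x
    using l2_bounded_weaken[OF 1(4)[OF that] assms(2)] .
  show "l2_bounded Y (\<lambda>\<eta>. cmod (\<Phi> x \<eta> - \<Phi> x' \<eta>)) (t' * hdist \<alpha> x x')"
    if "x \<in> \<Sigma>" "x' \<in> \<Sigma>" for x x'
    using l2_bounded_weaken[OF 1(5)[OF that] mult_right_mono[OF assms(3)]] by simp
qed

lemma hoelder_bounded_pointwise:
  assumes "hoelder_bounded \<alpha> \<Sigma> Y \<Phi> s t"
  shows "cmod (\<Phi> x \<eta>) \<le> s"
proof (cases "x \<in> \<Sigma> \<and> \<eta> \<in> Y")
  case True
  then show ?thesis
    using l2_bounded_pointwise[OF hoelder_boundedD(4)[OF assms, of x], of \<eta>] by simp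
next
  case False
  then show ?thesis using hoelder_boundedD(1,3)[OF assms] by auto
qed

lemma hoelder_bounded_zero: "hoelder_bounded \<alpha> \<Sigma> Y (\<lambda>_ _. 0) 0 0"
  by (intro hoelder_boundedI) auto

lemma hoelder_bounded_add:
  assumes "hoelder_bounded \<alpha> \<Sigma> Y \<Phi> s t" "hoelder_bounded \<alpha> \<Sigma> Y \<Psi> s' t'"
  shows "hoelder_bounded \<alpha> \<Sigma> Y (\<lambda>x \<eta>. \<Phi> x \<eta> + \<Psi> x \<eta>) (s + s') (t + t')"
proof (rule hoelder_boundedI)
  note 1 = hoelder_boundedD[OF assms(1)] and 2 = hoelder_boundedD[OF assms(2)]
  show "0 \<le> s + s'" "0 \<le> t + t'" using 1 2 by auto
  show "\<Phi> x \<eta> + \<Psi> x \<eta> = 0" if "x \<notin> \<Sigma> \<or> \<eta> \<notin> Y" for x \<eta> using 1(3) 2(3) that by simp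
  show "l2_bounded Y (\<lambda>\<eta>. cmod (\<Phi> x \<eta> + \<Psi> x \<eta>)) (s + s')" if "x \<in> \<Sigma>" for x
    by (rule l2_bounded_mono[OF l2_bounded_add[OF 1(4)[OF that] 2(4)[OF that]]])
      (simp add: norm_triangle_ineq)
  fix x x' assume x: "x \<in> \<Sigma>" "x' \<in> \<Sigma>"
  have "l2_bounded Y (\<lambda>\<eta>. cmod (\<Phi> x \<eta> + \<Psi> x \<eta> - (\<Phi> x' \<eta> + \<Psi> x' \<eta>))) (t * hdist \<alpha> x x' + t' * hdist \<alpha> x x')"
    by (rule l2_bounded_mono[OF l2_bounded_add[OF 1(5)[OF x] 2(5)[OF x]]])
      (simp add: add_diff_add norm_triangle_ineq)
  then show "l2_bounded Y (\<lambda>\<eta>. cmod (\<Phi> x \<eta> + \<Psi> x \<eta> - (\<Phi> x' \<eta> + \<Psi> x' \<eta>))) ((t + t') * hdist \<alpha> x x')"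
    by (simp add: distrib_right)
qed

lemma hoelder_bounded_scale:
  assumes "hoelder_bounded \<alpha> \<Sigma> Y \<Phi> s t"
  shows "hoelder_bounded \<alpha> \<Sigma> Y (\<lambda>x \<eta>. c * \<Phi> x \<eta>) (cmod c * s) (cmod c * t)"
proof (rule hoelder_boundedI)
  note 1 = hoelder_boundedD[OF assms(1)]
  show "0 \<le> cmod c * s" "0 \<le> cmod c * t" using 1 by auto
  show "c * \<Phi> x \<eta> = 0" if "x \<notin> \<Sigma> \<or> \<eta> \<notin> Y" for x \<eta> using 1(3) that by simp
  show "l2_bounded Y (\<lambda>\<eta>. cmod (c * \<Phi> x \<eta>)) (cmod c * s)" if "x \<in> \<Sigma>" for x
    using l2_bounded_cmult_nonneg[OF 1(4)[OF that], of "cmod c"] by (simp add: norm_mult)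
  show "l2_bounded Y (\<lambda>\<eta>. cmod (c * \<Phi> x \<eta> - c * \<Phi> x' \<eta>)) (cmod c * t * hdist \<alpha> x x')"
    if "x \<in> \<Sigma>" "x' \<in> \<Sigma>" for x x'
    using l2_bounded_cmult_nonneg[OF 1(5)[OF that], of "cmod c"]
    by (simp add: norm_mult mult.assoc flip: right_diff_distrib)
qed

lemma hoelder_bounded_sum:
  assumes "\<And>i. i \<in> I \<Longrightarrow> hoelder_bounded \<alpha> \<Sigma> Y (\<Phi> i) (s i) (t i)"
  shows "hoelder_bounded \<alpha> \<Sigma> Y (\<lambda>x \<eta>. \<Sum>i\<in>I. \<Phi> i x \<eta>) (\<Sum>i\<in>I. s i) (\<Sum>i\<in>I. t i)"
  using assms
proof (induction I rule: infinite_finite_induct)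
  case (insert i I)
  then show ?case by (simp add: hoelder_bounded_add)
qed (simp_all add: hoelder_bounded_zero)

lemma hoelder_bounded_limit:
  assumes "\<And>n. hoelder_bounded \<alpha> \<Sigma> Y (\<Phi> n) s t" "\<And>x \<eta>. (\<lambda>n. \<Phi> n x \<eta>) \<longlonglongrightarrow> \<Psi> x \<eta>"
  shows "hoelder_bounded \<alpha> \<Sigma> Y \<Psi> s t"
proof (rule hoelder_boundedI)
  note 1 = hoelder_boundedD[OF assms(1)]
  show "0 \<le> s" "0 \<le> t" using 1 by auto
  show "\<Psi> x \<eta> = 0" if "x \<notin> \<Sigma> \<or> \<eta> \<notin> Y" for x \<eta>
    using assms(2)[of x \<eta>] 1(3)[OF that] by (simp add: LIMSEQ_const_iff)
  show "l2_bounded Y (\<lambda>\<eta>. cmod (\<Psi> x \<eta>)) s" if "x \<in> \<Sigma>" for x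
    by (rule l2_bounded_limit[where f = "\<lambda>n \<eta>. cmod (\<Phi> n x \<eta>)"])
      (intro 1(4)[OF that] tendsto_norm assms(2))+
  show "l2_bounded Y (\<lambda>\<eta>. cmod (\<Psi> x \<eta> - \<Psi> x' \<eta>)) (t * hdist \<alpha> x x')" if "x \<in> \<Sigma>" "x' \<in> \<Sigma>" for x x'
    by (rule l2_bounded_limit[where f = "\<lambda>n \<eta>. cmod (\<Phi> n x \<eta> - \<Phi> n x' \<eta>)"])
      (intro 1(5)[OF that] tendsto_norm tendsto_diff assms(2))+
qed

abbreviation ell2_hoelder :: "real \<Rightarrow> 'a word set \<Rightarrow> 'y set \<Rightarrow> ('a word \<Rightarrow> 'y \<Rightarrow> complex) set" where
  "ell2_hoelder \<alpha> \<Sigma> Y \<equiv> hoelder_space \<alpha> \<Sigma> (ell2 Y) (ell2_norm Y)"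

abbreviation ell2_hoelder_norm :: "real \<Rightarrow> 'a word set \<Rightarrow> 'y set \<Rightarrow> ('a word \<Rightarrow> 'y \<Rightarrow> complex) \<Rightarrow> real" where
  "ell2_hoelder_norm \<alpha> \<Sigma> Y \<equiv> hoelder_norm_real \<alpha> \<Sigma> (ell2_norm Y)"

lemma ell2_diff:
  assumes "\<phi> \<in> ell2 Y" "\<psi> \<in> ell2 Y"
  shows "\<phi> - \<psi> \<in> ell2 Y"
proof (rule ell2I(1))
  show "(\<phi> - \<psi>) y = 0" if "y \<notin> Y" for y using assms that by (simp add: ell2_def)
  show "l2_bounded Y (\<lambda>y. cmod ((\<phi> - \<psi>) y)) (ell2_norm Y \<phi> + ell2_norm Y \<psi>)"
    by (rule l2_bounded_mono[OF l2_bounded_add[OF assms[THEN ell2_bounded]]])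
      (simp add: norm_triangle_ineq4)
qed

lemma ell2_hoelder_bounded:
  assumes "\<Phi> \<in> ell2_hoelder \<alpha> \<Sigma> Y"
  shows "hoelder_bounded \<alpha> \<Sigma> Y \<Phi> (ell2_hoelder_norm \<alpha> \<Sigma> Y \<Phi>) (ell2_hoelder_norm \<alpha> \<Sigma> Y \<Phi>)"
proof -
  have \<Phi>: "\<And>x. x \<in> \<Sigma> \<Longrightarrow> \<Phi> x \<in> ell2 Y" "\<And>x. x \<notin> \<Sigma> \<Longrightarrow> \<Phi> x = 0"
    and fin: "hoelder_norm \<alpha> \<Sigma> (ell2_norm Y) \<Phi> < \<infinity>"
    using assms by (auto simp: hoelder_space_def)
  obtain s t where st: "0 \<le> s" "0 \<le> t" "ell2_hoelder_norm \<alpha> \<Sigma> Y \<Phi> = s + t"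
    "\<And>x. x \<in> \<Sigma> \<Longrightarrow> ell2_norm Y (\<Phi> x) \<le> s"
    "\<And>x y. x \<in> \<Sigma> \<Longrightarrow> y \<in> \<Sigma> \<Longrightarrow> x \<noteq> y \<Longrightarrow> ell2_norm Y (\<Phi> x - \<Phi> y) \<le> t * hdist \<alpha> x y"
    using hoelder_norm_finite[OF fin] unfolding hoelder_norm_real_def by metis
  have "hoelder_bounded \<alpha> \<Sigma> Y \<Phi> s t"
  proof (rule hoelder_boundedI[OF st(1,2)])
    show "\<Phi> x \<eta> = 0" if "x \<notin> \<Sigma> \<or> \<eta> \<notin> Y" for x \<eta>
      using \<Phi> that by (cases "x \<in> \<Sigma>") (auto simp: ell2_def)
    show "l2_bounded Y (\<lambda>\<eta>. cmod (\<Phi> x \<eta>)) s" if "x \<in> \<Sigma>" for x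
      using l2_bounded_weaken[OF ell2_bounded[OF \<Phi>(1)[OF that]] st(4)[OF that]] .
    fix x x' assume x: "x \<in> \<Sigma>" "x' \<in> \<Sigma>"
    show "l2_bounded Y (\<lambda>\<eta>. cmod (\<Phi> x \<eta> - \<Phi> x' \<eta>)) (t * hdist \<alpha> x x')"
    proof (cases "x = x'")
      case False
      then show ?thesis
        using l2_bounded_weaken[OF ell2_bounded[OF ell2_diff[OF \<Phi>(1)[OF x(1)] \<Phi>(1)[OF x(2)]]] st(5)[OF x]]
        by simp
    qed simp
  qed
  then show ?thesis by (rule hoelder_bounded_weaken) (use st in auto)
qed

lemma hoelder_bounded_ell2:
  assumes "hoelder_bounded \<alpha> \<Sigma> Y \<Phi> s t"
  shows "\<Phi> \<in> ell2_hoelder \<alpha> \<Sigma> Y" "ell2_hoelder_norm \<alpha> \<Sigma> Y \<Phi> \<le> s + t"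
proof -
  note 1 = hoelder_boundedD[OF assms]
  have el: "\<Phi> x \<in> ell2 Y" "ell2_norm Y (\<Phi> x) \<le> s" if "x \<in> \<Sigma>" for x
    using ell2I[OF _ 1(4)[OF that]] 1(3) by auto
  have eld: "ell2_norm Y (\<Phi> x - \<Phi> x') \<le> t * hdist \<alpha> x x'" if "x \<in> \<Sigma>" "x' \<in> \<Sigma>" for x x'
    by (rule ell2I) (use 1(3) 1(5)[OF that] in auto)
  have le: "hoelder_norm \<alpha> \<Sigma> (ell2_norm Y) \<Phi> \<le> ennreal (s + t)"
    using 1(1,2) el(2) eld by (intro hoelder_norm_le)
  then have "hoelder_norm \<alpha> \<Sigma> (ell2_norm Y) \<Phi> < \<infinity>"
    by (rule le_less_trans) simp
  then show "\<Phi> \<in> ell2_hoelder \<alpha> \<Sigma> Y"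
    using el(1) 1(3) by (auto simp: hoelder_space_def fun_eq_iff)
  show "ell2_hoelder_norm \<alpha> \<Sigma> Y \<Phi> \<le> s + t"
    unfolding hoelder_norm_real_def using enn2real_leI[OF _ le] 1(1,2) by simp
qed


section \<open>Iterates of the twisted transfer operator\<close>

lemma sum_apply: "(\<Sum>i\<in>I. f i) y = (\<Sum>i\<in>I. f i y)"
  by (induction I rule: infinite_finite_induct) auto

locale twisted_shift = weighted_shift \<Sigma> F \<alpha> b M K
  for \<Sigma> :: "'a::finite word set" and F \<alpha> b M K +
  fixes G :: "('g, 'm) monoid_scheme" and \<theta> :: "'a word \<Rightarrow> 'g"
    and Y :: "'y set" and act :: "'g \<Rightarrow> 'y \<Rightarrow> 'y"
  assumes action: "group_action G Y act"
    and theta_closed: "x \<in> \<Sigma> \<Longrightarrow> \<theta> x \<in> carrier G"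
    and theta_window: "x \<in> \<Sigma> \<Longrightarrow> y \<in> \<Sigma> \<Longrightarrow> agree M x y \<Longrightarrow> \<theta> x = \<theta> y"
begin

lemma group_G: "group G"
  using group_action.group_hom[OF action] group_hom.axioms(1) by blast

lemma act_mult: "g \<in> carrier G \<Longrightarrow> h \<in> carrier G \<Longrightarrow> y \<in> Y \<Longrightarrow> act (g \<otimes>\<^bsub>G\<^esub> h) y = act g (act h y)"
  using group_action.composition_rule[OF action] by metis

lemma act_one: "y \<in> Y \<Longrightarrow> act \<one>\<^bsub>G\<^esub> y = y"
  using group_action.id_eq_one[OF action] by (metis restrict_apply')

lemma act_in: "g \<in> carrier G \<Longrightarrow> y \<in> Y \<Longrightarrow> act g y \<in> Y"
  using group_action.element_image[OF action] by blast

lemma act_inj: "g \<in> carrier G \<Longrightarrow> inj_on (act g) Y"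
  using group_action.inj_prop[OF action] .

lemma l2_bounded_act: "l2_bounded Y f B \<Longrightarrow> g \<in> carrier G \<Longrightarrow> l2_bounded Y (\<lambda>y. f (act g y)) B"
  by (rule l2_bounded_compose) (auto simp: act_in act_inj)

abbreviation \<theta>n :: "nat \<Rightarrow> 'a word \<Rightarrow> 'g" where "\<theta>n \<equiv> cocycle G \<theta>"

lemma cocycle_closed: "x \<in> \<Sigma> \<Longrightarrow> \<theta>n n x \<in> carrier G"
proof (induction n arbitrary: x)
  case (Suc n)
  have "\<theta>n n (shift x) \<in> carrier G" using Suc.IH suffix_in[OF Suc.prems] by blast
  then show ?case
    using theta_closed[OF Suc.prems] monoid.m_closed[OF group.is_monoid[OF group_G]]
    by (simp only: cocycle.simps)
qed (simp add: monoid.one_closed[OF group.is_monoid[OF group_G]])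

lemma cocycle_add: "x \<in> \<Sigma> \<Longrightarrow> \<theta>n (n + m) x = \<theta>n n x \<otimes>\<^bsub>G\<^esub> \<theta>n m (suffix n x)"
proof (induction n arbitrary: x)
  case 0
  then show ?case using monoid.l_one[OF group.is_monoid[OF group_G]] cocycle_closed by simp
next
  case (Suc n)
  have "shift x \<in> \<Sigma>" "suffix n (shift x) \<in> \<Sigma>" using Suc.prems suffix_in by auto
  then have "\<theta> x \<otimes>\<^bsub>G\<^esub> (\<theta>n n (shift x) \<otimes>\<^bsub>G\<^esub> \<theta>n m (suffix n (shift x)))
     = \<theta> x \<otimes>\<^bsub>G\<^esub> \<theta>n n (shift x) \<otimes>\<^bsub>G\<^esub> \<theta>n m (suffix n (shift x))"
    using monoid.m_assoc[OF group.is_monoid[OF group_G]] theta_closed[OF Suc.prems] cocycle_closed by metis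
  then show ?case using Suc.IH[OF \<open>shift x \<in> \<Sigma>\<close>] by (simp only: add_Suc cocycle.simps suffix_suffix plus_1_eq_Suc)
qed

lemma cocycle_window:
  "x \<in> \<Sigma> \<Longrightarrow> y \<in> \<Sigma> \<Longrightarrow> agree (n + M) x y \<Longrightarrow> \<theta>n n x = \<theta>n n y"
proof (induction n arbitrary: x y)
  case (Suc n)
  have "agree M x y" using agree_mono[OF Suc.prems(3), of M] by simp
  then have "\<theta> x = \<theta> y" using theta_window Suc.prems by blast
  moreover have "agree (n + M) (shift x) (shift y)" using agree_shift[of "n + M" x y] Suc.prems(3) by simp
  then have "\<theta>n n (shift x) = \<theta>n n (shift y)" using Suc.IH suffix_in Suc.prems by blast
  ultimately show ?case by (simp only: cocycle.simps)
qed simp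

definition twisted_sum :: "nat \<Rightarrow> ('a word \<Rightarrow> 'y \<Rightarrow> 'v::real_vector) \<Rightarrow> 'a word \<Rightarrow> 'y \<Rightarrow> 'v" where
  "twisted_sum n \<Phi> x \<eta> = (\<Sum>y\<in>preimages n x. weight n y *\<^sub>R \<Phi> y (act (\<theta>n n y) \<eta>))"

lemma twisted_sum_0: "x \<in> \<Sigma> \<Longrightarrow> \<eta> \<in> Y \<Longrightarrow> twisted_sum 0 \<Phi> x \<eta> = \<Phi> x \<eta>"
  by (simp add: twisted_sum_def preimages_0 act_one)

lemma twisted_sum_add:
  assumes "\<eta> \<in> Y"
  shows "twisted_sum (n + m) \<Phi> x \<eta> = twisted_sum m (twisted_sum n \<Phi>) x \<eta>"
proof -
  have "twisted_sum (n + m) \<Phi> x \<eta> = (\<Sum>u\<in>preimages m x. \<Sum>y\<in>preimages n u.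
      weight (n + m) y *\<^sub>R \<Phi> y (act (\<theta>n (n + m) y) \<eta>))"
    unfolding twisted_sum_def by (rule sum_preimages_add)
  also have "\<dots> = (\<Sum>u\<in>preimages m x. \<Sum>y\<in>preimages n u.
      weight m u *\<^sub>R (weight n y *\<^sub>R \<Phi> y (act (\<theta>n n y) (act (\<theta>n m u) \<eta>))))"
  proof (intro sum.cong refl)
    fix u y assume "u \<in> preimages m x" "y \<in> preimages n u"
    then have "y \<in> \<Sigma>" "u \<in> \<Sigma>" "suffix n y = u" by (auto simp: preimages_def)
    then show "weight (n + m) y *\<^sub>R \<Phi> y (act (\<theta>n (n + m) y) \<eta>)
      = weight m u *\<^sub>R (weight n y *\<^sub>R \<Phi> y (act (\<theta>n n y) (act (\<theta>n m u) \<eta>)))"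
      using assms by (simp add: weight_add cocycle_add act_mult cocycle_closed mult.commute)
  qed
  also have "\<dots> = twisted_sum m (twisted_sum n \<Phi>) x \<eta>"
    by (simp add: twisted_sum_def scaleR_sum_right)
  finally show ?thesis .
qed

lemma twisted_sum_cong:
  assumes "\<eta> \<in> Y" "\<And>y \<zeta>. y \<in> preimages n x \<Longrightarrow> \<zeta> \<in> Y \<Longrightarrow> \<Phi> y \<zeta> = \<Psi> y \<zeta>"
  shows "twisted_sum n \<Phi> x \<eta> = twisted_sum n \<Psi> x \<eta>"
  unfolding twisted_sum_def using assms
  by (intro sum.cong refl) (simp add: act_in cocycle_closed preimagesD(1))

lemma preimages_weight_nonneg: "y \<in> preimages n x \<Longrightarrow> 0 \<le> weight m y"
  using weight_pos[of y m] preimagesD(1)[of y n x] by (simp add: less_imp_le)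

lemma twisted_sum_mono:
  fixes f g :: "'a word \<Rightarrow> 'y \<Rightarrow> real"
  assumes "\<eta> \<in> Y" "\<And>y \<zeta>. y \<in> preimages n x \<Longrightarrow> \<zeta> \<in> Y \<Longrightarrow> f y \<zeta> \<le> g y \<zeta>"
  shows "twisted_sum n f x \<eta> \<le> twisted_sum n g x \<eta>"
  unfolding twisted_sum_def using assms
  by (intro sum_mono scaleR_left_mono)
    (auto simp: act_in cocycle_closed preimagesD(1) preimages_weight_nonneg)

lemma norm_twisted_sum_le:
  "norm (twisted_sum n \<Phi> x \<eta>) \<le> twisted_sum n (\<lambda>y \<zeta>. norm (\<Phi> y \<zeta>)) x \<eta>"
  unfolding twisted_sum_def
  by (rule order_trans[OF norm_sum], rule sum_mono)
    (simp add: preimages_weight_nonneg)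

lemma l2_bounded_twisted_sum:
  fixes f :: "'a word \<Rightarrow> 'y \<Rightarrow> real"
  assumes "\<And>y. y \<in> preimages n x \<Longrightarrow> l2_bounded Y (f y) (B y)"
  shows "l2_bounded Y (twisted_sum n f x) (\<Sum>y\<in>preimages n x. weight n y * B y)"
proof -
  have "l2_bounded Y (\<lambda>\<eta>. \<Sum>y\<in>preimages n x. weight n y * f y (act (\<theta>n n y) \<eta>))
      (\<Sum>y\<in>preimages n x. weight n y * B y)"
    by (intro l2_bounded_sum l2_bounded_cmult_nonneg l2_bounded_act assms)
      (auto simp: preimagesD(1) cocycle_closed preimages_weight_nonneg)
  then show ?thesis unfolding twisted_sum_def by simp
qed

abbreviation L :: "('a word \<Rightarrow> 'y \<Rightarrow> complex) \<Rightarrow> 'a word \<Rightarrow> 'y \<Rightarrow> complex" where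
  "L \<equiv> twisted_transfer_operator \<Sigma> F G Y act \<theta>"

lemma L_apply: "L \<Phi> x \<eta> = (if x \<in> \<Sigma> \<and> \<eta> \<in> Y then twisted_sum 1 \<Phi> x \<eta> else 0)"
proof -
  have "L \<Phi> x \<eta> = (\<Sum>y\<in>preimages 1 x. F y *\<^sub>R \<Phi> y (act (\<theta> y) \<eta>))" if "x \<in> \<Sigma>" "\<eta> \<in> Y"
  proof -
    have "L \<Phi> x \<eta> = (\<Sum>y\<in>preimages 1 x.
        complex_of_real (F y) * induced_rep G Y act (inv\<^bsub>G\<^esub> \<theta> y) (\<Phi> y) \<eta>)"
      using that by (simp add: twisted_transfer_operator_def preimages_1[symmetric] sum_apply
          scaleC_fun_def scaleC_complex_def del: One_nat_def)
    also have "\<dots> = (\<Sum>y\<in>preimages 1 x. F y *\<^sub>R \<Phi> y (act (\<theta> y) \<eta>))"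
      using that by (intro sum.cong refl)
        (simp add: induced_rep_def group.inv_inv[OF group_G] theta_closed preimagesD(1) scaleR_conv_of_real)
    finally show ?thesis .
  qed
  moreover have "twisted_sum 1 \<Phi> x \<eta> = (\<Sum>y\<in>preimages 1 x. F y *\<^sub>R \<Phi> y (act (\<theta> y) \<eta>))"
    unfolding twisted_sum_def
    by (intro sum.cong refl)
      (simp add: theta_closed preimagesD(1) monoid.r_one[OF group.is_monoid[OF group_G]])
  moreover have "L \<Phi> x \<eta> = 0" if "x \<notin> \<Sigma> \<or> \<eta> \<notin> Y"
    using that by (auto simp: twisted_transfer_operator_def sum_apply scaleC_fun_def
        scaleC_complex_def induced_rep_def)
  ultimately show ?thesis by auto
qed

lemma L_power_apply:
  assumes "\<And>x \<eta>. x \<notin> \<Sigma> \<or> \<eta> \<notin> Y \<Longrightarrow> \<Phi> x \<eta> = 0"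
  shows "(L ^^ n) \<Phi> x \<eta> = (if x \<in> \<Sigma> \<and> \<eta> \<in> Y then twisted_sum n \<Phi> x \<eta> else 0)"
proof (induction n arbitrary: x \<eta>)
  case 0
  then show ?case using assms by (auto simp: twisted_sum_0)
next
  case (Suc n)
  have "twisted_sum 1 ((L ^^ n) \<Phi>) x \<eta> = twisted_sum (n + 1) \<Phi> x \<eta>" if "x \<in> \<Sigma>" "\<eta> \<in> Y"
    unfolding twisted_sum_add[OF that(2)]
    using that by (intro twisted_sum_cong) (simp_all add: Suc preimagesD(1))
  moreover have "(L ^^ Suc n) \<Phi> x \<eta> = L ((L ^^ n) \<Phi>) x \<eta>" by simp
  ultimately show ?case unfolding L_apply[of "(L ^^ n) \<Phi>"] by simp
qed

definition ly_const :: real where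
  "ly_const = weight_lip + 2 * exp (\<alpha> * real M)"

lemma ly_const_nonneg: "ly_const \<ge> 0"
  unfolding ly_const_def using weight_lip_nonneg by simp

lemma weight_lip_le: "weight_lip \<le> ly_const"
  unfolding ly_const_def by simp

lemma one_le_exp_dist:
  assumes "\<not> agree M x x'"
  shows "1 \<le> exp (\<alpha> * real M) * D x x'"
proof -
  have "exp (\<alpha> * real M) * exp (- \<alpha> * real M) \<le> exp (\<alpha> * real M) * D x x'"
    using hdist_ge_if_not_agree[OF alpha_pos assms] by (intro mult_left_mono) auto
  then show ?thesis by (simp add: exp_add[symmetric])
qed

lemma twisted_sum_diff:
  fixes \<Phi> :: "'a word \<Rightarrow> 'y \<Rightarrow> 'v::real_vector"
  assumes x: "x \<in> \<Sigma>" "x' \<in> \<Sigma>" "agree M x x'"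
  shows "twisted_sum n \<Phi> x \<eta> - twisted_sum n \<Phi> x' \<eta> = (\<Sum>y\<in>preimages n x.
    (weight n y - weight n (glue n y x')) *\<^sub>R \<Phi> y (act (\<theta>n n y) \<eta>)
    + weight n (glue n y x') *\<^sub>R (\<Phi> y (act (\<theta>n n y) \<eta>) - \<Phi> (glue n y x') (act (\<theta>n n y) \<eta>)))"
  unfolding twisted_sum_def sum_preimages_glue[OF x] sum_subtractf[symmetric]
proof (intro sum.cong refl)
  fix y assume y: "y \<in> preimages n x"
  have "\<theta>n n (glue n y x') = \<theta>n n y"
    using cocycle_window[OF preimagesD(1)[OF y] glue_preimage(1,3)[OF y x(2,3)]] by simp
  then show "weight n y *\<^sub>R \<Phi> y (act (\<theta>n n y) \<eta>)
      - weight n (glue n y x') *\<^sub>R \<Phi> (glue n y x') (act (\<theta>n n (glue n y x')) \<eta>)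
    = (weight n y - weight n (glue n y x')) *\<^sub>R \<Phi> y (act (\<theta>n n y) \<eta>)
      + weight n (glue n y x') *\<^sub>R (\<Phi> y (act (\<theta>n n y) \<eta>) - \<Phi> (glue n y x') (act (\<theta>n n y) \<eta>))"
    by (simp add: algebra_simps)
qed

text \<open>The Lasota-Yorke inequality. Nearby points have preimages with the same cocycle,
  so their images differ by the variation of the weights and by that of \<open>\<Phi>\<close> at preimages, which
  are closer by the factor \<open>exp (- n)\<close>.\<close>

lemma lasota_yorke:
  assumes hb: "hoelder_bounded \<alpha> \<Sigma> Y \<Phi> s t"
  shows "hoelder_bounded \<alpha> \<Sigma> Y ((L ^^ n) \<Phi>) (sup_weight n * s)
    (sup_weight n * (ly_const * s + exp (- \<alpha> * real n) * t))"
proof (rule hoelder_boundedI)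
  note 1 = hoelder_boundedD[OF hb]
  have Ln: "(L ^^ n) \<Phi> x \<eta> = (if x \<in> \<Sigma> \<and> \<eta> \<in> Y then twisted_sum n \<Phi> x \<eta> else 0)" for x \<eta>
    by (rule L_power_apply) (rule 1(3))
  have a: "sup_weight n \<ge> 0" using sup_weight_pos[of n] by simp
  show "0 \<le> sup_weight n * s" "0 \<le> sup_weight n * (ly_const * s + exp (- \<alpha> * real n) * t)"
    using a 1(1,2) ly_const_nonneg by auto
  show "(L ^^ n) \<Phi> x \<eta> = 0" if "x \<notin> \<Sigma> \<or> \<eta> \<notin> Y" for x \<eta>
    using Ln that by auto
  show sup: "l2_bounded Y (\<lambda>\<eta>. cmod ((L ^^ n) \<Phi> x \<eta>)) (sup_weight n * s)" if x: "x \<in> \<Sigma>" for x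
  proof -
    have "l2_bounded Y (twisted_sum n (\<lambda>y \<zeta>. cmod (\<Phi> y \<zeta>)) x) (\<Sum>y\<in>preimages n x. weight n y * s)"
      by (intro l2_bounded_twisted_sum 1(4)) (rule preimagesD)
    then have "l2_bounded Y (twisted_sum n (\<lambda>y \<zeta>. cmod (\<Phi> y \<zeta>)) x) (sup_weight n * s)"
      by (rule l2_bounded_weaken)
        (use mult_right_mono[OF weight_sum_le[OF x, of n] 1(1)] in \<open>simp add: weight_sum_def sum_distrib_right\<close>)
    then show ?thesis
    proof (rule l2_bounded_mono)
      fix \<eta> assume "\<eta> \<in> Y"
      then have "(L ^^ n) \<Phi> x \<eta> = twisted_sum n \<Phi> x \<eta>" using x by (simp add: Ln)
      then show "\<bar>cmod ((L ^^ n) \<Phi> x \<eta>)\<bar> \<le> twisted_sum n (\<lambda>y \<zeta>. cmod (\<Phi> y \<zeta>)) x \<eta>"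
        using norm_twisted_sum_le[of n \<Phi> x \<eta>] by simp
    qed
  qed
  fix x x' assume x: "x \<in> \<Sigma>" "x' \<in> \<Sigma>"
  let ?B = "sup_weight n * (ly_const * s + exp (- \<alpha> * real n) * t) * D x x'"
  show "l2_bounded Y (\<lambda>\<eta>. cmod ((L ^^ n) \<Phi> x \<eta> - (L ^^ n) \<Phi> x' \<eta>)) ?B"
  proof (cases "agree M x x'")
    case False
    have "l2_bounded Y (\<lambda>\<eta>. cmod ((L ^^ n) \<Phi> x \<eta> - (L ^^ n) \<Phi> x' \<eta>)) (sup_weight n * s + sup_weight n * s)"
      by (rule l2_bounded_mono[OF l2_bounded_add[OF sup[OF x(1)] sup[OF x(2)]]])
        (simp add: norm_triangle_ineq4)
    moreover have "sup_weight n * s + sup_weight n * s \<le> ?B"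
    proof -
      have "sup_weight n * s * (2 * 1) \<le> sup_weight n * s * (2 * (exp (\<alpha> * real M) * D x x'))"
        using one_le_exp_dist[OF False] a 1(1) by (intro mult_left_mono) auto
      also have "\<dots> \<le> sup_weight n * s * (ly_const * D x x')"
        using a 1(1) weight_lip_nonneg by (intro mult_left_mono) (auto simp: ly_const_def distrib_right)
      also have "\<dots> \<le> ?B"
        using a 1(2) by (simp add: algebra_simps)
      finally show ?thesis by linarith
    qed
    ultimately show ?thesis by (rule l2_bounded_weaken)
  next
    case True
    let ?w = "\<lambda>y. weight n (glue n y x')"
    have "l2_bounded Y (\<lambda>\<eta>. \<Sum>y\<in>preimages n x.
        \<bar>weight n y - ?w y\<bar> * cmod (\<Phi> y (act (\<theta>n n y) \<eta>))
        + ?w y * cmod (\<Phi> y (act (\<theta>n n y) \<eta>) - \<Phi> (glue n y x') (act (\<theta>n n y) \<eta>)))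
      (\<Sum>y\<in>preimages n x. \<bar>weight n y - ?w y\<bar> * s + ?w y * (t * D y (glue n y x')))"
    proof (intro l2_bounded_sum l2_bounded_add l2_bounded_cmult_nonneg)
      fix y assume y: "y \<in> preimages n x"
      note g = glue_preimage[OF y x(2) True]
      show "l2_bounded Y (\<lambda>\<eta>. cmod (\<Phi> y (act (\<theta>n n y) \<eta>))) s"
        by (intro l2_bounded_act[of "\<lambda>\<eta>. cmod (\<Phi> y \<eta>)"] 1(4) cocycle_closed preimagesD[OF y])
      show "l2_bounded Y (\<lambda>\<eta>. cmod (\<Phi> y (act (\<theta>n n y) \<eta>) - \<Phi> (glue n y x') (act (\<theta>n n y) \<eta>))) (t * D y (glue n y x'))"
        by (intro l2_bounded_act[of "\<lambda>\<eta>. cmod (\<Phi> y \<eta> - \<Phi> (glue n y x') \<eta>)"] 1(5) cocycle_closed preimagesD[OF y] g)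
      show "0 \<le> ?w y" using weight_pos[OF g(1)] by (simp add: less_imp_le)
    qed simp
    moreover have "(\<Sum>y\<in>preimages n x. \<bar>weight n y - ?w y\<bar> * s + ?w y * (t * D y (glue n y x'))) \<le> ?B"
    proof -
      have "(\<Sum>y\<in>preimages n x. \<bar>weight n y - ?w y\<bar> * s + ?w y * (t * D y (glue n y x')))
        \<le> (\<Sum>y\<in>preimages n x. (weight_lip * s + exp (- \<alpha> * real n) * t) * D x x' * ?w y)"
      proof (rule sum_mono)
        fix y assume y: "y \<in> preimages n x"
        note g = glue_preimage[OF y x(2) True]
        have "\<bar>weight n y - ?w y\<bar> * s \<le> weight_lip * D x x' * ?w y * s"
          using weight_lipschitz[OF preimagesD(1)[OF y] g(1,2)] 1(1)
          by (intro mult_right_mono) (simp_all add: preimagesD(2)[OF y])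
        moreover have "D y (glue n y x') = exp (- \<alpha> * real n) * D x x'"
          using hdist_suffix[OF g(2), of \<alpha>] by (simp add: preimagesD(2)[OF y])
        ultimately show "\<bar>weight n y - ?w y\<bar> * s + ?w y * (t * D y (glue n y x'))
          \<le> (weight_lip * s + exp (- \<alpha> * real n) * t) * D x x' * ?w y"
          by (simp add: algebra_simps)
      qed
      also have "\<dots> = (weight_lip * s + exp (- \<alpha> * real n) * t) * D x x' * weight_sum n x'"
        unfolding weight_sum_def sum_preimages_glue[OF x True] sum_distrib_left ..
      also have "\<dots> \<le> (weight_lip * s + exp (- \<alpha> * real n) * t) * D x x' * sup_weight n"
        using weight_sum_le[OF x(2)] weight_lip_nonneg 1(1,2) by (intro mult_left_mono) auto
      also have "\<dots> \<le> (ly_const * s + exp (- \<alpha> * real n) * t) * D x x' * sup_weight n"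
        using mult_right_mono[OF weight_lip_le 1(1)] a by (intro mult_right_mono) simp_all
      finally show ?thesis by (simp add: algebra_simps)
    qed
    ultimately show ?thesis
    proof (rule l2_bounded_mono[OF l2_bounded_weaken])
      fix \<eta> assume "\<eta> \<in> Y"
      then have dif: "(L ^^ n) \<Phi> x \<eta> - (L ^^ n) \<Phi> x' \<eta> = twisted_sum n \<Phi> x \<eta> - twisted_sum n \<Phi> x' \<eta>"
        using x by (simp add: Ln)
      have "cmod (twisted_sum n \<Phi> x \<eta> - twisted_sum n \<Phi> x' \<eta>) \<le> (\<Sum>y\<in>preimages n x. \<bar>weight n y - ?w y\<bar> * cmod (\<Phi> y (act (\<theta>n n y) \<eta>))
        + ?w y * cmod (\<Phi> y (act (\<theta>n n y) \<eta>) - \<Phi> (glue n y x') (act (\<theta>n n y) \<eta>)))"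
        unfolding twisted_sum_diff[OF x True]
      proof (rule order_trans[OF norm_sum], rule sum_mono)
        fix y assume y: "y \<in> preimages n x"
        have "0 < ?w y" using weight_pos[OF glue_preimage(1)[OF y x(2) True]] .
        then show "cmod ((weight n y - ?w y) *\<^sub>R \<Phi> y (act (\<theta>n n y) \<eta>)
            + ?w y *\<^sub>R (\<Phi> y (act (\<theta>n n y) \<eta>) - \<Phi> (glue n y x') (act (\<theta>n n y) \<eta>)))
          \<le> \<bar>weight n y - ?w y\<bar> * cmod (\<Phi> y (act (\<theta>n n y) \<eta>))
            + ?w y * cmod (\<Phi> y (act (\<theta>n n y) \<eta>) - \<Phi> (glue n y x') (act (\<theta>n n y) \<eta>))"
          by (intro order_trans[OF norm_triangle_ineq]) simp
      qed
      then show "\<bar>cmod ((L ^^ n) \<Phi> x \<eta> - (L ^^ n) \<Phi> x' \<eta>)\<bar> \<le> (\<Sum>y\<in>preimages n x. \<bar>weight n y - ?w y\<bar> * cmod (\<Phi> y (act (\<theta>n n y) \<eta>))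
        + ?w y * cmod (\<Phi> y (act (\<theta>n n y) \<eta>) - \<Phi> (glue n y x') (act (\<theta>n n y) \<eta>)))"
        unfolding dif abs_norm_cancel .
    qed
  qed
qed

end


section \<open>The spectrum is bounded by the growth of the iterates\<close>

context twisted_shift
begin

abbreviation H :: "('a word \<Rightarrow> 'y \<Rightarrow> complex) set" where "H \<equiv> ell2_hoelder \<alpha> \<Sigma> Y"
abbreviation H_norm :: "('a word \<Rightarrow> 'y \<Rightarrow> complex) \<Rightarrow> real" where "H_norm \<equiv> ell2_hoelder_norm \<alpha> \<Sigma> Y"
abbreviation bounded_by :: "('a word \<Rightarrow> 'y \<Rightarrow> complex) \<Rightarrow> real \<Rightarrow> bool" where
  "bounded_by \<Phi> B \<equiv> hoelder_bounded \<alpha> \<Sigma> Y \<Phi> B B"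

lemma L_add: "L (\<Phi> + \<Psi>) = L \<Phi> + L \<Psi>"
  by (intro ext) (simp add: L_apply twisted_sum_def sum.distrib scaleR_add_right)

lemma L_scaleC: "L (c *\<^sub>C \<Phi>) = c *\<^sub>C L \<Phi>"
  by (intro ext) (simp add: L_apply twisted_sum_def scaleC_fun_def scaleC_complex_def sum_distrib_left)

lemma L_diff: "L (\<Phi> - \<Psi>) = L \<Phi> - L \<Psi>"
  using L_add[of "\<Phi> - \<Psi>" \<Psi>] by simp

lemma L_power_add: "(L ^^ n) (\<Phi> + \<Psi>) = (L ^^ n) \<Phi> + (L ^^ n) \<Psi>"
  by (induction n) (simp_all only: funpow.simps comp_apply id_apply L_add)

lemma L_power_scaleC: "(L ^^ n) (c *\<^sub>C \<Phi>) = c *\<^sub>C (L ^^ n) \<Phi>"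
  by (induction n) (simp_all only: funpow.simps comp_apply id_apply L_scaleC)

lemma L_power_diff: "(L ^^ n) (\<Phi> - \<Psi>) = (L ^^ n) \<Phi> - (L ^^ n) \<Psi>"
  by (induction n) (simp_all only: funpow.simps comp_apply id_apply L_diff)

lemma scaleC_apply: "(c *\<^sub>C \<Phi>) x \<eta> = c * \<Phi> x \<eta>" for \<Phi> :: "'a word \<Rightarrow> 'y \<Rightarrow> complex"
  by (simp add: scaleC_fun_def scaleC_complex_def)

text \<open>The resolvent is the Neumann series, summed pointwise: bounds for Hoelder norms
  pass to pointwise limits, so the sum is again a Hoelder function.\<close>

lemma spectrum_le_growth:
  assumes q: "q \<ge> 0" and C: "C \<ge> 0"
    and growth: "\<And>\<Phi> B n. bounded_by \<Phi> B \<Longrightarrow> bounded_by ((L ^^ n) \<Phi>) (C * q ^ n * B)"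
    and z: "z \<in> op_spectrum H H_norm L"
  shows "cmod z \<le> q"
proof (rule ccontr)
  assume "\<not> cmod z \<le> q"
  then have qz: "q < cmod z" and z0: "z \<noteq> 0" using q by auto
  define summand where "summand \<Phi> n x \<eta> = (L ^^ n) \<Phi> x \<eta> / z ^ Suc n" for \<Phi> n x \<eta>
  define R where "R \<Phi> = (\<lambda>x \<eta>. \<Sum>n. summand \<Phi> n x \<eta>)" for \<Phi>
  define \<kappa> where "\<kappa> = C / (cmod z - q)"
  have ratio: "0 \<le> q / cmod z" "q / cmod z < 1" using q qz z0 by (auto simp: divide_less_eq)
  have hb_term: "bounded_by (summand \<Phi> n) (C * B / cmod z * (q / cmod z) ^ n)" if "\<Phi> \<in> H" "B = H_norm \<Phi>" for \<Phi> B n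
  proof -
    have "(\<lambda>x \<eta>. 1 / z ^ Suc n * (L ^^ n) \<Phi> x \<eta>) = summand \<Phi> n" by (simp add: summand_def fun_eq_iff)
    moreover have "cmod (1 / z ^ Suc n) * (C * q ^ n * B) = C * B / cmod z * (q / cmod z) ^ n"
      by (simp add: norm_divide norm_power norm_mult power_divide)
    ultimately show ?thesis
      using hoelder_bounded_scale[OF growth[OF ell2_hoelder_bounded[OF that(1)], of n], of "1 / z ^ Suc n"]
      unfolding that(2) by simp
  qed
  have sums: "summand \<Phi> n x \<eta> = summand \<Phi> n x \<eta> \<and> (\<lambda>n. summand \<Phi> n x \<eta>) sums R \<Phi> x \<eta>" if "\<Phi> \<in> H" for \<Phi> x \<eta> n
  proof -
    have "summable (\<lambda>n. C * H_norm \<Phi> / cmod z * (q / cmod z) ^ n)"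
      using ratio by (intro summable_mult summable_geometric) auto
    then have "summable (\<lambda>n. summand \<Phi> n x \<eta>)"
      by (rule summable_comparison_test')
        (rule hoelder_bounded_pointwise[OF hb_term[OF that refl]])
    then show ?thesis unfolding R_def using summable_sums by blast
  qed
  have hbR: "bounded_by (R \<Phi>) (\<kappa> * H_norm \<Phi>)" if "\<Phi> \<in> H" for \<Phi>
  proof (rule hoelder_bounded_limit)
    fix N
    let ?B = "\<Sum>n<N. C * H_norm \<Phi> / cmod z * (q / cmod z) ^ n"
    have B0: "H_norm \<Phi> \<ge> 0" using hoelder_boundedD(1)[OF ell2_hoelder_bounded[OF that]] .
    have "?B = C * H_norm \<Phi> / cmod z * (\<Sum>n<N. (q / cmod z) ^ n)" by (simp add: sum_distrib_left)
    also have "\<dots> \<le> C * H_norm \<Phi> / cmod z * (1 / (1 - q / cmod z))"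
    proof (intro mult_left_mono)
      have "(\<Sum>n<N. (q / cmod z) ^ n) \<le> (\<Sum>n. (q / cmod z) ^ n)"
        using ratio by (intro sum_le_suminf summable_geometric) auto
      then show "(\<Sum>n<N. (q / cmod z) ^ n) \<le> 1 / (1 - q / cmod z)"
        using ratio by (simp add: suminf_geometric)
    qed (use C B0 in auto)
    also have "\<dots> = \<kappa> * H_norm \<Phi>" unfolding \<kappa>_def using z0 qz by (simp add: field_simps)
    finally have le: "?B \<le> \<kappa> * H_norm \<Phi>" .
    have "bounded_by (\<lambda>x \<eta>. \<Sum>n<N. summand \<Phi> n x \<eta>) ?B"
      by (intro hoelder_bounded_sum hb_term that refl)
    then show "bounded_by (\<lambda>x \<eta>. \<Sum>n<N. summand \<Phi> n x \<eta>) (\<kappa> * H_norm \<Phi>)"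
      using hoelder_bounded_weaken le by blast
  next
    show "(\<lambda>N. \<Sum>n<N. summand \<Phi> n x \<eta>) \<longlonglongrightarrow> R \<Phi> x \<eta>" for x \<eta>
      using sums[OF that, of 0 x \<eta>] by (simp add: sums_def)
  qed
  have R_in: "R \<Phi> \<in> H" if "\<Phi> \<in> H" for \<Phi> using hoelder_bounded_ell2(1)[OF hbR[OF that]] .
  have "bounded_operator H H_norm R"
    unfolding bounded_operator_def
  proof (intro conjI ballI allI)
    show "R \<Phi> \<in> H" if "\<Phi> \<in> H" for \<Phi> using R_in that .
    show "R (\<Phi> + \<Psi>) = R \<Phi> + R \<Psi>" if "\<Phi> \<in> H" "\<Psi> \<in> H" for \<Phi> \<Psi>
    proof (intro ext)
      fix x \<eta>
      have "(\<lambda>n. summand \<Phi> n x \<eta> + summand \<Psi> n x \<eta>) sums (R \<Phi> x \<eta> + R \<Psi> x \<eta>)"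
        using sums that by (intro sums_add) blast+
      then have "(\<lambda>n. summand (\<Phi> + \<Psi>) n x \<eta>) sums (R \<Phi> + R \<Psi>) x \<eta>"
        by (simp only: summand_def L_power_add plus_fun_apply add_divide_distrib)
      then show "R (\<Phi> + \<Psi>) x \<eta> = (R \<Phi> + R \<Psi>) x \<eta>"
        using sums_unique unfolding R_def by metis
    qed
    show "R (c *\<^sub>C \<Phi>) = c *\<^sub>C R \<Phi>" if "\<Phi> \<in> H" for c \<Phi>
    proof (intro ext)
      fix x \<eta>
      have "(\<lambda>n. c * summand \<Phi> n x \<eta>) sums (c * R \<Phi> x \<eta>)"
        using sums that by (intro sums_mult) blast
      then have "(\<lambda>n. summand (c *\<^sub>C \<Phi>) n x \<eta>) sums (c *\<^sub>C R \<Phi>) x \<eta>"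
        by (simp only: summand_def L_power_scaleC scaleC_apply times_divide_eq_right)
      then show "R (c *\<^sub>C \<Phi>) x \<eta> = (c *\<^sub>C R \<Phi>) x \<eta>"
        using sums_unique unfolding R_def by metis
    qed
    show "\<exists>K. \<forall>\<Phi>\<in>H. H_norm (R \<Phi>) \<le> K * H_norm \<Phi>"
    proof (intro exI[of _ "2 * \<kappa>"] ballI)
      fix \<Phi> assume "\<Phi> \<in> H"
      then show "H_norm (R \<Phi>) \<le> 2 * \<kappa> * H_norm \<Phi>"
        using hoelder_bounded_ell2(2)[OF hbR] by fastforce
    qed
  qed
  moreover have "R (z *\<^sub>C \<Phi> - L \<Phi>) = \<Phi> \<and> z *\<^sub>C R \<Phi> - L (R \<Phi>) = \<Phi>" if \<Phi>: "\<Phi> \<in> H" for \<Phi>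
  proof -
    have supp: "\<Phi> x \<eta> = 0" if "x \<notin> \<Sigma> \<or> \<eta> \<notin> Y" for x \<eta>
      using hoelder_boundedD(3)[OF ell2_hoelder_bounded[OF \<Phi>]] that .
    have tele: "(\<lambda>n. z * summand \<Phi> n x \<eta> - z * summand \<Phi> (Suc n) x \<eta>) sums \<Phi> x \<eta>" for x \<eta>
    proof -
      have "(\<lambda>n. summand \<Phi> n x \<eta>) \<longlonglongrightarrow> 0"
        using sums[OF \<Phi>, of 0 x \<eta>] summable_LIMSEQ_zero sums_summable by blast
      then have "(\<lambda>n. z * summand \<Phi> n x \<eta>) \<longlonglongrightarrow> z * 0" by (intro tendsto_mult tendsto_const)
      then have "(\<lambda>n. z * summand \<Phi> n x \<eta> - z * summand \<Phi> (Suc n) x \<eta>) sums (z * summand \<Phi> 0 x \<eta> - z * 0)"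
        by (rule telescope_sums')
      then show ?thesis using z0 by (simp add: summand_def)
    qed
    have Lterm: "(L ^^ Suc n) \<Phi> x \<eta> / z ^ Suc n = z * summand \<Phi> (Suc n) x \<eta>" for n x \<eta>
      using z0 by (simp add: summand_def)
    have "R (z *\<^sub>C \<Phi> - L \<Phi>) x \<eta> = \<Phi> x \<eta>" for x \<eta>
    proof -
      have "summand (z *\<^sub>C \<Phi> - L \<Phi>) n x \<eta> = z * summand \<Phi> n x \<eta> - z * summand \<Phi> (Suc n) x \<eta>" for n
        unfolding Lterm[symmetric]
        by (simp only: summand_def L_power_diff L_power_scaleC scaleC_apply minus_apply
            diff_divide_distrib funpow.simps comp_apply funpow_swap1 times_divide_eq_right)
      then have "(\<lambda>n. summand (z *\<^sub>C \<Phi> - L \<Phi>) n x \<eta>) sums \<Phi> x \<eta>" using tele[of x \<eta>] by (simp only:)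
      then show ?thesis using sums_unique unfolding R_def by metis
    qed
    moreover have "(z *\<^sub>C R \<Phi> - L (R \<Phi>)) x \<eta> = \<Phi> x \<eta>" for x \<eta>
    proof (cases "x \<in> \<Sigma> \<and> \<eta> \<in> Y")
      case True
      have "(\<lambda>n. twisted_sum 1 (summand \<Phi> n) x \<eta>) sums twisted_sum 1 (R \<Phi>) x \<eta>"
        unfolding twisted_sum_def using sums[OF \<Phi>] by (intro sums_sum sums_scaleR_right) blast
      moreover have "twisted_sum 1 (summand \<Phi> n) x \<eta> = z * summand \<Phi> (Suc n) x \<eta>" for n
      proof -
        have "twisted_sum 1 (summand \<Phi> n) x \<eta> = twisted_sum 1 ((L ^^ n) \<Phi>) x \<eta> / z ^ Suc n"
          by (simp add: twisted_sum_def summand_def sum_divide_distrib scaleR_conv_of_real)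
        also have "twisted_sum 1 ((L ^^ n) \<Phi>) x \<eta> = (L ^^ Suc n) \<Phi> x \<eta>"
          using True by (simp add: L_apply[of "(L ^^ n) \<Phi>"])
        finally show ?thesis by (simp only: Lterm)
      qed
      ultimately have "(\<lambda>n. z * summand \<Phi> n x \<eta> - z * summand \<Phi> (Suc n) x \<eta>) sums (z * R \<Phi> x \<eta> - L (R \<Phi>) x \<eta>)"
        using sums[OF \<Phi>, of 0 x \<eta>] True by (intro sums_diff sums_mult) (auto simp: L_apply[of "R \<Phi>"])
      then show ?thesis using sums_unique2[OF tele[of x \<eta>]] by (simp add: scaleC_apply)
    next
      case False
      then have "R \<Phi> x \<eta> = 0" using hoelder_boundedD(3)[OF hbR[OF \<Phi>]] by blast
      then show ?thesis using False supp by (auto simp: scaleC_apply L_apply[of "R \<Phi>"])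
    qed
    ultimately show ?thesis by (auto simp: fun_eq_iff)
  qed
  ultimately show False using z unfolding op_spectrum_def by blast
qed

lemma L_power_growth:
  assumes "bounded_by \<Phi> B"
  shows "bounded_by ((L ^^ n) \<Phi>) (sup_const * (ly_const + 1) * radius ^ n * B)"
proof (rule hoelder_bounded_weaken[OF lasota_yorke[OF assms]])
  have B: "B \<ge> 0" using hoelder_boundedD(1)[OF assms] .
  have "exp (- \<alpha> * real n) * B \<le> 1 * B" using B alpha_pos by (intro mult_right_mono) auto
  then have le: "ly_const * B + exp (- \<alpha> * real n) * B \<le> (ly_const + 1) * B"
    by (simp add: distrib_right)
  have m: "sup_weight n * ((ly_const + 1) * B) \<le> sup_const * radius ^ n * ((ly_const + 1) * B)"
    using le_radius[of n] B ly_const_nonneg by (intro mult_right_mono) auto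
  have "sup_weight n * (ly_const * B + exp (- \<alpha> * real n) * B) \<le> sup_weight n * ((ly_const + 1) * B)"
    using le sup_weight_pos[of n] by (intro mult_left_mono) auto
  then show "sup_weight n * (ly_const * B + exp (- \<alpha> * real n) * B) \<le> sup_const * (ly_const + 1) * radius ^ n * B"
    using m by (simp add: algebra_simps)
  have "1 * B \<le> (ly_const + 1) * B" using B ly_const_nonneg by (intro mult_right_mono) auto
  then have "sup_weight n * B \<le> sup_weight n * ((ly_const + 1) * B)"
    using sup_weight_pos[of n] by (intro mult_left_mono) auto
  then show "sup_weight n * B \<le> sup_const * (ly_const + 1) * radius ^ n * B"
    using m by (simp add: algebra_simps)
qed

lemma spectrum_le_radius:
  assumes "z \<in> op_spectrum H H_norm L"
  shows "cmod z \<le> radius"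
  by (rule spectrum_le_growth[OF _ _ L_power_growth assms])
    (use radius_pos sup_const(1) ly_const_nonneg in auto)


section \<open>Amenable actions\<close>

lemma lipschitz_global:
  assumes "\<And>x. x \<in> \<Sigma> \<Longrightarrow> 0 \<le> f x \<and> f x \<le> a"
    and "\<And>x x'. x \<in> \<Sigma> \<Longrightarrow> x' \<in> \<Sigma> \<Longrightarrow> agree M x x' \<Longrightarrow> \<bar>f x - f x'\<bar> \<le> weight_lip * D x x' * f x'"
    and x: "x \<in> \<Sigma>" "x' \<in> \<Sigma>"
  shows "\<bar>f x - f x'\<bar> \<le> ly_const * a * D x x'"
proof (cases "agree M x x'")
  case True
  have "\<bar>f x - f x'\<bar> \<le> weight_lip * D x x' * f x'" using assms(2)[OF x True] .
  also have "\<dots> \<le> weight_lip * D x x' * a"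
    using assms(1)[OF x(2)] weight_lip_nonneg by (intro mult_left_mono) auto
  also have "\<dots> \<le> ly_const * D x x' * a"
    using assms(1)[OF x(2)] by (intro mult_right_mono) (auto simp: ly_const_def)
  finally show ?thesis by (simp add: mult_ac)
next
  case False
  have "\<bar>f x - f x'\<bar> \<le> a * 1" using assms(1)[OF x(1)] assms(1)[OF x(2)] by (simp add: abs_le_iff)
  also have "\<dots> \<le> a * (exp (\<alpha> * real M) * D x x')"
    using one_le_exp_dist[OF False] assms(1)[OF x(1)] by (intro mult_left_mono) auto
  also have "\<dots> \<le> a * (ly_const * D x x')"
    using assms(1)[OF x(1)] weight_lip_nonneg
    by (intro mult_left_mono mult_right_mono) (auto simp: ly_const_def)
  finally show ?thesis by (simp add: mult_ac)
qed

lemma hoelder_bounded_tensor: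
  fixes f :: "'a word \<Rightarrow> real" and \<phi> :: "'y \<Rightarrow> complex"
  assumes f: "\<And>x. x \<in> \<Sigma> \<Longrightarrow> 0 \<le> f x \<and> f x \<le> a"
    and lip: "\<And>x x'. x \<in> \<Sigma> \<Longrightarrow> x' \<in> \<Sigma> \<Longrightarrow> agree M x x' \<Longrightarrow> \<bar>f x - f x'\<bar> \<le> weight_lip * D x x' * f x'"
    and \<phi>: "\<And>\<eta>. \<eta> \<notin> Y \<Longrightarrow> \<phi> \<eta> = 0" "l2_bounded Y (\<lambda>\<eta>. cmod (\<phi> \<eta>)) N"
  shows "hoelder_bounded \<alpha> \<Sigma> Y (\<lambda>x \<eta>. if x \<in> \<Sigma> then of_real (f x) * \<phi> \<eta> else 0) (a * N) (ly_const * a * N)"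
proof (rule hoelder_boundedI)
  have N: "N \<ge> 0" using l2_bounded_nonneg[OF \<phi>(2)] .
  have a: "a \<ge> 0" using f nonempty by fastforce
  show "0 \<le> a * N" "0 \<le> ly_const * a * N" using a N ly_const_nonneg by auto
  show "(if x \<in> \<Sigma> then of_real (f x) * \<phi> \<eta> else 0) = 0" if "x \<notin> \<Sigma> \<or> \<eta> \<notin> Y" for x \<eta>
    using that \<phi>(1) by auto
  show "l2_bounded Y (\<lambda>\<eta>. cmod (if x \<in> \<Sigma> then of_real (f x) * \<phi> \<eta> else 0)) (a * N)" if x: "x \<in> \<Sigma>" for x
    by (rule l2_bounded_weaken[OF l2_bounded_mono[OF l2_bounded_cmult_nonneg[OF \<phi>(2), of "f x"]]])
      (use x f[OF x] N in \<open>auto simp: norm_mult intro: mult_right_mono\<close>)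
  fix x x' assume x: "x \<in> \<Sigma>" "x' \<in> \<Sigma>"
  have l: "\<bar>f x - f x'\<bar> * N \<le> ly_const * a * N * D x x'"
    using mult_right_mono[OF lipschitz_global[OF f lip x] N] by (simp add: mult_ac)
  have "cmod (of_real (f x) * \<phi> \<eta> - of_real (f x') * \<phi> \<eta>) = \<bar>f x - f x'\<bar> * cmod (\<phi> \<eta>)" for \<eta>
    by (metis norm_mult norm_of_real of_real_diff left_diff_distrib)
  then show "l2_bounded Y (\<lambda>\<eta>. cmod ((if x \<in> \<Sigma> then of_real (f x) * \<phi> \<eta> else 0)
      - (if x' \<in> \<Sigma> then of_real (f x') * \<phi> \<eta> else 0))) (ly_const * a * N * D x x')"
    using x l2_bounded_weaken[OF l2_bounded_cmult_nonneg[OF \<phi>(2), of "\<bar>f x - f x'\<bar>"] l] by simp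
qed

lemma hoelder_bounded_twisted_difference:
  fixes f :: "'a word \<Rightarrow> real" and \<phi> :: "'g \<Rightarrow> 'y \<Rightarrow> complex"
  assumes f: "\<And>x. x \<in> \<Sigma> \<Longrightarrow> 0 \<le> f x \<and> f x \<le> a"
    and lip: "\<And>x x'. x \<in> \<Sigma> \<Longrightarrow> x' \<in> \<Sigma> \<Longrightarrow> agree M x x' \<Longrightarrow> \<bar>f x - f x'\<bar> \<le> weight_lip * D x x' * f x'"
    and \<phi>: "\<And>x. x \<in> \<Sigma> \<Longrightarrow> l2_bounded Y (\<lambda>\<eta>. cmod (\<phi> (\<theta> x) \<eta>)) N"
  shows "hoelder_bounded \<alpha> \<Sigma> Y (\<lambda>x \<eta>. if x \<in> \<Sigma> \<and> \<eta> \<in> Y then of_real (f x) * \<phi> (\<theta> x) \<eta> else 0)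
    (a * N) (ly_const * a * N)"
proof (rule hoelder_boundedI)
  have N: "N \<ge> 0" using l2_bounded_nonneg[OF \<phi>] nonempty by blast
  have a: "a \<ge> 0" using f nonempty by fastforce
  show "0 \<le> a * N" "0 \<le> ly_const * a * N" using a N ly_const_nonneg by auto
  show "(if x \<in> \<Sigma> \<and> \<eta> \<in> Y then of_real (f x) * \<phi> (\<theta> x) \<eta> else 0) = 0" if "x \<notin> \<Sigma> \<or> \<eta> \<notin> Y" for x \<eta>
    using that by auto
  show sup: "l2_bounded Y (\<lambda>\<eta>. cmod (if x \<in> \<Sigma> \<and> \<eta> \<in> Y then of_real (f x) * \<phi> (\<theta> x) \<eta> else 0)) (a * N)"
    if x: "x \<in> \<Sigma>" for x
    by (rule l2_bounded_weaken[OF l2_bounded_mono[OF l2_bounded_cmult_nonneg[OF \<phi>[OF x], of "f x"]]])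
      (use x f[OF x] N in \<open>auto simp: norm_mult intro: mult_right_mono\<close>)
  fix x x' assume x: "x \<in> \<Sigma>" "x' \<in> \<Sigma>"
  let ?\<Psi> = "\<lambda>x \<eta>. if x \<in> \<Sigma> \<and> \<eta> \<in> Y then of_real (f x) * \<phi> (\<theta> x) \<eta> else 0"
  show "l2_bounded Y (\<lambda>\<eta>. cmod (?\<Psi> x \<eta> - ?\<Psi> x' \<eta>)) (ly_const * a * N * D x x')"
  proof (cases "agree M x x'")
    case True
    have th: "\<theta> x' = \<theta> x" using theta_window[OF x True] by simp
    have l: "\<bar>f x - f x'\<bar> * N \<le> ly_const * a * N * D x x'"
      using mult_right_mono[OF lipschitz_global[OF f lip x] N] by (simp add: mult_ac)
    have eq: "cmod (of_real (f x) * \<phi> g \<eta> - of_real (f x') * \<phi> g \<eta>) = \<bar>f x - f x'\<bar> * cmod (\<phi> g \<eta>)" for \<eta> g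
      by (metis norm_mult norm_of_real of_real_diff left_diff_distrib)
    show ?thesis
      by (rule l2_bounded_mono[OF l2_bounded_weaken[OF l2_bounded_cmult_nonneg[OF \<phi>[OF x(1)], of "\<bar>f x - f x'\<bar>"] l]])
        (use x eq in \<open>auto simp: th\<close>)
  next
    case False
    have "a * N + a * N \<le> ly_const * a * N * D x x'"
    proof -
      have "a * N * (2 * 1) \<le> a * N * (2 * (exp (\<alpha> * real M) * D x x'))"
        using one_le_exp_dist[OF False] a N by (intro mult_left_mono) auto
      also have "\<dots> \<le> a * N * (ly_const * D x x')"
        using a N weight_lip_nonneg by (intro mult_left_mono) (auto simp: ly_const_def distrib_right)
      finally show ?thesis by (simp add: mult_ac)
    qed
    from l2_bounded_weaken[OF l2_bounded_add[OF sup[OF x(1)] sup[OF x(2)]] this] show ?thesis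
      by (rule l2_bounded_mono) (simp only: abs_norm_cancel norm_triangle_ineq4)
  qed
qed

lemma finite_theta: "finite (\<theta> ` \<Sigma>)"
proof -
  obtain R where R: "finite R" "R \<subseteq> \<Sigma>" "\<And>x. x \<in> \<Sigma> \<Longrightarrow> \<exists>c\<in>R. agree M x c"
    using finite_representatives by blast
  have "\<theta> ` \<Sigma> \<subseteq> \<theta> ` R"
  proof (rule image_subsetI)
    fix x assume x: "x \<in> \<Sigma>"
    then obtain c where "c \<in> R" "agree M x c" using R(3) by blast
    then show "\<theta> x \<in> \<theta> ` R" using theta_window[OF x, of c] R(2) by blast
  qed
  then show ?thesis using finite_subset[OF _ finite_imageI[OF R(1)]] by blast
qed

text \<open>If \<open>\<phi>\<close> is almost invariant, the product of \<open>cesaro J\<close> and \<open>\<phi>\<close> is almost an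
  eigenvector: its norm grows linearly in \<open>J\<close>, while its image under \<open>radius - L\<close> stays
  bounded if \<open>\<epsilon>\<close> is of order \<open>1 / J\<close>.\<close>

lemma cesaro_almost_eigenvector:
  fixes J :: nat and \<phi> :: "'y \<Rightarrow> complex"
  assumes \<phi>: "\<phi> \<in> ell2 Y" and \<epsilon>: "\<epsilon> \<ge> 0"
    and inv: "\<And>x. x \<in> \<Sigma> \<Longrightarrow> ell2_norm Y (induced_rep G Y act (\<theta> x) \<phi> - \<phi>) \<le> \<epsilon> * ell2_norm Y \<phi>"
  defines "\<Phi> \<equiv> \<lambda>x \<eta>. if x \<in> \<Sigma> then complex_of_real (cesaro J x) * \<phi> \<eta> else 0"
  shows "\<Phi> \<in> H" "of_real radius *\<^sub>C \<Phi> - L \<Phi> \<in> H"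
    and "H_norm (of_real radius *\<^sub>C \<Phi> - L \<Phi>)
      \<le> 2 * (ly_const + 1) * (1 + sup_const) * radius * (1 + (ly_const + 1) * \<epsilon> * sup_const * real J) * ell2_norm Y \<phi>"
    and "x \<in> \<Sigma> \<Longrightarrow> cesaro J x * ell2_norm Y \<phi> \<le> H_norm \<Phi>"
proof -
  let ?N = "ell2_norm Y \<phi>" and ?A = "sup_const * real J"
  have \<phi>0: "\<And>\<eta>. \<eta> \<notin> Y \<Longrightarrow> \<phi> \<eta> = 0" and \<phi>b: "l2_bounded Y (\<lambda>\<eta>. cmod (\<phi> \<eta>)) ?N"
    using \<phi> ell2_bounded by (auto simp: ell2_def)
  have ces: "\<And>x. x \<in> \<Sigma> \<Longrightarrow> 0 \<le> cesaro J x \<and> cesaro J x \<le> ?A"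
    using cesaro_nonneg cesaro_le by blast
  have hb\<Phi>: "hoelder_bounded \<alpha> \<Sigma> Y \<Phi> (?A * ?N) (ly_const * ?A * ?N)"
    unfolding \<Phi>_def by (rule hoelder_bounded_tensor[OF ces cesaro_lipschitz \<phi>0 \<phi>b])
  show \<Phi>H: "\<Phi> \<in> H" using hoelder_bounded_ell2(1)[OF hb\<Phi>] .
  define \<psi> where "\<psi> g \<eta> = induced_rep G Y act g \<phi> \<eta> - \<phi> \<eta>" for g \<eta>
  have \<psi>b: "l2_bounded Y (\<lambda>\<eta>. cmod (\<psi> (\<theta> x) \<eta>)) (\<epsilon> * ?N)" if x: "x \<in> \<Sigma>" for x
  proof -
    have c: "inv\<^bsub>G\<^esub> \<theta> x \<in> carrier G" using group.inv_closed[OF group_G theta_closed[OF x]] .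
    have "l2_bounded Y (\<lambda>\<eta>. cmod (induced_rep G Y act (\<theta> x) \<phi> \<eta>)) ?N"
      by (rule l2_bounded_mono[OF l2_bounded_act[OF \<phi>b c]]) (simp add: induced_rep_def)
    then have "induced_rep G Y act (\<theta> x) \<phi> \<in> ell2 Y" by (intro ell2I(1)) (auto simp: induced_rep_def)
    then have "l2_bounded Y (\<lambda>\<eta>. cmod ((induced_rep G Y act (\<theta> x) \<phi> - \<phi>) \<eta>)) (\<epsilon> * ?N)"
      using ell2_bounded[OF ell2_diff[OF _ \<phi>]] inv[OF x] l2_bounded_weaken by blast
    then show ?thesis by (simp add: \<psi>_def)
  qed
  \<comment> \<open>Since \<open>\<lambda>(\<theta> y)\<^sup>-\<^sup>1 \<lambda>(\<theta> y) \<phi> = \<phi>\<close>, the operator maps \<open>\<Phi> + \<Psi>\<close> to the product of the untwisted image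
    of \<open>cesaro J\<close> and \<open>\<phi>\<close>.\<close>
  define \<Psi> where "\<Psi> = (\<lambda>x \<eta>. if x \<in> \<Sigma> \<and> \<eta> \<in> Y then complex_of_real (cesaro J x) * \<psi> (\<theta> x) \<eta> else 0)"
  have hb\<Psi>: "hoelder_bounded \<alpha> \<Sigma> Y \<Psi> (?A * (\<epsilon> * ?N)) (ly_const * ?A * (\<epsilon> * ?N))"
    unfolding \<Psi>_def
    by (rule hoelder_bounded_twisted_difference[where \<phi> = \<psi>, OF _ _ \<psi>b])
      (use ces cesaro_lipschitz in blast)+
  let ?S = "\<lambda>x. weight_sum J x / radius ^ J"
  define E1 where "E1 = (\<lambda>x \<eta>. if x \<in> \<Sigma> then complex_of_real (radius * 1) * \<phi> \<eta> else 0)"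
  define E2 where "E2 = (\<lambda>x \<eta>. if x \<in> \<Sigma> then complex_of_real (radius * ?S x) * \<phi> \<eta> else 0)"
  have hbE1: "hoelder_bounded \<alpha> \<Sigma> Y E1 (radius * ?N) (ly_const * radius * ?N)"
    unfolding E1_def using radius_pos weight_lip_nonneg
    by (intro hoelder_bounded_tensor[OF _ _ \<phi>0 \<phi>b, where f = "\<lambda>_. radius * 1"]) auto
  have hbE2: "hoelder_bounded \<alpha> \<Sigma> Y E2 (radius * sup_const * ?N) (ly_const * (radius * sup_const) * ?N)"
    unfolding E2_def
  proof (rule hoelder_bounded_tensor[OF _ _ \<phi>0 \<phi>b])
    fix x assume x: "x \<in> \<Sigma>"
    have "?S x \<le> sup_const"
      using weight_sum_le[OF x, of J] le_radius[of J] radius_pos by (simp add: field_simps)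
    then show "0 \<le> radius * ?S x \<and> radius * ?S x \<le> radius * sup_const"
      using radius_pos weight_sum_nonneg[of J x] mult_left_mono[of "?S x" sup_const radius] by simp
    fix x' assume x': "x' \<in> \<Sigma>" "agree M x x'"
    have "radius * ?S x - radius * ?S x' = radius / radius ^ J * (weight_sum J x - weight_sum J x')"
      by (simp add: right_diff_distrib diff_divide_distrib)
    then have "\<bar>radius * ?S x - radius * ?S x'\<bar> = radius / radius ^ J * \<bar>weight_sum J x - weight_sum J x'\<bar>"
      using radius_pos by (simp only: abs_mult) simp
    also have "\<dots> \<le> radius / radius ^ J * (weight_lip * D x x' * weight_sum J x')"
      using radius_pos by (intro mult_left_mono weight_sum_lipschitz x x') auto
    finally show "\<bar>radius * ?S x - radius * ?S x'\<bar> \<le> weight_lip * D x x' * (radius * ?S x')"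
      by (simp add: mult_ac)
  qed
  have eq: "of_real radius *\<^sub>C \<Phi> - L \<Phi> = (\<lambda>x \<eta>. E1 x \<eta> + - 1 * E2 x \<eta> + (L ^^ 1) \<Psi> x \<eta>)"
  proof (intro ext)
    fix x \<eta>
    show "(of_real radius *\<^sub>C \<Phi> - L \<Phi>) x \<eta> = E1 x \<eta> + - 1 * E2 x \<eta> + (L ^^ 1) \<Psi> x \<eta>"
    proof (cases "x \<in> \<Sigma> \<and> \<eta> \<in> Y")
      case True
      have "L \<Phi> x \<eta> + L \<Psi> x \<eta> = (\<Sum>y\<in>preimages 1 x. of_real (F y * cesaro J y) * \<phi> \<eta>)"
      proof -
        have "F y *\<^sub>R \<Phi> y (act (\<theta> y) \<eta>) + F y *\<^sub>R \<Psi> y (act (\<theta> y) \<eta>) = of_real (F y * cesaro J y) * \<phi> \<eta>"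
          if y: "y \<in> preimages 1 x" for y
        proof -
          have c: "\<theta> y \<in> carrier G" "inv\<^bsub>G\<^esub> \<theta> y \<in> carrier G"
            using theta_closed[OF preimagesD(1)[OF y]] group.inv_closed[OF group_G] by auto
          have "act (inv\<^bsub>G\<^esub> \<theta> y) (act (\<theta> y) \<eta>) = \<eta>"
            using act_mult[OF c(2,1), of \<eta>] True c(1) group.l_inv[OF group_G c(1)] act_one by simp
          then have "induced_rep G Y act (\<theta> y) \<phi> (act (\<theta> y) \<eta>) = \<phi> \<eta>"
            using act_in[OF c(1)] True by (simp add: induced_rep_def)
          then show ?thesis
            using True preimagesD(1)[OF y] act_in[OF c(1)]
            by (simp add: \<Phi>_def \<Psi>_def \<psi>_def scaleR_conv_of_real algebra_simps)
        qed
        then show ?thesis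
          using True by (simp add: L_apply twisted_sum_def theta_closed preimagesD(1)
              monoid.r_one[OF group.is_monoid[OF group_G]] flip: sum.distrib)
      qed
      also have "\<dots> = of_real (\<Sum>y\<in>preimages 1 x. F y * cesaro J y) * \<phi> \<eta>"
        by (simp add: sum_distrib_right)
      also have "\<dots> = of_real (radius * (cesaro J x - 1 + ?S x)) * \<phi> \<eta>"
        using transfer_cesaro True by simp
      finally have "L \<Phi> x \<eta> = of_real (radius * (cesaro J x - 1 + ?S x)) * \<phi> \<eta> - L \<Psi> x \<eta>"
        by (simp add: algebra_simps)
      then show ?thesis
        using True by (simp add: scaleC_apply \<Phi>_def E1_def E2_def algebra_simps)
    next
      case False
      then show ?thesis
        using \<phi>0 by (auto simp: scaleC_apply L_apply E1_def E2_def \<Phi>_def)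
    qed
  qed
  note hb = hoelder_bounded_add[OF hoelder_bounded_add[OF hbE1 hoelder_bounded_scale[OF hbE2, of "- 1"]]
      lasota_yorke[OF hb\<Psi>, of 1]]
  show "of_real radius *\<^sub>C \<Phi> - L \<Phi> \<in> H"
    unfolding eq using hoelder_bounded_ell2(1)[OF hb] .
  have N: "?N \<ge> 0" by simp
  define l where "l = ly_const"
  have l: "l \<ge> 0" unfolding l_def by (rule ly_const_nonneg)
  have "sup_weight 1 \<le> sup_const * radius" using le_radius[of 1] by simp
  moreover have "exp (- \<alpha>) * (l * (?A * \<epsilon> * ?N)) \<le> 1 * (l * (?A * \<epsilon> * ?N))"
    using alpha_pos l \<epsilon> N sup_const(1) by (intro mult_right_mono) auto
  ultimately have t: "sup_weight 1 * ((1 + l) * (?A * \<epsilon> * ?N) + exp (- \<alpha>) * (l * (?A * \<epsilon> * ?N)))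
      \<le> sup_const * radius * (2 * (1 + l) * (?A * \<epsilon> * ?N))"
  proof (intro mult_mono)
    assume "exp (- \<alpha>) * (l * (?A * \<epsilon> * ?N)) \<le> 1 * (l * (?A * \<epsilon> * ?N))"
    moreover have "0 \<le> ?A * \<epsilon> * ?N" using \<epsilon> N sup_const(1) by simp
    ultimately show "(1 + l) * (?A * \<epsilon> * ?N) + exp (- \<alpha>) * (l * (?A * \<epsilon> * ?N)) \<le> 2 * (1 + l) * (?A * \<epsilon> * ?N)"
      by (simp only: distrib_right distrib_left mult_1_left mult.assoc)
    show "0 \<le> sup_const * radius" using sup_const(1) radius_pos by simp
    show "0 \<le> (1 + l) * (?A * \<epsilon> * ?N) + exp (- \<alpha>) * (l * (?A * \<epsilon> * ?N))"
      using l \<epsilon> N sup_const(1) by simp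
  qed
  have "H_norm (of_real radius *\<^sub>C \<Phi> - L \<Phi>)
      \<le> (1 + l) * (radius * ?N) + (1 + l) * (radius * sup_const * ?N)
        + sup_weight 1 * ((1 + l) * (?A * \<epsilon> * ?N) + exp (- \<alpha>) * (l * (?A * \<epsilon> * ?N)))"
    unfolding eq using hoelder_bounded_ell2(2)[OF hb] by (simp add: algebra_simps l_def)
  also have "\<dots> \<le> (1 + l) * (radius * ?N) + (1 + l) * (radius * sup_const * ?N)
        + sup_const * radius * (2 * (1 + l) * (?A * \<epsilon> * ?N))"
    using t by simp
  also have "\<dots> = (l + 1) * radius * ?N * (1 + sup_const + 2 * sup_const * (?A * \<epsilon>))"
    by (simp add: algebra_simps)
  also have "\<dots> \<le> (l + 1) * radius * ?N * (2 * (1 + sup_const) * (1 + (l + 1) * (?A * \<epsilon>)))"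
  proof (rule mult_left_mono)
    define e where "e = ?A * \<epsilon>"
    have e: "0 \<le> e" "0 \<le> sup_const * e" "0 \<le> l * e" "0 \<le> sup_const * (l * e)"
      using sup_const(1) \<epsilon> l by (simp_all add: e_def)
    have "1 + sup_const + 2 * sup_const * e \<le> 2 * (1 + sup_const) * (1 + (l + 1) * e)"
      using e sup_const(1) by (simp add: algebra_simps)
    then show "1 + sup_const + 2 * sup_const * (?A * \<epsilon>) \<le> 2 * (1 + sup_const) * (1 + (l + 1) * (?A * \<epsilon>))"
      by (simp add: e_def)
    show "0 \<le> (l + 1) * radius * ?N" using l radius_pos N by simp
  qed
  finally show "H_norm (of_real radius *\<^sub>C \<Phi> - L \<Phi>)
      \<le> 2 * (ly_const + 1) * (1 + sup_const) * radius * (1 + (ly_const + 1) * \<epsilon> * sup_const * real J) * ?N"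
    by (simp only: l_def mult_ac)
  assume x: "x \<in> \<Sigma>"
  show "cesaro J x * ?N \<le> H_norm \<Phi>"
  proof (cases "cesaro J x = 0")
    case True
    then show ?thesis using hoelder_boundedD(1)[OF ell2_hoelder_bounded[OF \<Phi>H]] by simp
  next
    case False
    then have c: "cesaro J x > 0" using cesaro_nonneg[of J x] by simp
    have "l2_bounded Y (\<lambda>\<eta>. (1 / cesaro J x) * cmod (\<Phi> x \<eta>)) ((1 / cesaro J x) * H_norm \<Phi>)"
      using c hoelder_boundedD(4)[OF ell2_hoelder_bounded[OF \<Phi>H] x]
      by (intro l2_bounded_cmult_nonneg) auto
    then have "l2_bounded Y (\<lambda>\<eta>. cmod (\<phi> \<eta>)) ((1 / cesaro J x) * H_norm \<Phi>)"
      using c x by (simp add: \<Phi>_def norm_mult)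
    then have "?N \<le> (1 / cesaro J x) * H_norm \<Phi>" by (intro ell2I(2)) (use \<phi>0 in auto)
    then show ?thesis using c by (simp add: field_simps)
  qed
qed

lemma amenable_imp_radius_in_spectrum:
  assumes am: "amenable_action G Y act"
  shows "complex_of_real radius \<in> op_spectrum H H_norm L"
proof (rule ccontr)
  assume "complex_of_real radius \<notin> op_spectrum H H_norm L"
  then obtain R where R: "bounded_operator H H_norm R"
    and inv: "\<And>\<Phi>. \<Phi> \<in> H \<Longrightarrow> R (of_real radius *\<^sub>C \<Phi> - L \<Phi>) = \<Phi>"
    unfolding op_spectrum_def by blast
  obtain k0 where k0: "\<And>\<Phi>. \<Phi> \<in> H \<Longrightarrow> H_norm (R \<Phi>) \<le> k0 * H_norm \<Phi>"
    using R unfolding bounded_operator_def by blast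
  define k where "k = max k0 0"
  have k: "H_norm (R \<Phi>) \<le> k * H_norm \<Phi>" if "\<Phi> \<in> H" for \<Phi>
    using k0[OF that] hoelder_boundedD(1)[OF ell2_hoelder_bounded[OF that]]
      mult_right_mono[of k0 k "H_norm \<Phi>"] by (simp add: k_def)
  have k_nn: "k \<ge> 0" by (simp add: k_def)
  obtain c where c: "c > 0" "\<And>J x. x \<in> \<Sigma> \<Longrightarrow> c * real J \<le> cesaro (J + K) x"
    using cesaro_ge by blast
  define C1 where "C1 = 2 * (ly_const + 1) * (1 + sup_const) * radius"
  define C2 where "C2 = (ly_const + 1) * sup_const"
  have C: "C1 \<ge> 0" "C2 \<ge> 0"
    using ly_const_nonneg sup_const(1) radius_pos by (auto simp: C1_def C2_def)
  obtain J where J: "real J > k * (C1 * (1 + C2)) / c + 1" using reals_Archimedean2 by blast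
  have "0 \<le> k * (C1 * (1 + C2)) / c" using k_nn C c(1) by simp
  then have Jpos: "real (J + K) > 0" using J by simp
  \<comment> \<open>The error caused by the displacement of \<open>\<phi>\<close> is proportional to \<open>\<epsilon> * (J + K)\<close>.\<close>
  define \<epsilon> where "\<epsilon> = 1 / real (J + K)"
  have \<epsilon>: "\<epsilon> > 0" using Jpos by (simp add: \<epsilon>_def)
  have "\<theta> ` \<Sigma> \<subseteq> carrier G" using theta_closed by blast
  then obtain \<phi> where \<phi>: "\<phi> \<in> ell2 Y"
    and inv\<phi>: "\<And>x. x \<in> \<Sigma> \<Longrightarrow> ell2_norm Y (induced_rep G Y act (\<theta> x) \<phi> - \<phi>) < \<epsilon> * ell2_norm Y \<phi>"
    using am finite_theta \<epsilon> unfolding amenable_action_def by (metis imageI)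
  obtain x where x: "x \<in> \<Sigma>" using nonempty by blast
  have N: "ell2_norm Y \<phi> > 0"
  proof -
    have "0 < \<epsilon> * ell2_norm Y \<phi>" using inv\<phi>[OF x] ell2_norm_nonneg by (rule le_less_trans[rotated])
    then show ?thesis using \<epsilon> by (simp add: zero_less_mult_iff)
  qed
  let ?\<Phi> = "\<lambda>x \<eta>. if x \<in> \<Sigma> then complex_of_real (cesaro (J + K) x) * \<phi> \<eta> else 0"
  note ev = cesaro_almost_eigenvector[where J = "J + K", OF \<phi> less_imp_le[OF \<epsilon>] less_imp_le[OF inv\<phi>]]
  have "c * real J * ell2_norm Y \<phi> \<le> cesaro (J + K) x * ell2_norm Y \<phi>"
    using c(2)[OF x] N by (intro mult_right_mono) auto
  also have "\<dots> \<le> H_norm ?\<Phi>" using ev(4) x by simp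
  also have "\<dots> = H_norm (R (of_real radius *\<^sub>C ?\<Phi> - L ?\<Phi>))" using inv[OF ev(1)] by simp
  also have "\<dots> \<le> k * H_norm (of_real radius *\<^sub>C ?\<Phi> - L ?\<Phi>)" using k[OF ev(2)] by simp
  also have "\<dots> \<le> k * (C1 * (1 + (ly_const + 1) * \<epsilon> * sup_const * real (J + K)) * ell2_norm Y \<phi>)"
    using ev(3) k_nn unfolding C1_def by (intro mult_left_mono) auto
  also have "(ly_const + 1) * \<epsilon> * sup_const * real (J + K) = C2"
    using Jpos unfolding \<epsilon>_def C2_def by simp
  finally have "c * real J * ell2_norm Y \<phi> \<le> k * (C1 * (1 + C2)) * ell2_norm Y \<phi>" by (simp add: mult_ac)
  then have "c * real J \<le> k * (C1 * (1 + C2))" using N by simp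
  then have "real J \<le> k * (C1 * (1 + C2)) / c" using c(1) by (simp add: field_simps)
  then show False using J by simp
qed

end


section \<open>Averages over a group without almost invariant vectors\<close>

lemma ell2_parallelogram:
  assumes "\<phi> \<in> ell2 Y" "\<psi> \<in> ell2 Y"
  shows "(ell2_norm Y (\<phi> + \<psi>))\<^sup>2 + (ell2_norm Y (\<phi> - \<psi>))\<^sup>2
    = 2 * (ell2_norm Y \<phi>)\<^sup>2 + 2 * (ell2_norm Y \<psi>)\<^sup>2"
proof -
  have neg: "- \<psi> \<in> ell2 Y" using assms(2) by (simp add: ell2_def)
  have sq: "(ell2_norm Y \<xi>)\<^sup>2 = (\<Sum>\<^sub>\<infinity>y\<in>Y. (cmod (\<xi> y))\<^sup>2)" for \<xi>
    unfolding ell2_norm_def by (intro real_sqrt_pow2 infsum_nonneg) simp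
  have summ: "(\<lambda>y. (cmod (\<xi> y))\<^sup>2) summable_on Y" if "\<xi> \<in> ell2 Y" for \<xi>
    using that by (simp add: ell2_def)
  have mem: "\<phi> + \<psi> \<in> ell2 Y" "\<phi> - \<psi> \<in> ell2 Y"
    using ell2_diff[OF assms(1) neg] ell2_diff[OF assms] by simp_all
  have pt: "(cmod (a + b))\<^sup>2 + (cmod (a - b))\<^sup>2 = 2 * (cmod a)\<^sup>2 + 2 * (cmod b)\<^sup>2" for a b
    unfolding cmod_power2 by (simp add: power2_eq_square algebra_simps)
  have "(ell2_norm Y (\<phi> + \<psi>))\<^sup>2 + (ell2_norm Y (\<phi> - \<psi>))\<^sup>2
    = (\<Sum>\<^sub>\<infinity>y\<in>Y. (cmod ((\<phi> + \<psi>) y))\<^sup>2 + (cmod ((\<phi> - \<psi>) y))\<^sup>2)"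
    unfolding sq by (rule infsum_add[symmetric]) (intro summ mem)+
  also have "\<dots> = (\<Sum>\<^sub>\<infinity>y\<in>Y. 2 * (cmod (\<phi> y))\<^sup>2 + 2 * (cmod (\<psi> y))\<^sup>2)"
    by (simp add: pt)
  also have "\<dots> = (\<Sum>\<^sub>\<infinity>y\<in>Y. 2 * (cmod (\<phi> y))\<^sup>2) + (\<Sum>\<^sub>\<infinity>y\<in>Y. 2 * (cmod (\<psi> y))\<^sup>2)"
    by (intro infsum_add summable_on_cmult_right summ assms)
  also have "\<dots> = 2 * (ell2_norm Y \<phi>)\<^sup>2 + 2 * (ell2_norm Y \<psi>)\<^sup>2"
    unfolding sq by (simp add: infsum_cmult_right')
  finally show ?thesis .
qed

context twisted_shift
begin

lemma ell2_of_real: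
  assumes "l2_bounded Y f B"
  defines "\<phi> \<equiv> \<lambda>y. if y \<in> Y then complex_of_real (f y) else 0"
  shows "\<phi> \<in> ell2 Y" "ell2_norm Y \<phi> \<le> B" "l2_bounded Y f (ell2_norm Y \<phi>)"
proof -
  have b: "l2_bounded Y (\<lambda>y. cmod (\<phi> y)) B"
    unfolding \<phi>_def l2_bounded_def
  proof (intro allI impI)
    fix A assume A: "finite A" "A \<subseteq> Y"
    have "L2_set (\<lambda>y. cmod (if y \<in> Y then complex_of_real (f y) else 0)) A = L2_set (\<lambda>y. \<bar>f y\<bar>) A"
      using A by (intro L2_set_cong) auto
    then show "L2_set (\<lambda>y. cmod (if y \<in> Y then complex_of_real (f y) else 0)) A \<le> B"
      using assms(1) A unfolding l2_bounded_def by (simp add: L2_set_abs)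
  qed
  show 1: "\<phi> \<in> ell2 Y" and "ell2_norm Y \<phi> \<le> B"
    using ell2I[OF _ b] by (auto simp: \<phi>_def)
  show "l2_bounded Y f (ell2_norm Y \<phi>)"
    by (rule l2_bounded_mono[OF ell2_bounded[OF 1]]) (simp add: \<phi>_def)
qed

text \<open>By the parallelogram law, two unit vectors at distance at least \<open>\<epsilon>\<close> have a sum of
  norm at most \<open>2 * sqrt (1 - \<epsilon>\<^sup>2 / 4)\<close>.\<close>

lemma displaced_sum_bound:
  assumes \<epsilon>: "0 < \<epsilon>" "\<epsilon> \<le> 1" and s: "s \<in> carrier G" and f: "l2_bounded Y f B"
  defines "\<phi> \<equiv> \<lambda>y. if y \<in> Y then complex_of_real (f y) else 0"
  assumes far: "\<epsilon> * ell2_norm Y \<phi> \<le> ell2_norm Y (induced_rep G Y act s \<phi> - \<phi>)"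
  shows "l2_bounded Y (\<lambda>\<eta>. f \<eta> + f (act (inv\<^bsub>G\<^esub> s) \<eta>)) (2 * sqrt (1 - \<epsilon>\<^sup>2 / 4) * B)"
proof -
  let ?\<psi> = "induced_rep G Y act s \<phi>" and ?b = "ell2_norm Y \<phi>"
  note \<phi> = ell2_of_real[OF f, folded \<phi>_def]
  have c: "inv\<^bsub>G\<^esub> s \<in> carrier G" using group.inv_closed[OF group_G s] .
  have "l2_bounded Y (\<lambda>\<eta>. cmod (?\<psi> \<eta>)) ?b"
    by (rule l2_bounded_mono[OF l2_bounded_act[OF ell2_bounded[OF \<phi>(1)] c]]) (simp add: induced_rep_def)
  then have \<psi>: "?\<psi> \<in> ell2 Y" "ell2_norm Y ?\<psi> \<le> ?b"
    using ell2I[of Y ?\<psi>] by (auto simp: induced_rep_def)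
  have "(ell2_norm Y (?\<psi> + \<phi>))\<^sup>2 = 2 * (ell2_norm Y ?\<psi>)\<^sup>2 + 2 * ?b\<^sup>2 - (ell2_norm Y (?\<psi> - \<phi>))\<^sup>2"
    using ell2_parallelogram[OF \<psi>(1) \<phi>(1)] by simp
  also have "\<dots> \<le> 2 * ?b\<^sup>2 + 2 * ?b\<^sup>2 - (\<epsilon> * ?b)\<^sup>2"
  proof -
    have "(ell2_norm Y ?\<psi>)\<^sup>2 \<le> ?b\<^sup>2" using \<psi>(2) by (intro power_mono) auto
    moreover have "(\<epsilon> * ?b)\<^sup>2 \<le> (ell2_norm Y (?\<psi> - \<phi>))\<^sup>2" using far \<epsilon>(1) by (intro power_mono) auto
    ultimately show ?thesis by linarith
  qed
  also have "\<dots> = (2 * sqrt (1 - \<epsilon>\<^sup>2 / 4) * ?b)\<^sup>2"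
  proof -
    have "\<epsilon>\<^sup>2 \<le> 1" using \<epsilon> by (simp add: power_le_one)
    then have sq: "(sqrt (1 - \<epsilon>\<^sup>2 / 4))\<^sup>2 = 1 - \<epsilon>\<^sup>2 / 4" by (intro real_sqrt_pow2) simp
    have "(2 * sqrt (1 - \<epsilon>\<^sup>2 / 4) * ?b)\<^sup>2 = 4 * (1 - \<epsilon>\<^sup>2 / 4) * ?b\<^sup>2"
      unfolding power_mult_distrib sq by simp
    then show ?thesis by (simp add: power_mult_distrib algebra_simps)
  qed
  finally have "ell2_norm Y (?\<psi> + \<phi>) \<le> 2 * sqrt (1 - \<epsilon>\<^sup>2 / 4) * ?b"
    by (rule power2_le_imp_le) (use \<epsilon> power_le_one[of \<epsilon> 2] in simp)
  also have "\<dots> \<le> 2 * sqrt (1 - \<epsilon>\<^sup>2 / 4) * B"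
    using \<phi>(2) \<epsilon> power_le_one[of \<epsilon> 2] by (intro mult_left_mono) auto
  finally have le: "ell2_norm Y (?\<psi> + \<phi>) \<le> 2 * sqrt (1 - \<epsilon>\<^sup>2 / 4) * B" .
  have "- \<phi> \<in> ell2 Y" using \<phi>(1) by (simp add: ell2_def)
  then have "?\<psi> + \<phi> \<in> ell2 Y" using ell2_diff[OF \<psi>(1), of "- \<phi>"] by simp
  then have "l2_bounded Y (\<lambda>\<eta>. cmod ((?\<psi> + \<phi>) \<eta>)) (2 * sqrt (1 - \<epsilon>\<^sup>2 / 4) * B)"
    using l2_bounded_weaken[OF ell2_bounded le] by blast
  then show ?thesis
  proof (rule l2_bounded_mono)
    fix \<eta> assume \<eta>: "\<eta> \<in> Y"
    have "(?\<psi> + \<phi>) \<eta> = complex_of_real (f \<eta> + f (act (inv\<^bsub>G\<^esub> s) \<eta>))"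
      using \<eta> act_in[OF c \<eta>] by (simp add: induced_rep_def \<phi>_def)
    then show "\<bar>f \<eta> + f (act (inv\<^bsub>G\<^esub> s) \<eta>)\<bar> \<le> cmod ((?\<psi> + \<phi>) \<eta>)"
      by (simp only: norm_of_real)
  qed
qed

text \<open>The neutral element is added to the finite set that witnesses non-amenability.
  Then, for each \<open>f\<close>, the sum contains \<open>f\<close> and a translate far from \<open>f\<close>, and these two terms
  lose norm by the parallelogram law.\<close>

lemma nonamenable_average:
  assumes "\<not> amenable_action G Y act"
  obtains S \<kappa> where "finite S" "S \<noteq> {}" "S \<subseteq> carrier G" "0 \<le> \<kappa>" "\<kappa> < 1"
    "\<And>f B. l2_bounded Y f B \<Longrightarrow> l2_bounded Y (\<lambda>\<eta>. \<Sum>g\<in>S. f (act g \<eta>)) (\<kappa> * real (card S) * B)"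
proof -
  obtain T \<epsilon>0 where T: "finite T" "T \<subseteq> carrier G" "\<epsilon>0 > 0"
    and none: "\<not> (\<exists>\<phi>\<in>ell2 Y. \<forall>s\<in>T. ell2_norm Y (induced_rep G Y act s \<phi> - \<phi>) < \<epsilon>0 * ell2_norm Y \<phi>)"
    using assms unfolding amenable_action_def not_all not_imp by (elim exE conjE) (rule that)
  \<comment> \<open>With \<open>\<epsilon> \<le> 1\<close>, the square root in the bound for the sum is that of a positive number.\<close>
  define \<epsilon> where "\<epsilon> = min \<epsilon>0 1"
  have \<epsilon>: "0 < \<epsilon>" "\<epsilon> \<le> 1" "\<epsilon> \<le> \<epsilon>0" using T(3) by (auto simp: \<epsilon>_def)
  define S where "S = insert \<one>\<^bsub>G\<^esub> ((\<lambda>s. inv\<^bsub>G\<^esub> s) ` T)"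
  define \<kappa>0 where "\<kappa>0 = sqrt (1 - \<epsilon>\<^sup>2 / 4)"
  have \<kappa>0: "0 \<le> \<kappa>0" "\<kappa>0 < 1"
    using \<epsilon> power_le_one[of \<epsilon> 2] by (auto simp: \<kappa>0_def)
  have S: "finite S" "S \<noteq> {}" "S \<subseteq> carrier G" "\<one>\<^bsub>G\<^esub> \<in> S"
    using T group.inv_closed[OF group_G] monoid.one_closed[OF group.is_monoid[OF group_G]]
    by (auto simp: S_def)
  have cardS: "real (card S) \<ge> 1" using S(1,2) by (simp add: Suc_le_eq card_gt_0_iff)
  define \<kappa> where "\<kappa> = max 0 ((real (card S) - 2 * (1 - \<kappa>0)) / real (card S))"
  show thesis
  proof (rule that[of S \<kappa>])
    show "\<kappa> < 1" unfolding \<kappa>_def using \<kappa>0 cardS by (simp add: divide_less_eq)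
    fix f B assume f: "l2_bounded Y f B"
    have B: "B \<ge> 0" using l2_bounded_nonneg[OF f] .
    let ?\<phi> = "\<lambda>y. if y \<in> Y then complex_of_real (f y) else 0"
    note \<phi> = ell2_of_real[OF f]
    obtain s where s: "s \<in> T" "\<epsilon>0 * ell2_norm Y ?\<phi> \<le> ell2_norm Y (induced_rep G Y act s ?\<phi> - ?\<phi>)"
      using none \<phi>(1) not_less by blast
    have "\<epsilon> * ell2_norm Y ?\<phi> \<le> \<epsilon>0 * ell2_norm Y ?\<phi>" using \<epsilon>(3) by (intro mult_right_mono) auto
    then have far: "\<epsilon> * ell2_norm Y ?\<phi> \<le> ell2_norm Y (induced_rep G Y act s ?\<phi> - ?\<phi>)"
      using s(2) by linarith
    have sc: "s \<in> carrier G" using s(1) T(2) by blast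
    let ?g = "inv\<^bsub>G\<^esub> s"
    show "l2_bounded Y (\<lambda>\<eta>. \<Sum>g\<in>S. f (act g \<eta>)) (\<kappa> * real (card S) * B)"
    proof (cases "?g = \<one>\<^bsub>G\<^esub>")
      case True
      then have "induced_rep G Y act s ?\<phi> - ?\<phi> = (\<lambda>_. 0)"
        by (auto simp: induced_rep_def act_one fun_eq_iff)
      then have "ell2_norm Y (induced_rep G Y act s ?\<phi> - ?\<phi>) \<le> 0"
        by (intro ell2I(2)) (simp_all add: fun_eq_iff)
      then have "\<epsilon> * ell2_norm Y ?\<phi> \<le> 0" using far by linarith
      then have "ell2_norm Y ?\<phi> = 0" using \<epsilon>(1) ell2_norm_nonneg[of Y ?\<phi>] by (simp add: mult_le_0_iff)
      then have z: "l2_bounded Y f 0" using \<phi>(3) by simp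
      have "l2_bounded Y (\<lambda>\<eta>. \<Sum>g\<in>S. f (act g \<eta>)) (\<Sum>g\<in>S. 0)"
        by (intro l2_bounded_sum l2_bounded_act[OF z]) (use S(3) in blast)
      then show ?thesis by (rule l2_bounded_weaken) (use B \<kappa>_def in simp)
    next
      case False
      have gS: "?g \<in> S" using s(1) by (simp add: S_def)
      let ?S = "S - {\<one>\<^bsub>G\<^esub>, ?g}"
      have card: "real (card ?S) = real (card S) - 2"
      proof -
        have "card {\<one>\<^bsub>G\<^esub>, ?g} = 2" using False by simp
        moreover have "{\<one>\<^bsub>G\<^esub>, ?g} \<subseteq> S" using gS S(4) by blast
        ultimately show ?thesis
          using card_Diff_subset[of "{\<one>\<^bsub>G\<^esub>, ?g}" S] card_mono[OF S(1), of "{\<one>\<^bsub>G\<^esub>, ?g}"]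
          by (simp add: of_nat_diff)
      qed
      have "l2_bounded Y (\<lambda>\<eta>. (f \<eta> + f (act ?g \<eta>)) + (\<Sum>g\<in>?S. f (act g \<eta>))) (2 * \<kappa>0 * B + (\<Sum>g\<in>?S. B))"
        unfolding \<kappa>0_def
        by (intro l2_bounded_add displaced_sum_bound[OF \<epsilon>(1,2) sc f far] l2_bounded_sum l2_bounded_act[OF f])
          (use S(3) in blast)
      moreover have "(f \<eta> + f (act ?g \<eta>)) + (\<Sum>g\<in>?S. f (act g \<eta>)) = (\<Sum>g\<in>S. f (act g \<eta>))" if "\<eta> \<in> Y" for \<eta>
      proof -
        have "(\<Sum>g\<in>S. f (act g \<eta>)) = (\<Sum>g\<in>{\<one>\<^bsub>G\<^esub>, ?g}. f (act g \<eta>)) + (\<Sum>g\<in>?S. f (act g \<eta>))"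
          using S(1,4) gS by (subst sum.subset_diff[of "{\<one>\<^bsub>G\<^esub>, ?g}" S]) auto
        then show ?thesis using False that by (auto simp: act_one)
      qed
      ultimately have "l2_bounded Y (\<lambda>\<eta>. \<Sum>g\<in>S. f (act g \<eta>)) (2 * \<kappa>0 * B + (\<Sum>g\<in>?S. B))"
        by (rule l2_bounded_cong)
      then show ?thesis
      proof (rule l2_bounded_weaken)
        have "2 * \<kappa>0 * B + (\<Sum>g\<in>?S. B) = (real (card S) - 2 * (1 - \<kappa>0)) * B"
          by (simp add: card algebra_simps)
        also have "\<dots> = (real (card S) - 2 * (1 - \<kappa>0)) / real (card S) * real (card S) * B"
          using cardS by simp
        also have "\<dots> \<le> \<kappa> * real (card S) * B"
          using B by (intro mult_right_mono) (auto simp: \<kappa>_def)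
        finally show "2 * \<kappa>0 * B + (\<Sum>g\<in>?S. B) \<le> \<kappa> * real (card S) * B" .
      qed
    qed
  qed (use S \<kappa>_def in auto)
qed

text \<open>Powers of the averaging operator have arbitrarily small norm. The terms of the
  \<open>j\<close>-th power are indexed by the lists of length \<open>j\<close>, so that all of them have the same weight.\<close>

lemma nonamenable_small_average:
  assumes "\<not> amenable_action G Y act" and \<delta>: "\<delta> > 0"
  obtains I :: "'g list set" and p where "finite I" "I \<noteq> {}" "\<And>i. i \<in> I \<Longrightarrow> p i \<in> carrier G"
    "\<And>f B. l2_bounded Y f B \<Longrightarrow> l2_bounded Y (\<lambda>\<eta>. \<Sum>i\<in>I. f (act (p i) \<eta>)) (\<delta> * real (card I) * B)"
proof -
  obtain S \<kappa> where S: "finite S" "S \<noteq> {}" "S \<subseteq> carrier G" and \<kappa>: "0 \<le> \<kappa>" "\<kappa> < 1"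
    and av: "\<And>f B. l2_bounded Y f B \<Longrightarrow> l2_bounded Y (\<lambda>\<eta>. \<Sum>g\<in>S. f (act g \<eta>)) (\<kappa> * real (card S) * B)"
    using nonamenable_average[OF assms(1)] by metis
  define I where "I j = {l. set l \<subseteq> S \<and> length l = j}" for j
  define p where "p l = foldr (\<lambda>a b. a \<otimes>\<^bsub>G\<^esub> b) l \<one>\<^bsub>G\<^esub>" for l
  have p_closed: "p l \<in> carrier G" if "set l \<subseteq> carrier G" for l
    using that by (induction l) (auto simp: p_def monoid.one_closed[OF group.is_monoid[OF group_G]]
        intro!: monoid.m_closed[OF group.is_monoid[OF group_G]])
  have finI: "finite (I j)" and cardI: "card (I j) = card S ^ j" for j
    unfolding I_def using S(1) by (simp_all add: finite_lists_length_eq card_lists_length_eq)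
  have bound: "l2_bounded Y (\<lambda>\<eta>. \<Sum>l\<in>I j. f (act (p l) \<eta>)) ((\<kappa> * real (card S)) ^ j * B)"
    if "l2_bounded Y f B" for j f B
    using that
  proof (induction j arbitrary: f B)
    case 0
    have "I 0 = {[]}" by (auto simp: I_def)
    then have "(\<Sum>l\<in>I 0. f (act (p l) \<eta>)) = f (act \<one>\<^bsub>G\<^esub> \<eta>)" for \<eta> by (simp add: p_def)
    then show ?case
      using l2_bounded_act[OF 0 monoid.one_closed[OF group.is_monoid[OF group_G]]] by simp
  next
    case (Suc j)
    let ?f = "\<lambda>\<eta>. \<Sum>g\<in>S. f (act g \<eta>)"
    have "l2_bounded Y (\<lambda>\<eta>. \<Sum>l\<in>I j. ?f (act (p l) \<eta>)) ((\<kappa> * real (card S)) ^ j * (\<kappa> * real (card S) * B))"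
      by (rule Suc.IH[OF av[OF Suc.prems]])
    moreover have "(\<Sum>l\<in>I j. ?f (act (p l) \<eta>)) = (\<Sum>l\<in>I (Suc j). f (act (p l) \<eta>))" if \<eta>: "\<eta> \<in> Y" for \<eta>
    proof -
      have "(\<Sum>l\<in>I (Suc j). f (act (p l) \<eta>)) = (\<Sum>(l, g)\<in>I j \<times> S. f (act (p (g # l)) \<eta>))"
        unfolding I_def lists_length_Suc_eq
        by (subst sum.reindex) (auto simp: inj_on_def split_def)
      also have "\<dots> = (\<Sum>l\<in>I j. \<Sum>g\<in>S. f (act (p (g # l)) \<eta>))"
        by (rule sum.cartesian_product[symmetric])
      also have "\<dots> = (\<Sum>l\<in>I j. ?f (act (p l) \<eta>))"
      proof (intro sum.cong refl)
        fix l g assume "l \<in> I j" "g \<in> S"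
        then have "p l \<in> carrier G" "g \<in> carrier G" using p_closed[of l] S(3) by (auto simp: I_def)
        then show "f (act (p (g # l)) \<eta>) = f (act g (act (p l) \<eta>))"
          using act_mult[of g "p l" \<eta>] \<eta> by (simp add: p_def)
      qed
      finally show ?thesis by simp
    qed
    ultimately have "l2_bounded Y (\<lambda>\<eta>. \<Sum>l\<in>I (Suc j). f (act (p l) \<eta>))
        ((\<kappa> * real (card S)) ^ j * (\<kappa> * real (card S) * B))"
      by (rule l2_bounded_cong)
    then show ?case by (simp add: mult_ac)
  qed
  obtain j where j: "\<kappa> ^ j < \<delta>" using real_arch_pow_inv[OF \<delta> \<kappa>(2)] by blast
  show thesis
  proof (rule that[of "I j" p])
    have "card (I j) > 0" unfolding cardI using S(1,2) by (simp add: card_gt_0_iff)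
    then show "I j \<noteq> {}" by auto
    show "p i \<in> carrier G" if "i \<in> I j" for i using p_closed[of i] that S(3) by (auto simp: I_def)
    fix f B assume f: "l2_bounded Y f B"
    have "(\<kappa> * real (card S)) ^ j * B \<le> \<delta> * real (card (I j)) * B"
      using j l2_bounded_nonneg[OF f] unfolding cardI
      by (simp add: power_mult_distrib mult_right_mono)
    then show "l2_bounded Y (\<lambda>\<eta>. \<Sum>i\<in>I j. f (act (p i) \<eta>)) (\<delta> * real (card (I j)) * B)"
      using l2_bounded_weaken[OF bound[OF f]] by blast
  qed (rule finI)
qed


section \<open>Visibility\<close>

lemma finite_cocycle: "finite (\<theta>n n ` \<Sigma>)"
proof -
  obtain R where R: "finite R" "R \<subseteq> \<Sigma>" "\<And>x. x \<in> \<Sigma> \<Longrightarrow> \<exists>c\<in>R. agree (n + M) x c"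
    using finite_representatives by blast
  have "\<theta>n n ` \<Sigma> \<subseteq> \<theta>n n ` R"
  proof (rule image_subsetI)
    fix x assume x: "x \<in> \<Sigma>"
    then obtain c where "c \<in> R" "agree (n + M) x c" using R(3) by blast
    then show "\<theta>n n x \<in> \<theta>n n ` R" using cocycle_window[OF x, of c] R(2) by blast
  qed
  then show ?thesis using finite_subset[OF _ finite_imageI[OF R(1)]] by blast
qed

text \<open>Irreducibility upgrades visibility: up to finitely many factors, every group
  element is read along a path that starts in a given window and ends at a given point.\<close>

lemma visibility_paths:
  assumes vis: "visibility_property \<Sigma> G \<theta>"
  obtains V where "finite V" "V \<subseteq> carrier G"
    "\<And>g. g \<in> carrier G \<Longrightarrow> \<exists>N. \<forall>x0\<in>\<Sigma>. \<forall>x\<in>\<Sigma>. \<exists>m\<le>N. \<exists>y\<in>preimages m x.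
       agree M y x0 \<and> (\<exists>v\<in>V. \<exists>v'\<in>V. \<theta>n m y = v \<otimes>\<^bsub>G\<^esub> g \<otimes>\<^bsub>G\<^esub> v')"
proof -
  interpret G: group G by (rule group_G)
  obtain U where U: "finite U" "U \<subseteq> carrier G"
    and vis': "\<forall>g\<in>carrier G. \<exists>x\<in>\<Sigma>. \<exists>n. \<exists>u1\<in>U. \<exists>u2\<in>U. g = u1 \<otimes>\<^bsub>G\<^esub> \<theta>n n x \<otimes>\<^bsub>G\<^esub> u2"
    using vis unfolding visibility_property_def by (elim exE conjE) (rule that)
  define W where "W = (\<Union>k\<le>K. \<theta>n k ` \<Sigma>)"
  have W: "finite W" "W \<subseteq> carrier G" unfolding W_def using finite_cocycle cocycle_closed by auto
  define V where "V = (\<lambda>(a, u). a \<otimes>\<^bsub>G\<^esub> inv\<^bsub>G\<^esub> u) ` (W \<times> U) \<union> (\<lambda>(a, u). inv\<^bsub>G\<^esub> u \<otimes>\<^bsub>G\<^esub> a) ` (W \<times> U)"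
  show thesis
  proof (rule that[of V])
    show "finite V" unfolding V_def using W U by simp
    show "V \<subseteq> carrier G" unfolding V_def using W(2) U(2) by auto
    fix g assume g: "g \<in> carrier G"
    obtain z n u1 u2 where z: "z \<in> \<Sigma>" and u: "u1 \<in> U" "u2 \<in> U" and gz: "g = u1 \<otimes>\<^bsub>G\<^esub> \<theta>n n z \<otimes>\<^bsub>G\<^esub> u2"
      using bspec[OF vis' g] by (elim bexE exE) (rule that)
    have uc: "u1 \<in> carrier G" "u2 \<in> carrier G" "\<theta>n n z \<in> carrier G" using u U(2) cocycle_closed[OF z] by auto
    have zg: "\<theta>n n z = inv\<^bsub>G\<^esub> u1 \<otimes>\<^bsub>G\<^esub> g \<otimes>\<^bsub>G\<^esub> inv\<^bsub>G\<^esub> u2"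
    proof -
      have "u1 \<otimes>\<^bsub>G\<^esub> \<theta>n n z = g \<otimes>\<^bsub>G\<^esub> inv\<^bsub>G\<^esub> u2" using uc gz g G.inv_solve_right by auto
      then have "\<theta>n n z = inv\<^bsub>G\<^esub> u1 \<otimes>\<^bsub>G\<^esub> (g \<otimes>\<^bsub>G\<^esub> inv\<^bsub>G\<^esub> u2)" using uc g G.inv_solve_left by auto
      then show ?thesis using uc g by (simp add: G.m_assoc)
    qed
    show "\<exists>N. \<forall>x0\<in>\<Sigma>. \<forall>x\<in>\<Sigma>. \<exists>m\<le>N. \<exists>y\<in>preimages m x.
       agree M y x0 \<and> (\<exists>v\<in>V. \<exists>v'\<in>V. \<theta>n m y = v \<otimes>\<^bsub>G\<^esub> g \<otimes>\<^bsub>G\<^esub> v')"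
    proof (rule exI[of _ "K + (n + K)"], intro ballI)
      fix x0 x assume x0: "x0 \<in> \<Sigma>" and x: "x \<in> \<Sigma>"
      obtain k1 y1 where y1: "k1 \<le> K" "y1 \<in> \<Sigma>" "agree M y1 (suffix n z)" "suffix k1 y1 = x"
        using connect[OF suffix_in[OF z] x] by blast
      define y2 where "y2 = glue n z y1"
      have y2: "y2 \<in> \<Sigma>" "suffix n y2 = y1" "agree (n + M) y2 z"
        unfolding y2_def using glue_in[OF z y1(2) agree_sym[OF y1(3)]] agree_glue_suffix[OF y1(3)] by auto
      obtain k3 y3 where y3: "k3 \<le> K" "y3 \<in> \<Sigma>" "agree M y3 x0" "suffix k3 y3 = y2"
        using connect[OF x0 y2(1)] by blast
      let ?m = "k3 + (n + k1)"
      have "suffix ?m y3 = x" using y1(4) y2(2) y3(4) by (metis suffix_suffix)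
      then have pre: "y3 \<in> preimages ?m x" using y3(2) by (simp add: preimages_def)
      define a c where "a = \<theta>n k3 y3" and "c = \<theta>n k1 y1"
      have acW: "a \<in> W" "c \<in> W" unfolding a_def c_def W_def using y1 y3 by auto
      have ac: "a \<in> carrier G" "c \<in> carrier G" using acW W(2) by auto
      have "\<theta>n ?m y3 = a \<otimes>\<^bsub>G\<^esub> (\<theta>n n z \<otimes>\<^bsub>G\<^esub> c)"
        using cocycle_add[OF y3(2), of k3 "n + k1"] cocycle_add[OF y2(1), of n k1]
          cocycle_window[OF y2(1) z y2(3)] y3(4) y2(2) by (simp add: a_def c_def)
      also have "\<dots> = (a \<otimes>\<^bsub>G\<^esub> inv\<^bsub>G\<^esub> u1) \<otimes>\<^bsub>G\<^esub> g \<otimes>\<^bsub>G\<^esub> (inv\<^bsub>G\<^esub> u2 \<otimes>\<^bsub>G\<^esub> c)"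
        unfolding zg using uc ac g by (simp add: G.m_assoc)
      finally have "\<theta>n ?m y3 = (a \<otimes>\<^bsub>G\<^esub> inv\<^bsub>G\<^esub> u1) \<otimes>\<^bsub>G\<^esub> g \<otimes>\<^bsub>G\<^esub> (inv\<^bsub>G\<^esub> u2 \<otimes>\<^bsub>G\<^esub> c)" .
      moreover have "a \<otimes>\<^bsub>G\<^esub> inv\<^bsub>G\<^esub> u1 \<in> V" "inv\<^bsub>G\<^esub> u2 \<otimes>\<^bsub>G\<^esub> c \<in> V"
        unfolding V_def using acW u by (auto simp: image_iff)
      moreover have "?m \<le> K + (n + K)" using y1(1) y3(1) by simp
      ultimately show "\<exists>m\<le>K + (n + K). \<exists>y\<in>preimages m x.
         agree M y x0 \<and> (\<exists>v\<in>V. \<exists>v'\<in>V. \<theta>n m y = v \<otimes>\<^bsub>G\<^esub> g \<otimes>\<^bsub>G\<^esub> v')"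
        using pre y3(3) by blast
    qed
  qed
qed

end


section \<open>Almost superharmonic functions\<close>

lemma iterate_contraction:
  fixes P :: "real \<Rightarrow> bool"
  assumes q: "0 \<le> q" "q < 1" and B0: "P B0" and step: "\<And>B. P B \<Longrightarrow> P (a + q * B)"
  shows "\<exists>B. (\<forall>n. P (B n)) \<and> B \<longlonglongrightarrow> a / (1 - q)"
proof -
  define l where "l = a / (1 - q)"
  have l: "a + q * l = l" unfolding l_def using q by (simp add: field_simps)
  have "P (l + q ^ n * (B0 - l))" for n
  proof (induction n)
    case (Suc n)
    have "a + q * (l + q ^ n * (B0 - l)) = l + q ^ Suc n * (B0 - l)"
      using l by (simp add: algebra_simps)
    then show ?case using step[OF Suc] by simp
  qed (use B0 in simp)
  moreover have "(\<lambda>n. l + q ^ n * (B0 - l)) \<longlonglongrightarrow> l + 0 * (B0 - l)"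
    using q by (intro tendsto_intros LIMSEQ_realpow_zero)
  ultimately show ?thesis
    unfolding l_def[symmetric] by (intro exI[of _ "\<lambda>n. l + q ^ n * (B0 - l)"] conjI allI) simp_all
qed

lemma exists_small_power_base:
  assumes "e > (0::real)"
  obtains s where "1 < s" "s \<le> 2" "(s * s) ^ N \<le> 1 + e"
proof -
  have "((\<lambda>s::real. (s * s) ^ N) \<longlongrightarrow> (1 * 1) ^ N) (at_right 1)" by (intro tendsto_intros)
  then have "\<forall>\<^sub>F s in at_right (1::real). (s * s) ^ N < 1 + e"
    using assms by (intro order_tendstoD(2)) auto
  moreover have "\<forall>\<^sub>F s in at_right (1::real). 1 < s \<and> s < 2"
    by (intro eventually_conj eventually_at_right_less order_tendstoD(2)[OF tendsto_ident_at]) simp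
  ultimately have "\<forall>\<^sub>F s in at_right (1::real). (s * s) ^ N < 1 + e \<and> 1 < s \<and> s < 2"
    by (rule eventually_conj)
  then obtain s :: real where "(s * s) ^ N < 1 + e" "1 < s" "s < 2"
    using eventually_happens'[OF trivial_limit_at_right_real] by blast
  then show thesis using that[of s] by simp
qed

context weighted_shift
begin

text \<open>The averages \<open>cesaro (J + K) / J\<close> for large \<open>J\<close>. It matters that \<open>lo\<close> and \<open>hi\<close> do
  not depend on \<open>s\<close>: the gain of the contraction is fixed by them before \<open>s\<close> is chosen close to
  1.\<close>

lemma superharmonic_functions:
  obtains lo hi where "0 < lo" "lo \<le> hi"
    "\<And>s. s > 1 \<Longrightarrow> \<exists>h. \<forall>x\<in>\<Sigma>. lo \<le> h x \<and> h x \<le> hi \<and>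
       (\<Sum>y\<in>preimages 1 x. F y * h y) \<le> radius * s * h x"
proof -
  obtain c where c: "c > 0" "\<And>J x. x \<in> \<Sigma> \<Longrightarrow> c * real J \<le> cesaro (J + K) x"
    using cesaro_ge by blast
  define hi where "hi = max c (sup_const * (1 + real K))"
  show thesis
  proof (rule that[of c hi])
    fix s :: real assume s: "s > 1"
    obtain J where J: "real J > sup_const / (c * (s - 1)) + 1" using reals_Archimedean2 by blast
    have "0 \<le> sup_const / (c * (s - 1))" using sup_const(1) c(1) s by simp
    then have J1: "real J \<ge> 1" using J by linarith
    have "sup_const / (c * (s - 1)) < real J" using J by simp
    then have Js: "sup_const < real J * (c * (s - 1))" using c(1) s by (simp add: pos_divide_less_eq)
    define h where "h x = cesaro (J + K) x / real J" for x
    have "c \<le> h x \<and> h x \<le> hi \<and> (\<Sum>y\<in>preimages 1 x. F y * h y) \<le> radius * s * h x" if x: "x \<in> \<Sigma>" for x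
    proof (intro conjI)
      show lo: "c \<le> h x" unfolding h_def using c(2)[OF x, of J] J1 by (simp add: field_simps)
      have "cesaro (J + K) x \<le> sup_const * (real J + real K)" using cesaro_le[OF x, of "J + K"] by simp
      also have "\<dots> \<le> sup_const * (real J * (1 + real K))"
        using J1 sup_const(1) mult_right_mono[OF J1, of "real K"]
        by (intro mult_left_mono) (auto simp: distrib_left)
      finally have "h x \<le> sup_const * (1 + real K)"
        unfolding h_def using J1 by (simp add: field_simps)
      then show "h x \<le> hi" by (simp add: hi_def)
      let ?S = "weight_sum (J + K) x / radius ^ (J + K)"
      have S: "?S \<le> sup_const"
        using weight_sum_le[OF x, of "J + K"] le_radius[of "J + K"] radius_pos by (simp add: field_simps)
      have "(\<Sum>y\<in>preimages 1 x. F y * h y) = (\<Sum>y\<in>preimages 1 x. F y * cesaro (J + K) y) / real J"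
        by (simp add: h_def sum_divide_distrib)
      also have "\<dots> = radius * (h x - 1 / real J + ?S / real J)"
        unfolding transfer_cesaro[OF x] h_def
        by (simp only: times_divide_eq_right[symmetric] add_divide_distrib diff_divide_distrib)
      also have "\<dots> \<le> radius * (h x + sup_const / real J)"
      proof (rule mult_left_mono)
        have "?S / real J \<le> sup_const / real J" by (intro divide_right_mono S) simp
        moreover have "0 \<le> 1 / real J" by simp
        ultimately show "h x - 1 / real J + ?S / real J \<le> h x + sup_const / real J" by linarith
      qed (use radius_pos in simp)
      also have "\<dots> \<le> radius * (s * h x)"
      proof -
        have "sup_const / real J \<le> c * (s - 1)" using Js J1 by (simp add: field_simps)
        also have "\<dots> \<le> h x * (s - 1)" using lo s by (intro mult_right_mono) auto
        finally show ?thesis using radius_pos by (intro mult_left_mono) (auto simp: algebra_simps)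
      qed
      finally show "(\<Sum>y\<in>preimages 1 x. F y * h y) \<le> radius * s * h x" by (simp add: mult.assoc)
    qed
    then show "\<exists>h. \<forall>x\<in>\<Sigma>. c \<le> h x \<and> h x \<le> hi \<and> (\<Sum>y\<in>preimages 1 x. F y * h y) \<le> radius * s * h x"
      by blast
  qed (use c(1) hi_def in auto)
qed

lemma superharmonic_iterate:
  assumes h: "\<And>x. x \<in> \<Sigma> \<Longrightarrow> (\<Sum>y\<in>preimages 1 x. F y * h y) \<le> r * h x" and r: "r \<ge> 0"
    and x: "x \<in> \<Sigma>"
  shows "(\<Sum>y\<in>preimages n x. weight n y * h y) \<le> r ^ n * h x"
  using x
proof (induction n arbitrary: x)
  case 0
  then show ?case by (simp add: preimages_0)
next
  case (Suc n)
  have "(\<Sum>y\<in>preimages (n + 1) x. weight (n + 1) y * h y)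
    = (\<Sum>u\<in>preimages 1 x. \<Sum>y\<in>preimages n u. weight (n + 1) y * h y)"
    by (rule sum_preimages_add)
  also have "\<dots> = (\<Sum>u\<in>preimages 1 x. F u * (\<Sum>y\<in>preimages n u. weight n y * h y))"
    unfolding sum_distrib_left
  proof (intro sum.cong refl)
    fix u y assume "u \<in> preimages 1 x" "y \<in> preimages n u"
    then have "weight (n + 1) y = weight n y * F u"
      using weight_add[of n 1 y] preimagesD(2)[of y n u] by simp
    then show "weight (n + 1) y * h y = F u * (weight n y * h y)" by (simp only: mult_ac)
  qed
  also have "\<dots> \<le> (\<Sum>u\<in>preimages 1 x. F u * (r ^ n * h u))"
    by (intro sum_mono mult_left_mono Suc.IH) (auto dest: preimagesD intro: less_imp_le F_pos)
  also have "\<dots> = r ^ n * (\<Sum>u\<in>preimages 1 x. F u * h u)"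
    by (simp add: sum_distrib_left mult_ac)
  also have "\<dots> \<le> r ^ n * (r * h x)" using h[OF Suc.prems] r by (intro mult_left_mono) auto
  finally show ?case by (simp add: mult_ac)
qed

end

context twisted_shift
begin

section \<open>Contraction for non-amenable actions\<close>

lemma twisted_sum_harnack:
  fixes f :: "'y \<Rightarrow> real"
  assumes x: "x \<in> \<Sigma>" "x' \<in> \<Sigma>" "agree M x x'" and \<eta>: "\<eta> \<in> Y" and f: "\<And>\<eta>. \<eta> \<in> Y \<Longrightarrow> f \<eta> \<ge> 0"
  shows "twisted_sum n (\<lambda>_. f) x \<eta> \<le> harnack * twisted_sum n (\<lambda>_. f) x' \<eta>"
  unfolding twisted_sum_def sum_preimages_glue[OF x] sum_distrib_left
proof (rule sum_mono)
  fix y assume y: "y \<in> preimages n x"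
  note g = glue_preimage[OF y x(2,3)]
  have "\<theta>n n (glue n y x') = \<theta>n n y" using cocycle_window[OF preimagesD(1)[OF y] g(1,3)] by simp
  moreover have "weight n y * f (act (\<theta>n n y) \<eta>) \<le> harnack * weight n (glue n y x') * f (act (\<theta>n n y) \<eta>)"
    by (intro mult_right_mono weight_harnack g preimagesD[OF y] f act_in cocycle_closed \<eta>)
  ultimately show "weight n y *\<^sub>R f (act (\<theta>n n y) \<eta>)
      \<le> harnack * (weight n (glue n y x') *\<^sub>R f (act (\<theta>n n (glue n y x')) \<eta>))"
    by (simp add: mult.assoc)
qed

text \<open>The truncated Green function treats all path lengths at once, so that paths of
  different lengths can be combined.\<close>

definition green :: "real \<Rightarrow> nat \<Rightarrow> ('y \<Rightarrow> real) \<Rightarrow> 'a word \<Rightarrow> 'y \<Rightarrow> real" where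
  "green z J f x \<eta> = (\<Sum>n\<le>J. twisted_sum n (\<lambda>_. f) x \<eta> / z ^ n)"

lemma twisted_sum_nonneg:
  fixes \<Psi> :: "'a word \<Rightarrow> 'y \<Rightarrow> real"
  assumes "\<And>y \<zeta>. y \<in> \<Sigma> \<Longrightarrow> \<zeta> \<in> Y \<Longrightarrow> \<Psi> y \<zeta> \<ge> 0" "\<eta> \<in> Y"
  shows "twisted_sum n \<Psi> x \<eta> \<ge> 0"
  unfolding twisted_sum_def
  by (intro sum_nonneg scaleR_nonneg_nonneg preimages_weight_nonneg assms act_in cocycle_closed)
    (auto dest: preimagesD)

lemma green_nonneg:
  assumes "z > 0" "\<And>\<eta>. \<eta> \<in> Y \<Longrightarrow> f \<eta> \<ge> 0" "\<eta> \<in> Y"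
  shows "green z J f x \<eta> \<ge> 0"
  unfolding green_def using assms by (intro sum_nonneg divide_nonneg_nonneg twisted_sum_nonneg) auto

lemma green_harnack:
  assumes "z > 0" "\<And>\<eta>. \<eta> \<in> Y \<Longrightarrow> f \<eta> \<ge> 0" "\<eta> \<in> Y" "x \<in> \<Sigma>" "x' \<in> \<Sigma>" "agree M x x'"
  shows "green z J f x \<eta> \<le> harnack * green z J f x' \<eta>"
  unfolding green_def sum_distrib_left
proof (rule sum_mono)
  fix n
  have "twisted_sum n (\<lambda>_. f) x \<eta> \<le> harnack * twisted_sum n (\<lambda>_. f) x' \<eta>"
    by (rule twisted_sum_harnack[OF assms(4-6,3)]) (rule assms(2))
  then show "twisted_sum n (\<lambda>_. f) x \<eta> / z ^ n \<le> harnack * (twisted_sum n (\<lambda>_. f) x' \<eta> / z ^ n)"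
    using divide_right_mono[of _ _ "z ^ n"] assms(1) by fastforce
qed

lemma twisted_sum_divide:
  fixes \<Psi> :: "'a word \<Rightarrow> 'y \<Rightarrow> real"
  shows "twisted_sum n (\<lambda>y \<zeta>. \<Psi> y \<zeta> / c) x \<eta> = twisted_sum n \<Psi> x \<eta> / c"
  by (simp add: twisted_sum_def sum_divide_distrib)

lemma green_step:
  assumes "z > 0" "\<And>\<eta>. \<eta> \<in> Y \<Longrightarrow> f \<eta> \<ge> 0" "\<eta> \<in> Y" "x \<in> \<Sigma>"
  shows "green z J f x \<eta> \<le> f \<eta> + twisted_sum 1 (green z J f) x \<eta> / z"
proof -
  let ?t = "\<lambda>n. twisted_sum n (\<lambda>_. f) x \<eta> / z ^ n"
  have step: "twisted_sum 1 (\<lambda>y \<zeta>. twisted_sum n (\<lambda>_. f) y \<zeta> / z ^ n) x \<eta> / z = ?t (Suc n)" for n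
  proof -
    have "twisted_sum (Suc n) (\<lambda>_. f) x \<eta> = twisted_sum 1 (twisted_sum n (\<lambda>_. f)) x \<eta>"
      using twisted_sum_add[OF assms(3), of n 1] by simp
    then show ?thesis by (simp only: twisted_sum_divide) simp
  qed
  have "twisted_sum 1 (green z J f) x \<eta> / z
    = (\<Sum>n\<le>J. twisted_sum 1 (\<lambda>y \<zeta>. twisted_sum n (\<lambda>_. f) y \<zeta> / z ^ n) x \<eta> / z)"
    unfolding twisted_sum_def[of 1] green_def
    by (simp only: scaleR_sum_right sum_divide_distrib) (rule sum.swap)
  also have "\<dots> = (\<Sum>n\<le>J. ?t (Suc n))" by (simp only: step)
  finally have eq: "f \<eta> + twisted_sum 1 (green z J f) x \<eta> / z = (\<Sum>n\<le>Suc J. ?t n)"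
    using assms(3,4) by (simp only: sum.atMost_Suc_shift twisted_sum_0) simp
  have "?t (Suc J) \<ge> 0" using assms by (intro divide_nonneg_nonneg twisted_sum_nonneg) auto
  then show ?thesis unfolding eq by (simp add: green_def)
qed

lemma green_iterate:
  assumes z: "z > 0" and f: "\<And>\<eta>. \<eta> \<in> Y \<Longrightarrow> f \<eta> \<ge> 0" and \<eta>: "\<eta> \<in> Y" and x: "x \<in> \<Sigma>"
  shows "green z J f x \<eta> \<le> (\<Sum>i<n. twisted_sum i (\<lambda>_. f) x \<eta> / z ^ i) + twisted_sum n (green z J f) x \<eta> / z ^ n"
proof (induction n)
  case 0
  then show ?case using twisted_sum_0[OF x \<eta>, of "green z J f"] by simp
next
  case (Suc n)
  have "twisted_sum n (green z J f) x \<eta>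
    \<le> twisted_sum n (\<lambda>y \<zeta>. f \<zeta> + twisted_sum 1 (green z J f) y \<zeta> / z) x \<eta>"
    by (intro twisted_sum_mono \<eta> green_step z f) (auto dest: preimagesD)
  also have "\<dots> = twisted_sum n (\<lambda>_. f) x \<eta> + twisted_sum n (twisted_sum 1 (green z J f)) x \<eta> / z"
    unfolding twisted_sum_def[of n] by (simp add: sum.distrib distrib_left sum_divide_distrib)
  also have "twisted_sum n (twisted_sum 1 (green z J f)) x \<eta> = twisted_sum (Suc n) (green z J f) x \<eta>"
    using twisted_sum_add[OF \<eta>, of 1 n "green z J f" x] by simp
  finally have "twisted_sum n (green z J f) x \<eta> / z ^ n
    \<le> (twisted_sum n (\<lambda>_. f) x \<eta> + twisted_sum (Suc n) (green z J f) x \<eta> / z) / z ^ n"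
    using z by (intro divide_right_mono) auto
  then show ?case using Suc by (simp add: add_divide_distrib mult.commute)
qed

lemma l2_bounded_twisted_const:
  assumes "l2_bounded Y f B" "x \<in> \<Sigma>"
  shows "l2_bounded Y (twisted_sum n (\<lambda>_. f) x) (sup_weight n * B)"
proof (rule l2_bounded_weaken[OF l2_bounded_twisted_sum])
  show "(\<Sum>y\<in>preimages n x. weight n y * B) \<le> sup_weight n * B"
    using mult_right_mono[OF weight_sum_le[OF assms(2)] l2_bounded_nonneg[OF assms(1)]]
    by (simp add: weight_sum_def sum_distrib_right)
qed (rule assms(1))

text \<open>The amount \<open>\<delta>0\<close> of the mass of all paths of length at most \<open>N\<close> is spread evenly
  over the paths chosen for the indices \<open>i\<close>. They all start in the window of \<open>x0\<close>, where \<open>\<psi>\<close> is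
  comparable with \<open>\<psi> x0\<close>, so that their contribution is dominated by the average of the
  translates of \<open>\<psi> x0\<close> over \<open>I\<close>, and \<open>\<delta>\<close> is so small that this average is at most half of the
  trivial bound.\<close>

lemma path_gain:
  fixes I :: "'i set" and p :: "'i \<Rightarrow> 'g" and h :: "'a word \<Rightarrow> real"
  assumes I: "finite I" "I \<noteq> {}" and p: "\<And>i. i \<in> I \<Longrightarrow> p i \<in> carrier G"
    and avg: "\<And>f B. l2_bounded Y f B \<Longrightarrow> l2_bounded Y (\<lambda>\<eta>. \<Sum>i\<in>I. f (act (p i) \<eta>)) (\<delta> * real (card I) * B)"
    and V: "finite V" "V \<subseteq> carrier G"
    and paths: "\<And>i. i \<in> I \<Longrightarrow> \<exists>m\<le>N. \<exists>y\<in>preimages m x.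
       agree M y x0 \<and> (\<exists>v\<in>V. \<exists>v'\<in>V. \<theta>n m y = v \<otimes>\<^bsub>G\<^esub> p i \<otimes>\<^bsub>G\<^esub> v')"
    and \<delta>0: "0 \<le> \<delta>0" "\<And>m y. m \<le> N \<Longrightarrow> y \<in> preimages m x \<Longrightarrow> \<delta>0 \<le> weight m y / z ^ m"
    and \<delta>: "\<delta> \<ge> 0" "harnack * (real (card V))\<^sup>2 * \<delta> * hi \<le> lo / 2"
    and z: "z > 0" and x: "x \<in> \<Sigma>" "x0 \<in> \<Sigma>"
    and h: "\<And>y. y \<in> \<Sigma> \<Longrightarrow> lo \<le> h y \<and> h y \<le> hi" "0 < lo"
    and \<psi>_nonneg: "\<And>y \<eta>. y \<in> \<Sigma> \<Longrightarrow> \<eta> \<in> Y \<Longrightarrow> 0 \<le> \<psi> y \<eta>"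
    and \<psi>_harnack: "\<And>y \<eta>. y \<in> \<Sigma> \<Longrightarrow> \<eta> \<in> Y \<Longrightarrow> agree M y x0 \<Longrightarrow> \<psi> y \<eta> \<le> harnack * \<psi> x0 \<eta>"
    and B: "B \<ge> 0" "\<And>y. y \<in> \<Sigma> \<Longrightarrow> l2_bounded Y (\<psi> y) (B * h y)"
  shows "l2_bounded Y (\<lambda>\<eta>. \<Sum>n\<le>N. twisted_sum n \<psi> x \<eta> / z ^ n)
    (B * ((\<Sum>n\<le>N. (\<Sum>y\<in>preimages n x. weight n y * h y) / z ^ n) - \<delta>0 * lo / 2))"
proof -
  interpret G: group G by (rule group_G)
  define P where "P = Sigma {..N} (\<lambda>n. preimages n x)"
  define w where "w = (\<lambda>(n, y). weight n y / z ^ n)"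
  define X where "X = (\<lambda>(n, y) \<eta>. \<psi> y (act (\<theta>n n y) \<eta>))"
  define hh where "hh = (\<lambda>(n::nat, y). h y)"
  have finP: "finite P" unfolding P_def by auto
  have P_in: "snd q \<in> \<Sigma>" if "q \<in> P" for q using that by (auto simp: P_def dest: preimagesD)
  have sumP: "(\<Sum>n\<le>N. twisted_sum n \<psi> x \<eta> / z ^ n) = (\<Sum>q\<in>P. w q * X q \<eta>)" for \<eta>
  proof -
    have "(\<Sum>n\<le>N. twisted_sum n \<psi> x \<eta> / z ^ n)
      = (\<Sum>n\<le>N. \<Sum>y\<in>preimages n x. w (n, y) * X (n, y) \<eta>)"
      by (simp add: twisted_sum_def w_def X_def sum_divide_distrib)
    also have "\<dots> = (\<Sum>(n, y)\<in>P. w (n, y) * X (n, y) \<eta>)"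
      unfolding P_def by (rule sum.Sigma) auto
    finally show ?thesis by (simp add: split_def)
  qed
  have sumh: "(\<Sum>n\<le>N. (\<Sum>y\<in>preimages n x. weight n y * h y) / z ^ n) = (\<Sum>q\<in>P. w q * hh q)"
  proof -
    have "(\<Sum>n\<le>N. (\<Sum>y\<in>preimages n x. weight n y * h y) / z ^ n)
      = (\<Sum>n\<le>N. \<Sum>y\<in>preimages n x. w (n, y) * hh (n, y))"
      by (simp add: w_def hh_def sum_divide_distrib)
    also have "\<dots> = (\<Sum>(n, y)\<in>P. w (n, y) * hh (n, y))"
      unfolding P_def by (rule sum.Sigma) auto
    finally show ?thesis by (simp add: split_def)
  qed
  have "\<exists>q. q \<in> P \<and> agree M (snd q) x0 \<and> (\<exists>v\<in>V. \<exists>v'\<in>V. \<theta>n (fst q) (snd q) = v \<otimes>\<^bsub>G\<^esub> p i \<otimes>\<^bsub>G\<^esub> v')"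
    if i: "i \<in> I" for i
  proof -
    obtain m y where "m \<le> N" "y \<in> preimages m x" "agree M y x0"
      "\<exists>v\<in>V. \<exists>v'\<in>V. \<theta>n m y = v \<otimes>\<^bsub>G\<^esub> p i \<otimes>\<^bsub>G\<^esub> v'"
      using paths[OF i] by (elim exE conjE bexE) (rule that, assumption+, blast)
    then show ?thesis by (intro exI[of _ "(m, y)"]) (auto simp: P_def)
  qed
  then have "\<forall>i\<in>I. \<exists>q v v'. q \<in> P \<and> agree M (snd q) x0 \<and> v \<in> V \<and> v' \<in> V \<and>
      \<theta>n (fst q) (snd q) = v \<otimes>\<^bsub>G\<^esub> p i \<otimes>\<^bsub>G\<^esub> v'"
    by blast
  then obtain P0 where "\<forall>i\<in>I. \<exists>v v'. P0 i \<in> P \<and> agree M (snd (P0 i)) x0 \<and> v \<in> V \<and> v' \<in> V \<and>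
      \<theta>n (fst (P0 i)) (snd (P0 i)) = v \<otimes>\<^bsub>G\<^esub> p i \<otimes>\<^bsub>G\<^esub> v'"
    by (rule bchoice[THEN exE])
  then obtain v where "\<forall>i\<in>I. \<exists>v'. P0 i \<in> P \<and> agree M (snd (P0 i)) x0 \<and> v i \<in> V \<and> v' \<in> V \<and>
      \<theta>n (fst (P0 i)) (snd (P0 i)) = v i \<otimes>\<^bsub>G\<^esub> p i \<otimes>\<^bsub>G\<^esub> v'"
    by (rule bchoice[THEN exE])
  then obtain v' where *: "\<forall>i\<in>I. P0 i \<in> P \<and> agree M (snd (P0 i)) x0 \<and> v i \<in> V \<and> v' i \<in> V \<and>
      \<theta>n (fst (P0 i)) (snd (P0 i)) = v i \<otimes>\<^bsub>G\<^esub> p i \<otimes>\<^bsub>G\<^esub> v' i"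
    by (rule bchoice[THEN exE])
  have P0: "\<And>i. i \<in> I \<Longrightarrow> P0 i \<in> P" "\<And>i. i \<in> I \<Longrightarrow> agree M (snd (P0 i)) x0"
    and vv: "\<And>i. i \<in> I \<Longrightarrow> v i \<in> V" "\<And>i. i \<in> I \<Longrightarrow> v' i \<in> V"
    and \<theta>P: "\<And>i. i \<in> I \<Longrightarrow> \<theta>n (fst (P0 i)) (snd (P0 i)) = v i \<otimes>\<^bsub>G\<^esub> p i \<otimes>\<^bsub>G\<^esub> v' i"
    using * by blast+
  define cnt where "cnt q = real (card {i \<in> I. P0 i = q})" for q
  have count: "(\<Sum>q\<in>P. cnt q * g q) = (\<Sum>i\<in>I. g (P0 i))" for g :: "nat \<times> 'a word \<Rightarrow> real"
  proof -
    have "(\<Sum>i\<in>I. g (P0 i)) = (\<Sum>q\<in>P. \<Sum>i\<in>{i \<in> I. P0 i = q}. g (P0 i))"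
      using P0(1) by (intro sum.group[symmetric] I(1) finP) auto
    also have "\<dots> = (\<Sum>q\<in>P. cnt q * g q)" by (intro sum.cong refl) (simp add: cnt_def)
    finally show ?thesis by simp
  qed
  have cardI: "real (card I) > 0" using I by (simp add: card_gt_0_iff)
  define \<epsilon> where "\<epsilon> = \<delta>0 / real (card I)"
  have \<epsilon>: "\<epsilon> \<ge> 0" "\<epsilon> * real (card I) = \<delta>0" using \<delta>0(1) cardI by (auto simp: \<epsilon>_def)
  have excess: "w q - \<epsilon> * cnt q \<ge> 0" if "q \<in> P" for q
  proof -
    have "cnt q \<le> real (card I)" unfolding cnt_def using card_mono[OF I(1), of "{i \<in> I. P0 i = q}"] by simp
    then have "\<epsilon> * cnt q \<le> \<epsilon> * real (card I)" using \<epsilon>(1) by (intro mult_left_mono)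
    also have "\<dots> \<le> w q" using \<epsilon>(2) \<delta>0(2) that by (auto simp: P_def w_def)
    finally show ?thesis by simp
  qed
  have part1: "l2_bounded Y (\<lambda>\<eta>. \<Sum>q\<in>P. (w q - \<epsilon> * cnt q) * X q \<eta>) (\<Sum>q\<in>P. (w q - \<epsilon> * cnt q) * (B * hh q))"
  proof (intro l2_bounded_sum l2_bounded_cmult_nonneg excess)
    fix q assume q: "q \<in> P"
    then show "l2_bounded Y (X q) (B * hh q)"
      using l2_bounded_act[OF B(2)[OF P_in[OF q]] cocycle_closed[OF P_in[OF q], of "fst q"]]
      by (simp add: X_def hh_def split_def)
  qed
  have part2: "l2_bounded Y (\<lambda>\<eta>. \<Sum>i\<in>I. X (P0 i) \<eta>) (real (card I) * (lo / 2) * B)"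
  proof -
    let ?A = "\<lambda>a a' \<eta>. \<Sum>i\<in>I. \<psi> x0 (act a (act (p i) (act a' \<eta>)))"
    have one: "l2_bounded Y (?A a a') (\<delta> * real (card I) * (B * hi))" if "a \<in> V" "a' \<in> V" for a a'
    proof -
      have c: "a \<in> carrier G" "a' \<in> carrier G" using that V(2) by auto
      have "l2_bounded Y (\<psi> x0) (B * hi)"
        using l2_bounded_weaken[OF B(2)[OF x(2)]] h(1)[OF x(2)] B(1) by (simp add: mult_left_mono)
      then have "l2_bounded Y (\<lambda>\<eta>. \<Sum>i\<in>I. \<psi> x0 (act a (act (p i) \<eta>))) (\<delta> * real (card I) * (B * hi))"
        by (intro avg[of "\<lambda>\<eta>. \<psi> x0 (act a \<eta>)"] l2_bounded_act c)
      then show ?thesis by (rule l2_bounded_act) (rule c)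
    qed
    have "l2_bounded Y (\<lambda>\<eta>. harnack * (\<Sum>a\<in>V. \<Sum>a'\<in>V. ?A a a' \<eta>))
      (harnack * (\<Sum>a\<in>V. \<Sum>a'\<in>V. \<delta> * real (card I) * (B * hi)))"
      using harnack_ge_1 by (intro l2_bounded_cmult_nonneg l2_bounded_sum one) auto
    moreover have "harnack * (\<Sum>a\<in>V. \<Sum>a'\<in>V. \<delta> * real (card I) * (B * hi)) \<le> real (card I) * (lo / 2) * B"
    proof -
      have "harnack * (\<Sum>a\<in>V. \<Sum>a'\<in>V. \<delta> * real (card I) * (B * hi))
        = harnack * (real (card V))\<^sup>2 * \<delta> * hi * (real (card I) * B)"
        by (simp add: power2_eq_square mult_ac)
      also have "\<dots> \<le> lo / 2 * (real (card I) * B)" using \<delta>(2) B(1) by (intro mult_right_mono) auto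
      finally show ?thesis by (simp add: mult_ac)
    qed
    ultimately have "l2_bounded Y (\<lambda>\<eta>. harnack * (\<Sum>a\<in>V. \<Sum>a'\<in>V. ?A a a' \<eta>)) (real (card I) * (lo / 2) * B)"
      by (rule l2_bounded_weaken)
    then show ?thesis
    proof (rule l2_bounded_mono)
      fix \<eta> assume \<eta>: "\<eta> \<in> Y"
      have nn: "0 \<le> \<psi> x0 (act a (act (p i) (act a' \<eta>)))" if "i \<in> I" "a \<in> V" "a' \<in> V" for i a a'
        using that V(2) by (intro \<psi>_nonneg x act_in p \<eta>) auto
      have nnX: "0 \<le> X (P0 i) \<eta>" if "i \<in> I" for i
        unfolding X_def split_def
        by (intro \<psi>_nonneg P_in P0 that act_in cocycle_closed \<eta>)
      have "X (P0 i) \<eta> \<le> (\<Sum>a\<in>V. \<Sum>a'\<in>V. harnack * \<psi> x0 (act a (act (p i) (act a' \<eta>))))" if i: "i \<in> I" for i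
      proof -
        have c: "v i \<in> carrier G" "v' i \<in> carrier G" "p i \<in> carrier G" using vv[OF i] V(2) p[OF i] by auto
        have "X (P0 i) \<eta> \<le> harnack * \<psi> x0 (act (\<theta>n (fst (P0 i)) (snd (P0 i))) \<eta>)"
          unfolding X_def split_def
          by (intro \<psi>_harnack P_in P0 i act_in cocycle_closed \<eta>)
        also have "\<dots> = harnack * \<psi> x0 (act (v i) (act (p i) (act (v' i) \<eta>)))"
          using \<theta>P[OF i] c \<eta> by (simp add: act_mult act_in)
        also have "\<dots> \<le> (\<Sum>a'\<in>V. harnack * \<psi> x0 (act (v i) (act (p i) (act a' \<eta>))))"
          using vv[OF i] V(1) nn[OF i] harnack_ge_1
          by (intro member_le_sum[of "v' i" V "\<lambda>a'. harnack * \<psi> x0 (act (v i) (act (p i) (act a' \<eta>)))"]) auto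
        also have "\<dots> \<le> (\<Sum>a\<in>V. \<Sum>a'\<in>V. harnack * \<psi> x0 (act a (act (p i) (act a' \<eta>))))"
          using vv[OF i] V(1) nn[OF i] harnack_ge_1
          by (intro member_le_sum[of "v i" V "\<lambda>a. \<Sum>a'\<in>V. harnack * \<psi> x0 (act a (act (p i) (act a' \<eta>)))"])
            (auto intro!: sum_nonneg mult_nonneg_nonneg)
        finally show ?thesis .
      qed
      then have "(\<Sum>i\<in>I. X (P0 i) \<eta>) \<le> (\<Sum>i\<in>I. \<Sum>a\<in>V. \<Sum>a'\<in>V. harnack * \<psi> x0 (act a (act (p i) (act a' \<eta>))))"
        by (rule sum_mono)
      also have "\<dots> = (\<Sum>a\<in>V. \<Sum>i\<in>I. \<Sum>a'\<in>V. harnack * \<psi> x0 (act a (act (p i) (act a' \<eta>))))"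
        by (rule sum.swap)
      also have "\<dots> = (\<Sum>a\<in>V. \<Sum>a'\<in>V. \<Sum>i\<in>I. harnack * \<psi> x0 (act a (act (p i) (act a' \<eta>))))"
        by (intro sum.cong refl sum.swap)
      also have "\<dots> = harnack * (\<Sum>a\<in>V. \<Sum>a'\<in>V. ?A a a' \<eta>)"
        by (simp only: sum_distrib_left)
      finally show "\<bar>\<Sum>i\<in>I. X (P0 i) \<eta>\<bar> \<le> harnack * (\<Sum>a\<in>V. \<Sum>a'\<in>V. ?A a a' \<eta>)"
        using sum_nonneg[of I "\<lambda>i. X (P0 i) \<eta>"] nnX by simp
    qed
  qed
  have "l2_bounded Y (\<lambda>\<eta>. (\<Sum>q\<in>P. (w q - \<epsilon> * cnt q) * X q \<eta>) + \<epsilon> * (\<Sum>i\<in>I. X (P0 i) \<eta>))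
    ((\<Sum>q\<in>P. (w q - \<epsilon> * cnt q) * (B * hh q)) + \<epsilon> * (real (card I) * (lo / 2) * B))"
    by (intro l2_bounded_add part1 l2_bounded_cmult_nonneg part2 \<epsilon>)
  moreover have "(\<Sum>q\<in>P. (w q - \<epsilon> * cnt q) * X q \<eta>) + \<epsilon> * (\<Sum>i\<in>I. X (P0 i) \<eta>) = (\<Sum>n\<le>N. twisted_sum n \<psi> x \<eta> / z ^ n)" for \<eta>
    unfolding sumP count[of "\<lambda>q. X q \<eta>", symmetric]
    by (simp add: left_diff_distrib sum_subtractf sum_distrib_left mult.assoc)
  ultimately have main: "l2_bounded Y (\<lambda>\<eta>. \<Sum>n\<le>N. twisted_sum n \<psi> x \<eta> / z ^ n)
    ((\<Sum>q\<in>P. (w q - \<epsilon> * cnt q) * (B * hh q)) + \<epsilon> * (real (card I) * (lo / 2) * B))"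
    by simp
  show ?thesis
  proof (rule l2_bounded_weaken[OF main])
    have "real (card I) * lo = (\<Sum>i\<in>I. lo)" by simp
    also have "\<dots> \<le> (\<Sum>i\<in>I. hh (P0 i))"
      using h(1) P_in P0(1) by (intro sum_mono) (auto simp: hh_def split_def)
    finally have "\<epsilon> * (real (card I) * lo) \<le> \<epsilon> * (\<Sum>i\<in>I. hh (P0 i))" using \<epsilon>(1) by (rule mult_left_mono)
    then have hl: "\<delta>0 * lo \<le> \<epsilon> * (\<Sum>i\<in>I. hh (P0 i))" using \<epsilon>(2) by (simp flip: mult.assoc)
    have "(\<Sum>q\<in>P. (w q - \<epsilon> * cnt q) * (B * hh q)) = B * ((\<Sum>q\<in>P. w q * hh q) - \<epsilon> * (\<Sum>i\<in>I. hh (P0 i)))"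
      unfolding count[of hh, symmetric] sum_distrib_left sum_subtractf[symmetric]
      by (intro sum.cong refl) (simp add: algebra_simps)
    also have "\<dots> \<le> B * ((\<Sum>q\<in>P. w q * hh q) - \<delta>0 * lo)" using hl B(1) by (intro mult_left_mono) auto
    finally have "(\<Sum>q\<in>P. (w q - \<epsilon> * cnt q) * (B * hh q)) \<le> B * ((\<Sum>q\<in>P. w q * hh q) - \<delta>0 * lo)" .
    moreover have "\<epsilon> * (real (card I) * (lo / 2) * B) = \<delta>0 * lo / 2 * B"
      using \<epsilon>(2) by (simp flip: mult.assoc)
    moreover have "B * (W - d) + d / 2 * B = B * (W - d / 2)" for W d
      by (simp add: field_simps)
    ultimately show "(\<Sum>q\<in>P. (w q - \<epsilon> * cnt q) * (B * hh q)) + \<epsilon> * (real (card I) * (lo / 2) * B)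
      \<le> B * ((\<Sum>n\<le>N. (\<Sum>y\<in>preimages n x. weight n y * h y) / z ^ n) - \<delta>0 * lo / 2)"
      unfolding sumh by (metis (no_types, lifting) add_right_mono)
  qed
qed

text \<open>After averaging over the path lengths \<open>n \<le> N\<close>, the truncated Green function is
  bounded by itself with a factor smaller than 1, uniformly in the truncation. The constants are
  chosen in this order: \<open>lo\<close>, \<open>hi\<close> and \<open>V\<close> determine \<open>\<delta>\<close>, which determines \<open>I\<close>, hence \<open>N\<close>, hence
  the gain. Only then is \<open>z < radius\<close> chosen, so close to \<open>radius\<close> that the gain survives.\<close>

lemma nonamenable_contraction:
  assumes vis: "visibility_property \<Sigma> G \<theta>" and na: "\<not> amenable_action G Y act"
  obtains z C where "0 < z" "z < radius" "C \<ge> 0"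
    "\<And>f B n x. \<lbrakk>\<And>\<eta>. \<eta> \<in> Y \<Longrightarrow> f \<eta> \<ge> 0; l2_bounded Y f B; x \<in> \<Sigma>\<rbrakk>
       \<Longrightarrow> l2_bounded Y (twisted_sum n (\<lambda>_. f) x) (C * z ^ n * B)"
proof -
  obtain lo hi where lohi: "0 < lo" "lo \<le> hi"
    and super: "\<And>s. s > 1 \<Longrightarrow> \<exists>h. \<forall>x\<in>\<Sigma>. lo \<le> h x \<and> h x \<le> hi \<and>
       (\<Sum>y\<in>preimages 1 x. F y * h y) \<le> radius * s * h x"
    by (rule superharmonic_functions, rule that)
  obtain V where V: "finite V" "V \<subseteq> carrier G"
    and Vpaths: "\<And>g. g \<in> carrier G \<Longrightarrow> \<exists>N. \<forall>x0\<in>\<Sigma>. \<forall>x\<in>\<Sigma>. \<exists>m\<le>N. \<exists>y\<in>preimages m x.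
       agree M y x0 \<and> (\<exists>v\<in>V. \<exists>v'\<in>V. \<theta>n m y = v \<otimes>\<^bsub>G\<^esub> g \<otimes>\<^bsub>G\<^esub> v')"
    by (rule visibility_paths[OF vis], rule that)
  define c2 where "c2 = (real (card V))\<^sup>2 + 1"
  define \<delta> where "\<delta> = lo / (2 * hi * harnack * c2)"
  have hi: "hi > 0" using lohi by linarith
  have hk: "harnack > 0" using harnack_ge_1 by linarith
  have V2: "c2 > 0" using zero_le_power2[of "real (card V)"] unfolding c2_def by linarith
  have \<delta>: "\<delta> > 0" unfolding \<delta>_def using lohi(1) hi hk V2 by simp
  have \<delta>le: "harnack * (real (card V))\<^sup>2 * \<delta> * hi \<le> lo / 2"
  proof -
    have "harnack * (real (card V))\<^sup>2 * \<delta> * hi \<le> harnack * c2 * \<delta> * hi"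
      using \<delta> hi hk by (intro mult_right_mono mult_left_mono) (auto simp: c2_def)
    also have "\<dots> = lo / 2" unfolding \<delta>_def using hi hk V2 by simp
    finally show ?thesis .
  qed
  obtain I :: "'g list set" and p where I: "finite I" "I \<noteq> {}" and p: "\<And>i. i \<in> I \<Longrightarrow> p i \<in> carrier G"
    and avg: "\<And>f B. l2_bounded Y f B \<Longrightarrow> l2_bounded Y (\<lambda>\<eta>. \<Sum>i\<in>I. f (act (p i) \<eta>)) (\<delta> * real (card I) * B)"
  proof (rule nonamenable_small_average[OF na \<delta>])
    fix I :: "'g list set" and p
    assume "finite I" "I \<noteq> {}" "\<And>i. i \<in> I \<Longrightarrow> p i \<in> carrier G"
      "\<And>f B. l2_bounded Y f B \<Longrightarrow> l2_bounded Y (\<lambda>\<eta>. \<Sum>i\<in>I. f (act (p i) \<eta>)) (\<delta> * real (card I) * B)"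
    then show thesis by (rule that)
  qed
  have "\<forall>i\<in>I. \<exists>N. \<forall>x0\<in>\<Sigma>. \<forall>x\<in>\<Sigma>. \<exists>m\<le>N. \<exists>y\<in>preimages m x.
       agree M y x0 \<and> (\<exists>v\<in>V. \<exists>v'\<in>V. \<theta>n m y = v \<otimes>\<^bsub>G\<^esub> p i \<otimes>\<^bsub>G\<^esub> v')"
    using Vpaths[OF p] by (intro ballI)
  then obtain Nf where Nf: "\<forall>i\<in>I. \<forall>x0\<in>\<Sigma>. \<forall>x\<in>\<Sigma>. \<exists>m\<le>Nf i. \<exists>y\<in>preimages m x.
       agree M y x0 \<and> (\<exists>v\<in>V. \<exists>v'\<in>V. \<theta>n m y = v \<otimes>\<^bsub>G\<^esub> p i \<otimes>\<^bsub>G\<^esub> v')"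
    by (rule bchoice[THEN exE])
  define N where "N = Max (Nf ` I)"
  have paths: "\<exists>m\<le>N. \<exists>y\<in>preimages m x.
       agree M y x0 \<and> (\<exists>v\<in>V. \<exists>v'\<in>V. \<theta>n m y = v \<otimes>\<^bsub>G\<^esub> p i \<otimes>\<^bsub>G\<^esub> v')"
    if "i \<in> I" "x0 \<in> \<Sigma>" "x \<in> \<Sigma>" for i x0 x
  proof -
    have "Nf i \<le> N" unfolding N_def using I(1) that(1) by (intro Max_ge) auto
    moreover have "\<exists>m\<le>Nf i. \<exists>y\<in>preimages m x.
       agree M y x0 \<and> (\<exists>v\<in>V. \<exists>v'\<in>V. \<theta>n m y = v \<otimes>\<^bsub>G\<^esub> p i \<otimes>\<^bsub>G\<^esub> v')"
      using bspec[OF bspec[OF bspec[OF Nf that(1)] that(2)] that(3)] .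
    ultimately show ?thesis by (elim exE conjE) (rule exI, rule conjI, erule (1) order_trans, assumption)
  qed
  define u where "u = min 1 (exp (- b) / radius)"
  have u: "0 < u" "u \<le> 1" "u \<le> exp (- b) / radius" using radius_pos by (auto simp: u_def)
  define \<delta>0 where "\<delta>0 = u ^ N"
  have \<delta>0: "\<delta>0 > 0" using u by (simp add: \<delta>0_def)
  have weight_ge: "\<delta>0 \<le> weight m y / z ^ m"
    if "m \<le> N" "y \<in> preimages m x" "0 < z" "z \<le> radius" for m y x z
  proof -
    have "\<delta>0 \<le> u ^ m" unfolding \<delta>0_def using u that(1) by (intro power_decreasing) auto
    also have "\<dots> \<le> (exp (- b) / radius) ^ m" using u by (intro power_mono) auto
    also have "\<dots> \<le> exp (- b) ^ m / z ^ m"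
      unfolding power_divide using that radius_pos by (intro divide_left_mono power_mono mult_pos_pos) auto
    also have "\<dots> \<le> weight m y / z ^ m"
      using weight_lower[OF preimagesD(1)[OF that(2)]] that(3) by (intro divide_right_mono) auto
    finally show ?thesis .
  qed
  define n1 where "n1 = real (N + 1)"
  have n1: "n1 > 0" by (simp add: n1_def)
  define e where "e = \<delta>0 * lo / (2 * hi * n1)"
  have e: "e > 0" unfolding e_def using \<delta>0 lohi(1) hi n1 by simp
  obtain s where s: "1 < s" "s \<le> 2" "(s * s) ^ N \<le> 1 + e / 2"
    using exists_small_power_base[of "e / 2" N] e by auto
  obtain h where h: "\<And>x. x \<in> \<Sigma> \<Longrightarrow> lo \<le> h x \<and> h x \<le> hi"
    and hsup: "\<And>x. x \<in> \<Sigma> \<Longrightarrow> (\<Sum>y\<in>preimages 1 x. F y * h y) \<le> radius * s * h x"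
    using super[OF s(1)] by blast
  define z where "z = radius / s"
  have z: "0 < z" "z < radius" "radius / 2 \<le> z"
    unfolding z_def using radius_pos s by (auto simp: field_simps)
  define x0 where "x0 = (SOME x. x \<in> \<Sigma>)"
  have x0: "x0 \<in> \<Sigma>" unfolding x0_def using nonempty by (simp add: some_in_eq)
  define T where "T = (\<Sum>n\<le>N. \<Sum>i<n. sup_weight i / z ^ i)"
  have T: "T \<ge> 0" unfolding T_def using z(1) sup_weight_pos
    by (intro sum_nonneg divide_nonneg_nonneg) (auto intro: less_imp_le)
  define q where "q = max 0 (1 - e / 2)"
  have q: "0 \<le> q" "q < 1" using e by (auto simp: q_def)
  define C where "C = T / (n1 * lo) / (1 - q) * hi"
  have C: "C \<ge> 0" unfolding C_def using T lohi(1) hi q n1 by simp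
  have green_bound: "l2_bounded Y (green z J f x) (C * Bf)"
    if f: "\<And>\<eta>. \<eta> \<in> Y \<Longrightarrow> f \<eta> \<ge> 0" and Bf: "l2_bounded Y f Bf" and x: "x \<in> \<Sigma>" for f Bf x J
  proof -
    let ?\<psi> = "green z J f"
    have Bf0: "Bf \<ge> 0" using l2_bounded_nonneg[OF Bf] .
    define a where "a = T * Bf / (n1 * lo)"
    have a: "a \<ge> 0" unfolding a_def using T Bf0 lohi(1) n1 by simp
    define P where "P B \<longleftrightarrow> 0 \<le> B \<and> (\<forall>x\<in>\<Sigma>. l2_bounded Y (?\<psi> x) (B * h x))" for B
    have step: "P (a + q * B)" if PB: "P B" for B
      unfolding P_def
    proof (intro conjI ballI)
      have B: "B \<ge> 0" "\<And>y. y \<in> \<Sigma> \<Longrightarrow> l2_bounded Y (?\<psi> y) (B * h y)" using PB by (auto simp: P_def)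
      show "0 \<le> a + q * B" using a q B by simp
      fix x assume x: "x \<in> \<Sigma>"
      have hx: "h x > 0" using h[OF x] lohi(1) by linarith
      let ?W = "\<Sum>n\<le>N. (\<Sum>y\<in>preimages n x. weight n y * h y) / z ^ n"
      have gain: "l2_bounded Y (\<lambda>\<eta>. \<Sum>n\<le>N. twisted_sum n ?\<psi> x \<eta> / z ^ n) (B * (?W - \<delta>0 * lo / 2))"
      proof (rule path_gain[where I = I and p = p and V = V and ?x0.0 = x0 and \<delta> = \<delta> and hi = hi])
        show "finite I" "I \<noteq> {}" "finite V" "V \<subseteq> carrier G" by (fact I V)+
        show "p i \<in> carrier G" if "i \<in> I" for i using p[OF that] .
        show "l2_bounded Y (\<lambda>\<eta>. \<Sum>i\<in>I. f' (act (p i) \<eta>)) (\<delta> * real (card I) * B')"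
          if "l2_bounded Y f' B'" for f' B' using avg[OF that] .
        show "\<exists>m\<le>N. \<exists>y\<in>preimages m x.
           agree M y x0 \<and> (\<exists>v\<in>V. \<exists>v'\<in>V. \<theta>n m y = v \<otimes>\<^bsub>G\<^esub> p i \<otimes>\<^bsub>G\<^esub> v')" if "i \<in> I" for i
          using paths[OF that x0 x] .
        show "harnack * (real (card V))\<^sup>2 * \<delta> * hi \<le> lo / 2" by (fact \<delta>le)
        show "lo \<le> h y \<and> h y \<le> hi" if "y \<in> \<Sigma>" for y using h[OF that] .
        show "l2_bounded Y (?\<psi> y) (B * h y)" if "y \<in> \<Sigma>" for y using B(2)[OF that] .
        show "\<delta>0 \<le> weight m y / z ^ m" if "m \<le> N" "y \<in> preimages m x" for m y
          using weight_ge[OF that z(1)] z(2) by simp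
        show "0 \<le> ?\<psi> y \<eta>" if "y \<in> \<Sigma>" "\<eta> \<in> Y" for y \<eta> by (rule green_nonneg[where f = f, OF z(1) f that(2)])
        show "?\<psi> y \<eta> \<le> harnack * ?\<psi> x0 \<eta>" if "y \<in> \<Sigma>" "\<eta> \<in> Y" "agree M y x0" for y \<eta>
          by (rule green_harnack[where f = f, OF z(1) f that(2,1) x0 that(3)])
      qed (use \<delta>0 \<delta> x0 x z(1) lohi(1) B(1) in auto)
      have head: "l2_bounded Y (\<lambda>\<eta>. \<Sum>n\<le>N. \<Sum>i<n. (1 / z ^ i) * twisted_sum i (\<lambda>_. f) x \<eta>)
          (\<Sum>n\<le>N. \<Sum>i<n. (1 / z ^ i) * (sup_weight i * Bf))"
        using z(1) by (intro l2_bounded_sum l2_bounded_cmult_nonneg l2_bounded_twisted_const Bf x) auto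
      have headT: "(\<Sum>n\<le>N. \<Sum>i<n. (1 / z ^ i) * (sup_weight i * Bf)) = T * Bf"
        by (simp add: T_def sum_distrib_right)
      have avg_bound: "n1 * ?\<psi> x \<eta> \<le> (\<Sum>n\<le>N. \<Sum>i<n. (1 / z ^ i) * twisted_sum i (\<lambda>_. f) x \<eta>)
          + (\<Sum>n\<le>N. twisted_sum n ?\<psi> x \<eta> / z ^ n)" if "\<eta> \<in> Y" for \<eta>
        using sum_mono[of "{..N}" "\<lambda>_. ?\<psi> x \<eta>", OF green_iterate[where f = f and J = J, OF z(1) f that x]]
        by (simp add: sum.distrib n1_def)
      have "l2_bounded Y (\<lambda>\<eta>. 1 / n1 * ((\<Sum>n\<le>N. \<Sum>i<n. (1 / z ^ i) * twisted_sum i (\<lambda>_. f) x \<eta>)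
          + (\<Sum>n\<le>N. twisted_sum n ?\<psi> x \<eta> / z ^ n))) (1 / n1 * (T * Bf + B * (?W - \<delta>0 * lo / 2)))"
        using l2_bounded_add[OF head gain] unfolding headT by (rule l2_bounded_cmult_nonneg) (simp add: n1 less_imp_le)
      then have "l2_bounded Y (?\<psi> x) (1 / n1 * (T * Bf + B * (?W - \<delta>0 * lo / 2)))"
      proof (rule l2_bounded_mono)
        fix \<eta> assume \<eta>: "\<eta> \<in> Y"
        show "\<bar>?\<psi> x \<eta>\<bar> \<le> 1 / n1 * ((\<Sum>n\<le>N. \<Sum>i<n. (1 / z ^ i) * twisted_sum i (\<lambda>_. f) x \<eta>)
          + (\<Sum>n\<le>N. twisted_sum n ?\<psi> x \<eta> / z ^ n))"
          using avg_bound[OF \<eta>] green_nonneg[where f = f and J = J and x = x, OF z(1) f \<eta>] n1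
          by (simp add: pos_le_divide_eq mult.commute)
      qed
      then show "l2_bounded Y (?\<psi> x) ((a + q * B) * h x)"
      proof (rule l2_bounded_weaken)
        have "?W \<le> (\<Sum>n\<le>N. (1 + e / 2) * h x)"
        proof (rule sum_mono)
          fix n assume n: "n \<in> {..N}"
          have "(\<Sum>y\<in>preimages n x. weight n y * h y) / z ^ n \<le> (radius * s) ^ n * h x / z ^ n"
            using z(1) radius_pos s(1) by (intro divide_right_mono superharmonic_iterate hsup x) auto
          also have "\<dots> = (s * s) ^ n * h x"
            using radius_pos s(1) by (simp add: z_def power_mult_distrib power_divide)
          also have "\<dots> \<le> (s * s) ^ N * h x"
            using n s(1) hx by (intro mult_right_mono power_increasing) (auto simp: less_1_mult less_imp_le)
          also have "\<dots> \<le> (1 + e / 2) * h x" using s(3) hx by (intro mult_right_mono) auto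
          finally show "(\<Sum>y\<in>preimages n x. weight n y * h y) / z ^ n \<le> (1 + e / 2) * h x" .
        qed
        then have W: "?W \<le> n1 * ((1 + e / 2) * h x)" by (simp add: n1_def)
        have "e * n1 * h x \<le> e * n1 * hi"
          using h[OF x] e n1 by (intro mult_left_mono) auto
        also have "\<dots> = \<delta>0 * lo / 2" unfolding e_def using hi n1 by simp
        finally have g: "e * n1 * h x \<le> \<delta>0 * lo / 2" .
        have "?W - \<delta>0 * lo / 2 \<le> n1 * ((1 - e / 2) * h x)"
          using W g by (simp add: algebra_simps)
        also have "\<dots> \<le> n1 * (q * h x)"
          using hx n1 by (intro mult_left_mono mult_right_mono) (auto simp: q_def)
        finally have "B * (?W - \<delta>0 * lo / 2) \<le> B * (n1 * (q * h x))"
          using B(1) by (intro mult_left_mono)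
        moreover have "T * Bf \<le> n1 * (a * h x)"
        proof -
          have "T * Bf = n1 * (a * lo)" unfolding a_def using lohi(1) n1 by simp
          also have "\<dots> \<le> n1 * (a * h x)"
            using h[OF x] a n1 by (intro mult_left_mono) auto
          finally show ?thesis .
        qed
        ultimately have "T * Bf + B * (?W - \<delta>0 * lo / 2) \<le> n1 * ((a + q * B) * h x)"
          by (simp add: algebra_simps)
        then show "1 / n1 * (T * Bf + B * (?W - \<delta>0 * lo / 2)) \<le> (a + q * B) * h x"
          using n1 by (simp add: pos_divide_le_eq mult.commute)
      qed
    qed
    have "P ((\<Sum>n\<le>J. (1 / z ^ n) * (sup_weight n * Bf)) / lo)"
      unfolding P_def
    proof (intro conjI ballI)
      let ?S = "\<Sum>n\<le>J. (1 / z ^ n) * (sup_weight n * Bf)"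
      have S: "?S \<ge> 0" using z(1) Bf0 sup_weight_pos
        by (intro sum_nonneg mult_nonneg_nonneg) (auto intro: less_imp_le)
      then show "0 \<le> ?S / lo" using lohi(1) by simp
      fix x assume x: "x \<in> \<Sigma>"
      have "l2_bounded Y (\<lambda>\<eta>. \<Sum>n\<le>J. (1 / z ^ n) * twisted_sum n (\<lambda>_. f) x \<eta>) ?S"
        using z(1) by (intro l2_bounded_sum l2_bounded_cmult_nonneg l2_bounded_twisted_const Bf x) auto
      moreover have "?S \<le> ?S / lo * h x"
        using mult_left_mono[of lo "h x" "?S / lo"] h[OF x] S lohi(1) by simp
      ultimately show "l2_bounded Y (?\<psi> x) (?S / lo * h x)"
        using l2_bounded_weaken by (simp add: green_def[abs_def])
    qed
    from iterate_contraction[OF q this step] obtain Bs where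
      Bs: "\<And>n. P (Bs n)" "Bs \<longlonglongrightarrow> a / (1 - q)" by blast
    have "l2_bounded Y (?\<psi> x) (a / (1 - q) * h x)"
    proof (rule l2_bounded_limit_bound[where B = "\<lambda>n. Bs n * h x"])
      show "l2_bounded Y (?\<psi> x) (Bs n * h x)" for n using Bs(1)[of n] x by (simp add: P_def)
      show "(\<lambda>n. Bs n * h x) \<longlonglongrightarrow> a / (1 - q) * h x" by (intro tendsto_mult Bs tendsto_const)
    qed
    then show ?thesis
    proof (rule l2_bounded_weaken)
      have "a / (1 - q) * h x \<le> a / (1 - q) * hi" using h[OF x] a q by (intro mult_left_mono) auto
      also have "\<dots> = C * Bf" by (simp add: C_def a_def)
      finally show "a / (1 - q) * h x \<le> C * Bf" .
    qed
  qed
  show thesis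
  proof (rule that[OF z(1,2) C])
    fix f B n x assume f: "\<And>\<eta>. \<eta> \<in> Y \<Longrightarrow> (0::real) \<le> f \<eta>" and B: "l2_bounded Y f B" and x: "x \<in> \<Sigma>"
    have "l2_bounded Y (\<lambda>\<eta>. z ^ n * green z n f x \<eta>) (z ^ n * (C * B))"
    proof (rule l2_bounded_cmult_nonneg)
      show "l2_bounded Y (green z n f x) (C * B)" by (rule green_bound[OF _ B x]) (rule f)
    qed (use z(1) in simp)
    then have "l2_bounded Y (twisted_sum n (\<lambda>_. f) x) (z ^ n * (C * B))"
    proof (rule l2_bounded_mono)
      fix \<eta> assume \<eta>: "\<eta> \<in> Y"
      have nn: "0 \<le> twisted_sum i (\<lambda>_. f) x \<eta>" for i using f \<eta> by (intro twisted_sum_nonneg) auto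
      have "twisted_sum n (\<lambda>_. f) x \<eta> / z ^ n \<le> green z n f x \<eta>"
        unfolding green_def using nn z(1)
        by (intro member_le_sum[of n "{..n}" "\<lambda>n. twisted_sum n (\<lambda>_. f) x \<eta> / z ^ n"]) auto
      then show "\<bar>twisted_sum n (\<lambda>_. f) x \<eta>\<bar> \<le> z ^ n * green z n f x \<eta>"
        using nn z(1) by (simp add: field_simps)
    qed
    then show "l2_bounded Y (twisted_sum n (\<lambda>_. f) x) (C * z ^ n * B)" by (simp add: mult_ac)
  qed
qed

end


section \<open>The spectral gap\<close>

context twisted_shift
begin

lemma hoelder_bounded_sup:
  assumes "hoelder_bounded \<alpha> \<Sigma> Y \<Phi> s t" "0 \<le> s'"
    "\<And>x. x \<in> \<Sigma> \<Longrightarrow> l2_bounded Y (\<lambda>\<eta>. cmod (\<Phi> x \<eta>)) s'"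
  shows "hoelder_bounded \<alpha> \<Sigma> Y \<Phi> s' t"
proof (rule hoelder_boundedI)
  show "0 \<le> s'" "0 \<le> t" by (fact assms(2) hoelder_boundedD(2)[OF assms(1)])+
  show "\<Phi> x \<eta> = 0" if "x \<notin> \<Sigma> \<or> \<eta> \<notin> Y" for x \<eta> using hoelder_boundedD(3)[OF assms(1) that] .
  show "l2_bounded Y (\<lambda>\<eta>. cmod (\<Phi> x \<eta>)) s'" if "x \<in> \<Sigma>" for x using assms(3)[OF that] .
  show "l2_bounded Y (\<lambda>\<eta>. cmod (\<Phi> x \<eta> - \<Phi> x' \<eta>)) (t * hdist \<alpha> x x')" if "x \<in> \<Sigma>" "x' \<in> \<Sigma>" for x x'
    using hoelder_boundedD(5)[OF assms(1) that] .
qed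

text \<open>A Hoelder function is close to one that takes finitely many values \<open>\<Phi> c\<close>. The
  latter is dominated by the constant function with value \<open>\<Sum>c. \<bar>\<Phi> c\<bar>\<close>, to which the contraction
  applies.\<close>

lemma nonamenable_sup_decay:
  assumes vis: "visibility_property \<Sigma> G \<theta>" and na: "\<not> amenable_action G Y act" and \<epsilon>: "\<epsilon> > 0"
  shows "\<exists>n0. \<forall>n\<ge>n0. \<forall>\<Phi> B. bounded_by \<Phi> B \<longrightarrow>
    (\<forall>x\<in>\<Sigma>. l2_bounded Y (\<lambda>\<eta>. cmod ((L ^^ n) \<Phi> x \<eta>)) (\<epsilon> * radius ^ n * B))"
proof -
  obtain z C where z: "0 < z" "z < radius" and C: "C \<ge> 0"
    and contr: "\<And>f B n x. \<lbrakk>\<And>\<eta>. \<eta> \<in> Y \<Longrightarrow> (0::real) \<le> f \<eta>; l2_bounded Y f B; x \<in> \<Sigma>\<rbrakk>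
       \<Longrightarrow> l2_bounded Y (twisted_sum n (\<lambda>_. f) x) (C * z ^ n * B)"
  proof (rule nonamenable_contraction[OF vis na])
    fix z C assume "0 < z" "z < radius" "C \<ge> 0"
      "\<And>f B n x. \<lbrakk>\<And>\<eta>. \<eta> \<in> Y \<Longrightarrow> (0::real) \<le> f \<eta>; l2_bounded Y f B; x \<in> \<Sigma>\<rbrakk>
       \<Longrightarrow> l2_bounded Y (twisted_sum n (\<lambda>_. f) x) (C * z ^ n * B)"
    then show thesis by (rule that)
  qed
  have sc: "sup_const > 0" using sup_const(1) by linarith
  obtain k where k: "exp (- \<alpha>) ^ k < \<epsilon> / (2 * sup_const)"
    using real_arch_pow_inv[of "\<epsilon> / (2 * sup_const)" "exp (- \<alpha>)"] \<epsilon> sc alpha_pos by auto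
  have k': "sup_const * exp (- \<alpha> * real k) \<le> \<epsilon> / 2"
    using k sc by (simp add: exp_of_nat_mult[symmetric] field_simps)
  obtain R where R: "finite R" "R \<subseteq> \<Sigma>" "\<And>x. x \<in> \<Sigma> \<Longrightarrow> \<exists>c\<in>R. agree k x c"
    using finite_representatives by blast
  define m where "m = C * real (card R)"
  have m: "m \<ge> 0" using C by (simp add: m_def)
  have zr: "0 \<le> z / radius" "z / radius < 1" using z radius_pos by auto
  then obtain n0 where n0: "(z / radius) ^ n0 < \<epsilon> / (2 * (m + 1))"
    using real_arch_pow_inv[of "\<epsilon> / (2 * (m + 1))" "z / radius"] \<epsilon> m by auto
  show ?thesis
  proof (intro exI[of _ n0] allI impI ballI)
    fix n \<Phi> B x assume n: "n \<ge> n0" and \<Phi>: "bounded_by \<Phi> B" and x: "x \<in> \<Sigma>"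
    note D\<Phi> = hoelder_boundedD[OF \<Phi>]
    have B: "B \<ge> 0" using D\<Phi>(1) .
    have "\<forall>y\<in>\<Sigma>. \<exists>c. c \<in> R \<and> agree k y c" using R(3) by blast
    then obtain rep where rep: "\<forall>y\<in>\<Sigma>. rep y \<in> R \<and> agree k y (rep y)"
      by (rule bchoice[THEN exE])
    define e where "e y \<eta> = cmod (\<Phi> y \<eta> - \<Phi> (rep y) \<eta>)" for y \<eta>
    define f where "f \<eta> = (\<Sum>c\<in>R. cmod (\<Phi> c \<eta>))" for \<eta>
    have e_bound: "l2_bounded Y (e y) (B * exp (- \<alpha> * real k))" if y: "y \<in> \<Sigma>" for y
    proof -
      have r: "rep y \<in> \<Sigma>" "agree k y (rep y)" using rep y R(2) by auto
      show ?thesis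
        unfolding e_def using l2_bounded_weaken[OF D\<Phi>(5)[OF y r(1)]]
          mult_left_mono[OF hdist_le_if_agree[OF alpha_pos r(2)] B] by blast
    qed
    have f_bound: "l2_bounded Y f (real (card R) * B)"
    proof -
      have "l2_bounded Y (\<lambda>\<eta>. \<Sum>c\<in>R. cmod (\<Phi> c \<eta>)) (\<Sum>c\<in>R. B)"
        using R(2) by (intro l2_bounded_sum D\<Phi>(4)) blast
      then show ?thesis unfolding f_def[abs_def] by simp
    qed
    have "l2_bounded Y (twisted_sum n e x) (\<Sum>y\<in>preimages n x. weight n y * (B * exp (- \<alpha> * real k)))"
      by (intro l2_bounded_twisted_sum e_bound) (rule preimagesD)
    then have e2: "l2_bounded Y (twisted_sum n e x) (\<epsilon> / 2 * radius ^ n * B)"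
    proof (rule l2_bounded_weaken)
      have "(\<Sum>y\<in>preimages n x. weight n y * (B * exp (- \<alpha> * real k))) = weight_sum n x * (B * exp (- \<alpha> * real k))"
        by (simp add: weight_sum_def sum_distrib_right)
      also have "\<dots> \<le> sup_const * radius ^ n * (B * exp (- \<alpha> * real k))"
        using weight_sum_le[OF x, of n] le_radius[of n] B by (intro mult_right_mono) auto
      also have "\<dots> = sup_const * exp (- \<alpha> * real k) * (radius ^ n * B)" by (simp only: mult_ac)
      also have "\<dots> \<le> \<epsilon> / 2 * (radius ^ n * B)"
        using k' B radius_pos by (intro mult_right_mono) auto
      finally show "(\<Sum>y\<in>preimages n x. weight n y * (B * exp (- \<alpha> * real k))) \<le> \<epsilon> / 2 * radius ^ n * B"
        by (simp only: mult_ac)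
    qed
    have "l2_bounded Y (twisted_sum n (\<lambda>_. f) x) (C * z ^ n * (real (card R) * B))"
      by (rule contr[OF _ f_bound x]) (auto simp: f_def intro: sum_nonneg)
    then have f2: "l2_bounded Y (twisted_sum n (\<lambda>_. f) x) (\<epsilon> / 2 * radius ^ n * B)"
    proof (rule l2_bounded_weaken)
      have "m * (z / radius) ^ n \<le> (m + 1) * (z / radius) ^ n0"
        using m zr n by (intro mult_mono power_decreasing) auto
      also have "\<dots> \<le> \<epsilon> / 2" using n0 m by (simp add: field_simps)
      finally have "m * (z / radius) ^ n * (radius ^ n * B) \<le> \<epsilon> / 2 * (radius ^ n * B)"
        using B radius_pos by (intro mult_right_mono) auto
      moreover have "m * (z / radius) ^ n * (radius ^ n * B) = C * z ^ n * (real (card R) * B)"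
        using radius_pos by (simp add: m_def power_divide)
      ultimately have "C * z ^ n * (real (card R) * B) \<le> \<epsilon> / 2 * (radius ^ n * B)" by linarith
      then show "C * z ^ n * (real (card R) * B) \<le> \<epsilon> / 2 * radius ^ n * B" by (simp only: mult.assoc)
    qed
    have "l2_bounded Y (\<lambda>\<eta>. twisted_sum n e x \<eta> + twisted_sum n (\<lambda>_. f) x \<eta>)
        (\<epsilon> / 2 * radius ^ n * B + \<epsilon> / 2 * radius ^ n * B)"
      by (rule l2_bounded_add[OF e2 f2])
    then have s: "l2_bounded Y (\<lambda>\<eta>. twisted_sum n e x \<eta> + twisted_sum n (\<lambda>_. f) x \<eta>) (\<epsilon> * radius ^ n * B)"
      by (simp add: field_simps)
    then show "l2_bounded Y (\<lambda>\<eta>. cmod ((L ^^ n) \<Phi> x \<eta>)) (\<epsilon> * radius ^ n * B)"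
    proof (rule l2_bounded_mono)
      fix \<eta> assume \<eta>: "\<eta> \<in> Y"
      have "(L ^^ n) \<Phi> x \<eta> = twisted_sum n \<Phi> x \<eta>"
        using L_power_apply[of \<Phi> n x \<eta>] D\<Phi>(3) x \<eta> by auto
      then have "cmod ((L ^^ n) \<Phi> x \<eta>) \<le> twisted_sum n (\<lambda>y \<zeta>. cmod (\<Phi> y \<zeta>)) x \<eta>"
        using norm_twisted_sum_le[of n \<Phi> x \<eta>] by simp
      also have "\<dots> \<le> twisted_sum n (\<lambda>y \<zeta>. e y \<zeta> + f \<zeta>) x \<eta>"
      proof (rule twisted_sum_mono[OF \<eta>])
        fix y \<zeta> assume "y \<in> preimages n x"
        then have y: "y \<in> \<Sigma>" by (rule preimagesD)
        have "cmod (\<Phi> y \<zeta>) \<le> e y \<zeta> + cmod (\<Phi> (rep y) \<zeta>)"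
          unfolding e_def using norm_triangle_ineq[of "\<Phi> y \<zeta> - \<Phi> (rep y) \<zeta>" "\<Phi> (rep y) \<zeta>"] by simp
        moreover have "cmod (\<Phi> (rep y) \<zeta>) \<le> f \<zeta>"
          unfolding f_def using rep y R(1) by (intro member_le_sum) auto
        ultimately show "cmod (\<Phi> y \<zeta>) \<le> e y \<zeta> + f \<zeta>" by linarith
      qed
      also have "\<dots> = twisted_sum n e x \<eta> + twisted_sum n (\<lambda>_. f) x \<eta>"
        by (simp add: twisted_sum_def distrib_left sum.distrib)
      finally show "\<bar>cmod ((L ^^ n) \<Phi> x \<eta>)\<bar> \<le> twisted_sum n e x \<eta> + twisted_sum n (\<lambda>_. f) x \<eta>" by simp
    qed
  qed
qed

text \<open>The Lasota-Yorke inequality turns decay of the supremum norm after \<open>n\<close> steps into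
  decay of the Hoelder norm after \<open>2 * n\<close> steps.\<close>

lemma nonamenable_contracting_power:
  assumes vis: "visibility_property \<Sigma> G \<theta>" and na: "\<not> amenable_action G Y act"
  obtains m where "m \<ge> 1" "\<And>\<Phi> B. bounded_by \<Phi> B \<Longrightarrow> bounded_by ((L ^^ m) \<Phi>) (radius ^ m / 2 * B)"
proof -
  define A where "A = sup_const * (ly_const + 1)"
  have A: "A \<ge> 1"
    unfolding A_def using sup_const(1) ly_const_nonneg mult_mono[of 1 sup_const 1 "ly_const + 1"] by simp
  define \<epsilon> where "\<epsilon> = 1 / (4 * A)"
  have \<epsilon>: "\<epsilon> > 0" using A by (simp add: \<epsilon>_def)
  obtain n0 where n0: "\<forall>n\<ge>n0. \<forall>\<Phi> B. bounded_by \<Phi> B \<longrightarrow>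
    (\<forall>x\<in>\<Sigma>. l2_bounded Y (\<lambda>\<eta>. cmod ((L ^^ n) \<Phi> x \<eta>)) (\<epsilon> * radius ^ n * B))"
    using nonamenable_sup_decay[OF vis na \<epsilon>] by blast
  obtain n1 where n1: "exp (- \<alpha>) ^ n1 < 1 / (4 * sup_const * A)"
    using real_arch_pow_inv[of "1 / (4 * sup_const * A)" "exp (- \<alpha>)"] sup_const(1) A alpha_pos by auto
  define n where "n = max 1 (max n0 n1)"
  have n: "n \<ge> 1" "n \<ge> n0" "n \<ge> n1" by (auto simp: n_def)
  have "exp (- \<alpha> * real n) = exp (- \<alpha>) ^ n" by (simp add: exp_of_nat_mult[symmetric] mult.commute)
  also have "\<dots> \<le> exp (- \<alpha>) ^ n1" using n(3) alpha_pos by (intro power_decreasing) auto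
  finally have ex: "exp (- \<alpha> * real n) \<le> 1 / (4 * sup_const * A)" using n1 by linarith
  show thesis
  proof (rule that[of "n + n"])
    show "n + n \<ge> 1" using n(1) by simp
    fix \<Phi> B assume \<Phi>: "bounded_by \<Phi> B"
    have B: "B \<ge> 0" using hoelder_boundedD(1)[OF \<Phi>] .
    have r: "radius ^ n > 0" using radius_pos by simp
    let ?s = "\<epsilon> * radius ^ n * B" and ?t = "A * radius ^ n * B"
    have "hoelder_bounded \<alpha> \<Sigma> Y ((L ^^ n) \<Phi>) ?t ?t"
      unfolding A_def by (rule L_power_growth[OF \<Phi>])
    then have "hoelder_bounded \<alpha> \<Sigma> Y ((L ^^ n) \<Phi>) ?s ?t"
    proof (rule hoelder_bounded_sup)
      show "0 \<le> ?s" using \<epsilon> r B by simp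
      show "l2_bounded Y (\<lambda>\<eta>. cmod ((L ^^ n) \<Phi> x \<eta>)) ?s" if "x \<in> \<Sigma>" for x
        by (rule n0[rule_format, OF n(2) \<Phi> that])
    qed
    from lasota_yorke[OF this, of n]
    have h: "hoelder_bounded \<alpha> \<Sigma> Y ((L ^^ n) ((L ^^ n) \<Phi>)) (sup_weight n * ?s)
        (sup_weight n * (ly_const * ?s + exp (- \<alpha> * real n) * ?t))" .
    have s0: "?s \<ge> 0" "?t \<ge> 0" using \<epsilon> r B A by auto
    have key: "sup_weight n * (ly_const * ?s + ?s + exp (- \<alpha> * real n) * ?t) \<le> radius ^ (n + n) / 2 * B"
    proof -
      have "exp (- \<alpha> * real n) * ?t \<le> 1 / (4 * sup_const * A) * ?t"
        using ex s0(2) by (rule mult_right_mono)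
      also have "\<dots> = radius ^ n * B / (4 * sup_const)" using A by simp
      finally have t: "exp (- \<alpha> * real n) * ?t \<le> radius ^ n * B / (4 * sup_const)" .
      have "sup_const * (ly_const * ?s + ?s) = A * \<epsilon> * (radius ^ n * B)"
        by (simp add: A_def algebra_simps)
      also have "A * \<epsilon> = 1 / 4" using A by (simp add: \<epsilon>_def)
      finally have s: "sup_const * (ly_const * ?s + ?s) = radius ^ n * B / 4" by simp
      have "sup_weight n * (ly_const * ?s + ?s + exp (- \<alpha> * real n) * ?t)
        \<le> sup_const * radius ^ n * (ly_const * ?s + ?s + exp (- \<alpha> * real n) * ?t)"
        using le_radius[of n] s0 ly_const_nonneg by (intro mult_right_mono) auto
      also have "\<dots> = radius ^ n * (sup_const * (ly_const * ?s + ?s) + sup_const * (exp (- \<alpha> * real n) * ?t))"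
        by (simp only: distrib_left mult_ac)
      also have "\<dots> \<le> radius ^ n * (radius ^ n * B / 4 + sup_const * (radius ^ n * B / (4 * sup_const)))"
        unfolding s using t sup_const(1) r by (intro mult_left_mono add_left_mono) auto
      also have "\<dots> = radius ^ (n + n) / 2 * B"
        using sup_const(1) by (simp add: power_add)
      finally show ?thesis .
    qed
    have "sup_weight n * ?s \<le> sup_weight n * (ly_const * ?s + ?s + exp (- \<alpha> * real n) * ?t)"
      using s0 ly_const_nonneg sup_weight_pos[of n] by (intro mult_left_mono) auto
    moreover have "sup_weight n * (ly_const * ?s + exp (- \<alpha> * real n) * ?t)
        \<le> sup_weight n * (ly_const * ?s + ?s + exp (- \<alpha> * real n) * ?t)"
      using s0 sup_weight_pos[of n] by (intro mult_left_mono) auto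
    ultimately have "bounded_by ((L ^^ n) ((L ^^ n) \<Phi>)) (radius ^ (n + n) / 2 * B)"
      using hoelder_bounded_weaken[OF h] key by (meson order_trans)
    then show "bounded_by ((L ^^ (n + n)) \<Phi>) (radius ^ (n + n) / 2 * B)" by (simp add: funpow_add)
  qed
qed

lemma nonamenable_spectral_gap:
  assumes vis: "visibility_property \<Sigma> G \<theta>" and na: "\<not> amenable_action G Y act"
  obtains q where "0 \<le> q" "q < radius" "\<And>z. z \<in> op_spectrum H H_norm L \<Longrightarrow> cmod z \<le> q"
proof -
  obtain m where m: "m \<ge> 1"
    and half: "\<And>\<Phi> B. bounded_by \<Phi> B \<Longrightarrow> bounded_by ((L ^^ m) \<Phi>) (radius ^ m / 2 * B)"
    by (rule nonamenable_contracting_power[OF vis na], rule that)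
  define q where "q = root m (radius ^ m / 2)"
  have qm: "q ^ m = radius ^ m / 2" unfolding q_def using m radius_pos by simp
  have q: "q > 0" unfolding q_def using m radius_pos by simp
  have "q ^ m < radius ^ m" unfolding qm using radius_pos by simp
  then have qr: "q < radius" by (rule power_less_imp_less_base) (use radius_pos in simp)
  define A where "A j = sup_const * (ly_const + 1) * radius ^ j" for j
  define C where "C = (\<Sum>j<m. A j / q ^ j)"
  have A: "A j \<ge> 0" for j using sup_const(1) ly_const_nonneg radius_pos by (simp add: A_def)
  have C: "C \<ge> 0" unfolding C_def using A q by (intro sum_nonneg) auto
  have iter: "bounded_by ((L ^^ (i * m)) \<Phi>) (q ^ (i * m) * B)" if "bounded_by \<Phi> B" for i \<Phi> B
  proof (induction i)
    case (Suc i)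
    have "bounded_by ((L ^^ m) ((L ^^ (i * m)) \<Phi>)) (q ^ m * (q ^ (i * m) * B))"
      using half[OF Suc] unfolding qm .
    moreover have "(L ^^ m) ((L ^^ (i * m)) \<Phi>) = (L ^^ (Suc i * m)) \<Phi>" by (simp add: funpow_add)
    ultimately show ?case by (simp add: power_add mult.assoc)
  qed (use that in simp)
  show thesis
  proof (rule that[of q])
    fix z assume "z \<in> op_spectrum H H_norm L"
    then show "cmod z \<le> q"
    proof (rule spectrum_le_growth[rotated 3])
      show "0 \<le> q" "0 \<le> C" using q C by simp_all
      fix \<Phi> B n assume \<Phi>: "bounded_by \<Phi> B"
      have B: "B \<ge> 0" using hoelder_boundedD(1)[OF \<Phi>] .
      let ?i = "n div m" and ?j = "n mod m"
      have j: "?j < m" using m by simp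
      have "bounded_by ((L ^^ (?i * m)) ((L ^^ ?j) \<Phi>)) (q ^ (?i * m) * (A ?j * B))"
        by (rule iter) (unfold A_def, rule L_power_growth[OF \<Phi>])
      moreover have "(L ^^ (?i * m)) ((L ^^ ?j) \<Phi>) = (L ^^ n) \<Phi>"
        by (metis comp_apply funpow_add div_mult_mod_eq)
      moreover have "q ^ (?i * m) * (A ?j * B) \<le> C * q ^ n * B"
      proof -
        have "q ^ n = q ^ (?i * m) * q ^ ?j" by (metis power_add div_mult_mod_eq)
        then have "q ^ (?i * m) * A ?j = A ?j / q ^ ?j * q ^ n" using q by simp
        also have "\<dots> \<le> C * q ^ n"
          unfolding C_def using j A q by (intro mult_right_mono member_le_sum) auto
        finally have "q ^ (?i * m) * A ?j * B \<le> C * q ^ n * B" using B by (rule mult_right_mono)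
        then show ?thesis by (simp only: mult.assoc)
      qed
      ultimately show "bounded_by ((L ^^ n) \<Phi>) (C * q ^ n * B)"
        using hoelder_bounded_weaken by metis
    qed
  qed (use q qr in auto)
qed

lemma spectral_radius_le:
  assumes "0 \<le> q" "\<And>z. z \<in> op_spectrum H H_norm L \<Longrightarrow> cmod z \<le> q"
  shows "op_spectral_radius H H_norm L \<le> q"
  unfolding op_spectral_radius_def using assms by (intro cSup_least) auto

lemma spectral_radius_eq:
  assumes "complex_of_real radius \<in> op_spectrum H H_norm L"
  shows "op_spectral_radius H H_norm L = radius"
proof (rule antisym)
  show "op_spectral_radius H H_norm L \<le> radius"
    using radius_pos spectrum_le_radius by (intro spectral_radius_le) auto
  have "bdd_above (insert 0 (cmod ` op_spectrum H H_norm L))"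
    using spectrum_le_radius by (auto intro!: bdd_aboveI2[where M = radius])
  then show "radius \<le> op_spectral_radius H H_norm L"
    unfolding op_spectral_radius_def using assms radius_pos
    by (intro cSup_upper) (auto simp: image_iff intro!: bexI[of _ "complex_of_real radius"])
qed

lemma amenability_spectrum:
  assumes vis: "visibility_property \<Sigma> G \<theta>"
  shows "amenable_action G Y act \<longleftrightarrow> complex_of_real radius \<in> op_spectrum H H_norm L"
    and "complex_of_real radius \<in> op_spectrum H H_norm L \<longleftrightarrow> op_spectral_radius H H_norm L = radius"
proof -
  have "amenable_action G Y act" if "op_spectral_radius H H_norm L = radius"
  proof (rule ccontr)
    assume na: "\<not> amenable_action G Y act"
    obtain q where q: "0 \<le> q" "q < radius" "\<And>z. z \<in> op_spectrum H H_norm L \<Longrightarrow> cmod z \<le> q"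
      by (rule nonamenable_spectral_gap[OF vis na], rule that)
    show False using spectral_radius_le[OF q(1,3)] q(2) that by linarith
  qed
  then show "amenable_action G Y act \<longleftrightarrow> complex_of_real radius \<in> op_spectrum H H_norm L"
    and "complex_of_real radius \<in> op_spectrum H H_norm L \<longleftrightarrow> op_spectral_radius H H_norm L = radius"
    using amenable_imp_radius_in_spectrum spectral_radius_eq by blast+
qed

end


section \<open>The untwisted operator\<close>

lemma op_spectrum_transport:
  fixes j :: "'v::complex_vector \<Rightarrow> 'w::complex_vector"
  assumes ij: "\<And>v. i (j v) = v" and ji: "\<And>w. j (i w) = w"
    and mem: "\<And>v. v \<in> V \<longleftrightarrow> j v \<in> W" and nrm: "\<And>v. nW (j v) = nV v"
    and add: "\<And>u v. j (u + v) = j u + j v" and scale: "\<And>c v. j (c *\<^sub>C v) = c *\<^sub>C j v"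
    and T: "\<And>v. j (T v) = S (j v)"
    and z: "z \<in> op_spectrum V nV T"
  shows "z \<in> op_spectrum W nW S"
proof (rule ccontr)
  assume "z \<notin> op_spectrum W nW S"
  then obtain R where R: "bounded_operator W nW R"
    and inv: "\<And>w. w \<in> W \<Longrightarrow> R (z *\<^sub>C w - S w) = w \<and> z *\<^sub>C R w - S (R w) = w"
    unfolding op_spectrum_def by blast
  have diff: "j (u - v) = j u - j v" for u v
    using add[of "u - v" v] by simp
  have inj: "u = v" if "j u = j v" for u v using ij that by metis
  define Q where "Q v = i (R (j v))" for v
  have jQ: "j (Q v) = R (j v)" for v by (simp add: Q_def ji)
  obtain k where k: "\<And>w. w \<in> W \<Longrightarrow> nW (R w) \<le> k * nW w"
    using R unfolding bounded_operator_def by blast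
  have "bounded_operator V nV Q"
    unfolding bounded_operator_def
  proof (intro conjI ballI allI)
    show "Q v \<in> V" if "v \<in> V" for v
      using R that unfolding mem jQ bounded_operator_def by blast
    show "Q (u + v) = Q u + Q v" if "u \<in> V" "v \<in> V" for u v
      using R that unfolding mem bounded_operator_def by (intro inj) (simp add: jQ add)
    show "Q (c *\<^sub>C v) = c *\<^sub>C Q v" if "v \<in> V" for c v
      using R that unfolding mem bounded_operator_def by (intro inj) (simp add: jQ scale)
    show "\<exists>k. \<forall>v\<in>V. nV (Q v) \<le> k * nV v"
      using k by (intro exI[of _ k]) (simp add: mem jQ flip: nrm)
  qed
  moreover have "Q (z *\<^sub>C v - T v) = v \<and> z *\<^sub>C Q v - T (Q v) = v" if "v \<in> V" for v
  proof
    have w: "j v \<in> W" using that mem by blast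
    show "Q (z *\<^sub>C v - T v) = v" using inv[OF w] by (intro inj) (simp add: jQ diff scale T)
    show "z *\<^sub>C Q v - T (Q v) = v" using inv[OF w] by (intro inj) (simp add: jQ diff scale T)
  qed
  ultimately show False using z unfolding op_spectrum_def by blast
qed

lemma group_action_unit:
  assumes "group G"
  shows "group_action G {()} (\<lambda>_ _. ())"
proof -
  have eq: "f = g" for f g :: "unit \<Rightarrow> unit" by (rule ext) simp
  have "(\<lambda>_. ()) \<in> Bij {()}"
    by (auto simp: Bij_def extensional_def bij_betw_def inj_on_def)
  then have "(\<lambda>_ _. ()) \<in> hom G (BijGroup {()})"
    by (intro homI) (auto simp: BijGroup_def intro: eq)
  then show ?thesis
    unfolding group_action_def group_hom_def group_hom_axioms_def
    using assms group_BijGroup by blast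
qed

lemma ell2_unit: "\<phi> \<in> ell2 {()}" "ell2_norm {()} \<phi> = cmod (\<phi> ())"
  by (simp_all add: ell2_def ell2_norm_def)

lemma amenable_unit:
  "amenable_action G {()} (\<lambda>_ _. ())"
  unfolding amenable_action_def
proof (intro allI impI)
  fix S :: "'a set" and \<epsilon> :: real assume \<epsilon>: "\<epsilon> > 0"
  show "\<exists>\<phi>\<in>ell2 {()}. \<forall>s\<in>S. ell2_norm {()} (induced_rep G {()} (\<lambda>_ _. ()) s \<phi> - \<phi>) < \<epsilon> * ell2_norm {()} \<phi>"
    by (rule bexI[of _ "\<lambda>_. 1"]) (use \<epsilon> in \<open>simp_all add: ell2_unit induced_rep_def\<close>)
qed

text \<open>This identifies \<open>\<rho>\<close> as the spectral radius of a twisted operator, to which the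
  results for amenable actions apply.\<close>

lemma transfer_operator_spectrum:
  fixes G :: "('g, 'm) monoid_scheme"
  shows "op_spectrum (hoelder_space \<alpha> \<Sigma> UNIV cmod) (hoelder_norm_real \<alpha> \<Sigma> cmod) (transfer_operator \<Sigma> F)
    = op_spectrum (ell2_hoelder \<alpha> \<Sigma> {()}) (ell2_hoelder_norm \<alpha> \<Sigma> {()})
        (twisted_transfer_operator \<Sigma> F G {()} (\<lambda>_ _. ()) \<theta>)"
    (is "op_spectrum ?V ?nV ?T = op_spectrum ?W ?nW ?S")
proof -
  define j :: "('a word \<Rightarrow> complex) \<Rightarrow> 'a word \<Rightarrow> unit \<Rightarrow> complex" where "j \<Phi> = (\<lambda>x _. \<Phi> x)" for \<Phi>
  define i :: "('a word \<Rightarrow> unit \<Rightarrow> complex) \<Rightarrow> 'a word \<Rightarrow> complex" where "i \<Psi> = (\<lambda>x. \<Psi> x ())" for \<Psi>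
  have ij: "i (j \<Phi>) = \<Phi>" and ji: "j (i \<Psi>) = \<Psi>" for \<Phi> \<Psi> by (auto simp: i_def j_def)
  have norm: "hoelder_norm \<alpha> \<Sigma> (ell2_norm {()}) (j \<Phi>) = hoelder_norm \<alpha> \<Sigma> cmod \<Phi>" for \<Phi>
    by (simp add: hoelder_norm_def sup_norm_def hoelder_seminorm_def ell2_unit j_def)
  have mem: "\<Phi> \<in> ?V \<longleftrightarrow> j \<Phi> \<in> ?W" for \<Phi>
    unfolding hoelder_space_def mem_Collect_eq norm by (auto simp: ell2_unit j_def fun_eq_iff)
  have nrm: "?nW (j \<Phi>) = ?nV \<Phi>" for \<Phi> by (simp add: hoelder_norm_real_def norm)
  have add: "j (\<Phi> + \<Psi>) = j \<Phi> + j \<Psi>" and scale: "j (c *\<^sub>C \<Phi>) = c *\<^sub>C j \<Phi>" for \<Phi> \<Psi> c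
    by (auto simp: j_def fun_eq_iff scaleC_fun_def)
  have iadd: "i (\<Phi> + \<Psi>) = i \<Phi> + i \<Psi>" and iscale: "i (c *\<^sub>C \<Phi>) = c *\<^sub>C i \<Phi>" for \<Phi> \<Psi> c
    by (auto simp: i_def fun_eq_iff scaleC_fun_def)
  have T: "j (?T \<Phi>) = ?S (j \<Phi>)" for \<Phi>
    by (auto simp: j_def fun_eq_iff transfer_operator_def twisted_transfer_operator_def
        sum_apply scaleC_fun_def scaleC_complex_def induced_rep_def)
  have iT: "i (?S \<Psi>) = ?T (i \<Psi>)" for \<Psi> using T[of "i \<Psi>"] ij ji by metis
  show ?thesis
  proof (intro equalityI subsetI)
    show "z \<in> op_spectrum ?W ?nW ?S" if "z \<in> op_spectrum ?V ?nV ?T" for z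
      by (rule op_spectrum_transport[OF ij ji mem nrm add scale T that])
    show "z \<in> op_spectrum ?V ?nV ?T" if "z \<in> op_spectrum ?W ?nW ?S" for z
      by (rule op_spectrum_transport[OF ji ij _ _ iadd iscale iT that]) (simp_all add: mem ji flip: nrm)
  qed
qed


section \<open>Amenability and the spectral radius\<close>

theorem theoremA25:
  fixes \<Sigma> :: "'a::finite word set"
    and F :: "'a word \<Rightarrow> real"
    and \<alpha> :: real
    and G :: "('g, 'm) monoid_scheme"
    and \<theta> :: "'a word \<Rightarrow> 'g"
    and Y :: "'y set"
    and act :: "'g \<Rightarrow> 'y \<Rightarrow> 'y"
  assumes "subshift \<Sigma>" and "finite_type \<Sigma>" and "irreducible_shift \<Sigma>"
    and "\<alpha> > 0"
    and "\<forall>x\<in>\<Sigma>. F x > 0"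
    and "bounded_hoelder_variations \<alpha> \<Sigma> F"
    and "finitely_generated_group G"
    and "\<theta> \<in> \<Sigma> \<rightarrow> carrier G"
    and "locally_constant_on \<Sigma> \<theta>"
    and "visibility_property \<Sigma> G \<theta>"
    and "group_action G Y act"
  defines "\<rho> \<equiv> op_spectral_radius (hoelder_space \<alpha> \<Sigma> UNIV cmod) (hoelder_norm_real \<alpha> \<Sigma> cmod)
                 (transfer_operator \<Sigma> F)"
    and "H \<equiv> hoelder_space \<alpha> \<Sigma> (ell2 Y) (ell2_norm Y)"
    and "H_norm \<equiv> hoelder_norm_real \<alpha> \<Sigma> (ell2_norm Y)"
    and "L_rep \<equiv> twisted_transfer_operator \<Sigma> F G Y act \<theta>"
  shows "(amenable_action G Y act \<longleftrightarrow> complex_of_real \<rho> \<in> op_spectrum H H_norm L_rep) \<and>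
         (complex_of_real \<rho> \<in> op_spectrum H H_norm L_rep \<longleftrightarrow> op_spectral_radius H H_norm L_rep = \<rho>)"
proof -
  have cl: "closedin word_topology \<Sigma>" and inv: "shift ` \<Sigma> \<subseteq> \<Sigma>"
    using \<open>subshift \<Sigma>\<close> by (auto simp: subshift_def)
  have grp: "group G" using \<open>finitely_generated_group G\<close> by (simp add: finitely_generated_group_def)
  have ne: "\<Sigma> \<noteq> {}"
    using \<open>visibility_property \<Sigma> G \<theta>\<close> group.is_monoid[OF grp, THEN monoid.one_closed]
    unfolding visibility_property_def by blast
  obtain N where N: "\<And>x. x \<in> \<Sigma> \<longleftrightarrow> (\<forall>i. admissible_word \<Sigma> (subsequence x i (i + N)))"
    using \<open>finite_type \<Sigma>\<close> unfolding finite_type_def by blast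
  obtain M\<theta> where M\<theta>: "\<forall>x\<in>\<Sigma>. \<forall>y\<in>\<Sigma>. agree M\<theta> x y \<longrightarrow> \<theta> x = \<theta> y"
    using locally_constant_window[OF cl \<open>locally_constant_on \<Sigma> \<theta>\<close>] by blast
  define M where "M = max N M\<theta>"
  have glue: "glue n z x \<in> \<Sigma>" if "z \<in> \<Sigma>" "x \<in> \<Sigma>" "agree M (suffix n z) x" for n z x
    using glue_in_finite_type[OF inv N that(1,2)] agree_mono[OF that(3), of N] by (simp add: M_def)
  obtain K where K: "\<forall>z\<in>\<Sigma>. \<forall>x\<in>\<Sigma>. \<exists>k\<le>K. \<exists>y\<in>\<Sigma>. agree M y z \<and> suffix k y = x"
    using irreducible_connect_uniform[OF \<open>irreducible_shift \<Sigma>\<close> glue inv] by blast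
  obtain s t where st: "0 \<le> s" "0 \<le> t" "\<And>x. x \<in> \<Sigma> \<Longrightarrow> norm (ln (F x)) \<le> s"
    "\<And>x y. x \<in> \<Sigma> \<Longrightarrow> y \<in> \<Sigma> \<Longrightarrow> x \<noteq> y \<Longrightarrow> norm (ln (F x) - ln (F y)) \<le> t * hdist \<alpha> x y"
    using hoelder_norm_finite[OF \<open>bounded_hoelder_variations \<alpha> \<Sigma> F\<close>[unfolded bounded_hoelder_variations_def]]
    by metis
  have weighted: "weighted_shift \<Sigma> F \<alpha> (s + t) M K"
  proof
    show "\<bar>ln (F x)\<bar> \<le> s + t" if "x \<in> \<Sigma>" for x using st(3)[OF that] st(2) by simp
    show "\<bar>ln (F x) - ln (F y)\<bar> \<le> (s + t) * hdist \<alpha> x y" if "x \<in> \<Sigma>" "y \<in> \<Sigma>" for x y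
    proof (cases "x = y")
      case False
      have "\<bar>ln (F x) - ln (F y)\<bar> \<le> t * hdist \<alpha> x y" using st(4)[OF that False] by simp
      also have "\<dots> \<le> (s + t) * hdist \<alpha> x y" using st(1) by (intro mult_right_mono) auto
      finally show ?thesis .
    qed simp
  qed (use ne inv glue K st \<open>\<alpha> > 0\<close> \<open>\<forall>x\<in>\<Sigma>. F x > 0\<close> in auto)
  have window: "\<theta> x = \<theta> y" if "x \<in> \<Sigma>" "y \<in> \<Sigma>" "agree M x y" for x y
  proof -
    have "agree M\<theta> x y" by (rule agree_mono[OF that(3)]) (simp add: M_def)
    then show ?thesis using M\<theta> that(1,2) by blast
  qed
  interpret A: twisted_shift \<Sigma> F \<alpha> "s + t" M K G \<theta> Y act
    by (intro twisted_shift.intro weighted twisted_shift_axioms.intro)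
      (use \<open>group_action G Y act\<close> \<open>\<theta> \<in> \<Sigma> \<rightarrow> carrier G\<close> in \<open>auto intro: window\<close>)
  interpret U: twisted_shift \<Sigma> F \<alpha> "s + t" M K G \<theta> "{()}" "\<lambda>_ _. ()"
    by (intro twisted_shift.intro weighted twisted_shift_axioms.intro)
      (use group_action_unit[OF grp] \<open>\<theta> \<in> \<Sigma> \<rightarrow> carrier G\<close> in \<open>auto intro: window\<close>)
  have "\<rho> = A.radius"
    unfolding \<rho>_def
    using U.spectral_radius_eq[OF U.amenable_imp_radius_in_spectrum[OF amenable_unit]]
    unfolding op_spectral_radius_def transfer_operator_spectrum[of \<alpha> \<Sigma> F G \<theta>] .
  then show ?thesis
    unfolding H_def H_norm_def L_rep_def
    using A.amenability_spectrum[OF \<open>visibility_property \<Sigma> G \<theta>\<close>] by simp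
qed

end
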